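(* Let $G$ be a group, $H<G$ a subgroup, and let $\boldsymbol{H}=\mathrm{Comm}_G(H)$ be the commensurator of $H$ in $G$. Assume that $\boldsymbol{H}$ is countable. Then the canonical action of $H$ on its universal minimal proximal flow $\Pi(H)$ can be extended to an action $(\boldsymbol{H},\Pi(H))$. That is, there is a homomorphism $g\mapsto\hat g$ from $\boldsymbol{H}$ to $\mathrm{Homeo}(\Pi(H))$ such that: (i) $\hat g$ satisfies the equation $\hat g(tx)=(gtg^{-1})\hat g(x)$ for every $t\in H\cap g^{-1}Hg$ and $x\in\Pi(H)$; (ii) for $h\in H$ and $x\in\Pi(H)$ we have $\hat h(x)=h(x)$ (the canonical action of $h$ on $x$); (iii) for every $g\in\boldsymbol{H}$, $$(H,\Pi(H))\cong(H,\Pi(H_g))\cong(H^g,\Pi(H_g))\cong(H^g,\Pi(H^g)).$$ Analogous statements hold for $\Pi_s$ (the universal minimal strongly proximal flow) in place of $\Pi$.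
   Context: For $g\in G$ put $H^g=gHg^{-1}$ and $H_g=H\cap H^g$. The commensurator of $H$ in $G$ is $\mathrm{Comm}_G(H)=\{g\in G\mid H_g\text{ has finite index in both }H\text{ and }H^g\}$. A flow $(K,X)$ is a jointly continuous action $K\times X\to X$ of a (Hausdorff) topological group $K$ on a compact Hausdorff space $X$. It is minimal if every orbit is dense; proximal if for all $x,y\in X$ there is a net $\{t_n\}$ in $K$ with $\lim t_nx=\lim t_ny$; strongly proximal if the induced action of $K$ on the compact convex set $\mathcal M(X)$ of quasi-regular Borel probability measures on $X$ (weak-* topology) is proximal. $(K,\Pi(K))$ (respectively $(K,\Pi_s(K))$) denotes the universal minimal proximal (respectively universal minimal strongly proximal) flow of $K$: the minimal proximal (respectively minimal strongly proximal) flow, unique up to isomorphism, that has every minimal proximal (respectively minimal strongly proximal) flow of $K$ as a factor, i.e. as image under a continuous surjective $K$-equivariant map. $\mathrm{Homeo}(X)$ is the group of self-homeomorphisms of $X$. The symbol $\cong$ denotes isomorphism of flows; $(H,\Pi(H_g))$ and $(H^g,\Pi(H_g))$ denote $\Pi(H_g)$ with actions of $H$ and of $H^g$ extending the canonical action of $H_g$. *)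

theory Defs
  imports "HOL-Probability.Probability_Measure" "HOL-Algebra.Group_Action"
begin

no_notation eq_closure_of (\<open>closure'_of\<index>\<close>)

section \<open>Commensurators\<close>

definition conjugate_subgroup :: "('g, 'm) monoid_scheme \<Rightarrow> 'g \<Rightarrow> 'g set \<Rightarrow> 'g set"
  where "conjugate_subgroup G g H = (g <#\<^bsub>G\<^esub> H) #>\<^bsub>G\<^esub> inv\<^bsub>G\<^esub> g"

definition finite_index :: "('g, 'm) monoid_scheme \<Rightarrow> 'g set \<Rightarrow> 'g set \<Rightarrow> bool"
  where "finite_index G L H \<longleftrightarrow> L \<subseteq> H \<and> finite (rcosets\<^bsub>G\<lparr>carrier := H\<rparr>\<^esub> L)"

definition commensurator :: "('g, 'm) monoid_scheme \<Rightarrow> 'g set \<Rightarrow> 'g set"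
  where "commensurator G H =
    {g \<in> carrier G. finite_index G (H \<inter> conjugate_subgroup G g H) H \<and>
                    finite_index G (H \<inter> conjugate_subgroup G g H) (conjugate_subgroup G g H)}"


section \<open>Flows\<close>

definition topological_group :: "('g, 'm) monoid_scheme \<Rightarrow> 'g topology \<Rightarrow> bool"
  where "topological_group K T \<longleftrightarrow>
    group K \<and> topspace T = carrier K \<and> Hausdorff_space T \<and>
    continuous_map (prod_topology T T) T (\<lambda>(x, y). x \<otimes>\<^bsub>K\<^esub> y) \<and>
    continuous_map T T (\<lambda>x. inv\<^bsub>K\<^esub> x)"

text \<open>The phase space is required to be nonempty; otherwise the empty flow would be a minimal
  proximal flow and no nonempty flow could have it as a factor. In accordance with
  \<^const>\<open>BijGroup\<close>, the maps of a \<^const>\<open>group_action\<close> are extensional, i.e. undefined outside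
  the phase space.\<close>

definition flow ::
    "('g, 'm) monoid_scheme \<Rightarrow> 'g topology \<Rightarrow> 'x topology \<Rightarrow> ('g \<Rightarrow> 'x \<Rightarrow> 'x) \<Rightarrow> bool"
  where "flow K T X a \<longleftrightarrow>
    topological_group K T \<and>
    topspace X \<noteq> {} \<and> compact_space X \<and> Hausdorff_space X \<and>
    group_action K (topspace X) a \<and>
    continuous_map (prod_topology T X) X (\<lambda>(k, x). a k x)"

definition minimal_flow ::
    "('g, 'm) monoid_scheme \<Rightarrow> 'g topology \<Rightarrow> 'x topology \<Rightarrow> ('g \<Rightarrow> 'x \<Rightarrow> 'x) \<Rightarrow> bool"
  where "minimal_flow K T X a \<longleftrightarrow>
    flow K T X a \<and> (\<forall>x \<in> topspace X. X closure_of (orbit K a x) = topspace X)"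

text \<open>Nets in \<open>K\<close> are represented by proper filters \<open>F\<close> that contain \<open>carrier K\<close>: the filter
  of eventual sets of a net has the same limits as the net, and every such filter arises from
  a net.\<close>

definition proximal_action ::
    "('g, 'm) monoid_scheme \<Rightarrow> 'x topology \<Rightarrow> ('g \<Rightarrow> 'x \<Rightarrow> 'x) \<Rightarrow> bool"
  where "proximal_action K X a \<longleftrightarrow>
    (\<forall>x \<in> topspace X. \<forall>y \<in> topspace X. \<exists>F z.
       F \<noteq> bot \<and> eventually (\<lambda>k. k \<in> carrier K) F \<and>
       limitin X (\<lambda>k. a k x) z F \<and> limitin X (\<lambda>k. a k y) z F)"

definition flow_factor_map ::
    "('g, 'm) monoid_scheme \<Rightarrow> 'x topology \<Rightarrow> ('g \<Rightarrow> 'x \<Rightarrow> 'x) \<Rightarrow>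
     'y topology \<Rightarrow> ('g \<Rightarrow> 'y \<Rightarrow> 'y) \<Rightarrow> ('x \<Rightarrow> 'y) \<Rightarrow> bool"
  where "flow_factor_map K X a Y b f \<longleftrightarrow>
    continuous_map X Y f \<and> f ` topspace X = topspace Y \<and>
    (\<forall>k \<in> carrier K. \<forall>x \<in> topspace X. f (a k x) = b k (f x))"

definition flow_isomorphic_along ::
    "('g \<Rightarrow> 'h) \<Rightarrow> ('g, 'm) monoid_scheme \<Rightarrow> 'x topology \<Rightarrow> ('g \<Rightarrow> 'x \<Rightarrow> 'x) \<Rightarrow>
     ('h, 'n) monoid_scheme \<Rightarrow> 'y topology \<Rightarrow> ('h \<Rightarrow> 'y \<Rightarrow> 'y) \<Rightarrow> bool"
  where "flow_isomorphic_along \<phi> K X a L Y b \<longleftrightarrow>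
    \<phi> \<in> iso K L \<and>
    (\<exists>f. homeomorphic_map X Y f \<and>
         (\<forall>k \<in> carrier K. \<forall>x \<in> topspace X. f (a k x) = b (\<phi> k) (f x)))"

abbreviation flow_isomorphic ::
    "('g, 'm) monoid_scheme \<Rightarrow> 'x topology \<Rightarrow> ('g \<Rightarrow> 'x \<Rightarrow> 'x) \<Rightarrow>
     'y topology \<Rightarrow> ('g \<Rightarrow> 'y \<Rightarrow> 'y) \<Rightarrow> bool"
  where "flow_isomorphic K X a Y b \<equiv> flow_isomorphic_along (\<lambda>k. k) K X a K Y b"

definition extends_action ::
    "'g set \<Rightarrow> 'x topology \<Rightarrow> ('g \<Rightarrow> 'x \<Rightarrow> 'x) \<Rightarrow> ('g \<Rightarrow> 'x \<Rightarrow> 'x) \<Rightarrow> bool"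
  where "extends_action L X b a \<longleftrightarrow> (\<forall>k \<in> L. \<forall>x \<in> topspace X. b k x = a k x)"

definition homeo_group :: "'x topology \<Rightarrow> ('x \<Rightarrow> 'x) monoid"
  where "homeo_group X =
    (BijGroup (topspace X))\<lparr>carrier := {f \<in> Bij (topspace X). homeomorphic_map X X f}\<rparr>"


section \<open>Strong proximality\<close>

definition borel_algebra :: "'x topology \<Rightarrow> 'x measure"
  where "borel_algebra X = sigma (topspace X) {U. openin X U}"

text \<open>Quasi-regularity: outer regularity on Borel sets, inner regularity (with respect to
  compact sets) on open sets.\<close>

definition quasi_regular :: "'x topology \<Rightarrow> 'x measure \<Rightarrow> bool"
  where "quasi_regular X \<mu> \<longleftrightarrow>
    (\<forall>A \<in> sets \<mu>. emeasure \<mu> A = (INF U \<in> {U. openin X U \<and> A \<subseteq> U}. emeasure \<mu> U)) \<and>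
    (\<forall>U. openin X U \<longrightarrow>
       emeasure \<mu> U = (SUP C \<in> {C. compactin X C \<and> C \<subseteq> U \<and> C \<in> sets \<mu>}. emeasure \<mu> C))"

definition prob_measures :: "'x topology \<Rightarrow> 'x measure set"
  where "prob_measures X =
    {\<mu>. prob_space \<mu> \<and> space \<mu> = topspace X \<and> sets \<mu> = sets (borel_algebra X) \<and> quasi_regular X \<mu>}"

definition weak_star_topology :: "'x topology \<Rightarrow> 'x measure topology"
  where "weak_star_topology X = topology_generated_by
    {{\<mu> \<in> prob_measures X. integral\<^sup>L \<mu> f \<in> U} | f U. continuous_map X euclideanreal f \<and> open U}"

definition induced_action :: "'x topology \<Rightarrow> ('g \<Rightarrow> 'x \<Rightarrow> 'x) \<Rightarrow> 'g \<Rightarrow> 'x measure \<Rightarrow> 'x measure"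
  where "induced_action X a k \<mu> = distr \<mu> (borel_algebra X) (a k)"

definition strongly_proximal_action ::
    "('g, 'm) monoid_scheme \<Rightarrow> 'x topology \<Rightarrow> ('g \<Rightarrow> 'x \<Rightarrow> 'x) \<Rightarrow> bool"
  where "strongly_proximal_action K X a \<longleftrightarrow>
    proximal_action K (weak_star_topology X) (induced_action X a)"


section \<open>Universal flows\<close>

text \<open>A quantifier inside a definition ranges over a fixed type. Every minimal flow of a group
  with elements in \<open>'g\<close> is isomorphic to one whose points lie in \<open>'g set set\<close>, since a point
  \<open>y\<close> is determined by the sets \<open>A\<close> of group elements with \<open>y\<close> in the closure of \<open>A y\<^sub>0\<close>.
  Hence testing universality against flows on \<open>'g set set\<close> is no restriction; see
  \<open>universal_minimal_proximal_flow_factor\<close> and \<open>universal_minimal_strongly_proximal_flow_factor\<close>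
  below.\<close>

definition universal_minimal_proximal_flow ::
    "('g, 'm) monoid_scheme \<Rightarrow> 'g topology \<Rightarrow> 'x topology \<Rightarrow> ('g \<Rightarrow> 'x \<Rightarrow> 'x) \<Rightarrow> bool"
  where "universal_minimal_proximal_flow K T X a \<longleftrightarrow>
    minimal_flow K T X a \<and> proximal_action K X a \<and>
    (\<forall>(Y :: 'g set set topology) b.
       minimal_flow K T Y b \<and> proximal_action K Y b \<longrightarrow> (\<exists>f. flow_factor_map K X a Y b f))"

definition universal_minimal_strongly_proximal_flow ::
    "('g, 'm) monoid_scheme \<Rightarrow> 'g topology \<Rightarrow> 'x topology \<Rightarrow> ('g \<Rightarrow> 'x \<Rightarrow> 'x) \<Rightarrow> bool"
  where "universal_minimal_strongly_proximal_flow K T X a \<longleftrightarrow>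
    minimal_flow K T X a \<and> strongly_proximal_action K X a \<and>
    (\<forall>(Y :: 'g set set topology) b.
       minimal_flow K T Y b \<and> strongly_proximal_action K Y b \<longrightarrow>
       (\<exists>f. flow_factor_map K X a Y b f))"


subsection \<open>Independence of the test type\<close>

lemma orbit_image: "orbit K a x = (\<lambda>k. a k x) ` carrier K"
  by (auto simp: orbit_def)

definition transport_action ::
    "'y topology \<Rightarrow> ('x \<Rightarrow> 'y) \<Rightarrow> ('y \<Rightarrow> 'x) \<Rightarrow> ('g \<Rightarrow> 'x \<Rightarrow> 'x) \<Rightarrow> 'g \<Rightarrow> 'y \<Rightarrow> 'y"
  where "transport_action Y e e' a k = (\<lambda>y \<in> topspace Y. e (a k (e' y)))"

lemma flow_maps_to:
  assumes "flow K T X a" "k \<in> carrier K" "x \<in> topspace X"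
  shows "a k x \<in> topspace X"
  using assms by (auto simp: flow_def intro: group_action.element_image)

lemma flow_continuous:
  assumes "flow K T X a" "k \<in> carrier K"
  shows "continuous_map X X (a k)"
proof -
  have "continuous_map X (prod_topology T X) (\<lambda>x. (k, x))"
    using assms by (auto simp: flow_def topological_group_def continuous_map_pairedI)
  then have "continuous_map X X ((\<lambda>(k, x). a k x) \<circ> (\<lambda>x. (k, x)))"
    using assms(1) unfolding flow_def by (blast intro: continuous_map_compose)
  then show ?thesis by (simp add: o_def)
qed

context
  fixes X :: "'x topology" and Y :: "'y topology" and e e'
  assumes hm: "homeomorphic_maps X Y e e'"
begin

lemma hm_simps:
  "x \<in> topspace X \<Longrightarrow> e' (e x) = x" "y \<in> topspace Y \<Longrightarrow> e (e' y) = y"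
  "x \<in> topspace X \<Longrightarrow> e x \<in> topspace Y" "y \<in> topspace Y \<Longrightarrow> e' y \<in> topspace X"
  using hm by (auto simp: homeomorphic_maps_def continuous_map_def)

lemma hm_maps: "homeomorphic_map X Y e" "homeomorphic_map Y X e'"
  "continuous_map X Y e" "continuous_map Y X e'"
  using hm homeomorphic_maps_map homeomorphic_maps_sym
  by (auto simp: homeomorphic_maps_def intro: homeomorphic_maps_imp_map)

lemma hm_vimage:
  assumes "A \<subseteq> topspace Y"
  shows "e -` A \<inter> topspace X = e' ` A"
proof
  show "e -` A \<inter> topspace X \<subseteq> e' ` A"
  proof
    fix x assume "x \<in> e -` A \<inter> topspace X"
    then show "x \<in> e' ` A" using hm_simps(1)[of x] by (metis IntE image_eqI vimageE)
  qed
  show "e' ` A \<subseteq> e -` A \<inter> topspace X" using assms hm_simps(2,4) by fastforce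
qed

lemma flow_transport:
  assumes "flow K T X a"
  shows "flow K T Y (transport_action Y e e' a)"
proof -
  let ?b = "transport_action Y e e' a"
  interpret A: group_action K "topspace X" a using assms by (simp add: flow_def)
  have K: "group K" using assms by (simp add: flow_def topological_group_def)
  have in_X: "a k (e' y) \<in> topspace X" if "k \<in> carrier K" "y \<in> topspace Y" for k y
    by (rule A.element_image[OF that(1) hm_simps(4)[OF that(2)] refl])
  have Bij: "?b k \<in> Bij (topspace Y)" if k: "k \<in> carrier K" for k
  proof -
    have 1: "bij_betw (a k) (topspace X) (topspace X)"
      using A.bij_prop0 k by (auto simp: Bij_def)
    have 2: "bij_betw e' (topspace Y) (topspace X)" "bij_betw e (topspace X) (topspace Y)"
      unfolding bij_betw_def
      using homeomorphic_imp_injective_map[OF hm_maps(1)] homeomorphic_imp_injective_map[OF hm_maps(2)]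
        homeomorphic_imp_surjective_map[OF hm_maps(1)] homeomorphic_imp_surjective_map[OF hm_maps(2)]
      by blast+
    have "bij_betw (e \<circ> (a k \<circ> e')) (topspace Y) (topspace Y)"
      by (rule bij_betw_trans[OF bij_betw_trans[OF 2(1) 1] 2(2)])
    moreover have "(e \<circ> (a k \<circ> e')) y = ?b k y" if "y \<in> topspace Y" for y
      using that by (simp add: transport_action_def)
    ultimately have "bij_betw (?b k) (topspace Y) (topspace Y)"
      using bij_betw_cong[of "topspace Y" "e \<circ> (a k \<circ> e')" "?b k"] by blast
    then show ?thesis by (simp add: Bij_def transport_action_def)
  qed
  have "?b (k \<otimes>\<^bsub>K\<^esub> l) = compose (topspace Y) (?b k) (?b l)"
    if "k \<in> carrier K" "l \<in> carrier K" for k l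
  proof
    fix y
    show "?b (k \<otimes>\<^bsub>K\<^esub> l) y = compose (topspace Y) (?b k) (?b l) y"
    proof (cases "y \<in> topspace Y")
      case True
      have "a (k \<otimes>\<^bsub>K\<^esub> l) (e' y) = a k (a l (e' y))"
        by (rule A.composition_rule[OF hm_simps(4)[OF True] that])
      then show ?thesis
        using True hm_simps(1,3)[OF in_X[OF that(2) True]]
        by (simp add: transport_action_def compose_def)
    qed (simp add: transport_action_def compose_def)
  qed
  then have "?b \<in> hom K (BijGroup (topspace Y))"
    using Bij by (simp add: hom_def BijGroup_def)
  then have act: "group_action K (topspace Y) ?b"
    using K by (simp add: group_action_def group_hom_def group_hom_axioms_def group_BijGroup)
  have "continuous_map (prod_topology T Y) Y (\<lambda>p. e (a (fst p) (e' (snd p))))"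
  proof -
    have "continuous_map (prod_topology T Y) (prod_topology T X) (\<lambda>p. (fst p, e' (snd p)))"
      by (intro continuous_map_pairedI continuous_map_fst
          continuous_map_compose[OF continuous_map_snd hm_maps(4), unfolded o_def])
    moreover have "continuous_map (prod_topology T X) X (\<lambda>(k, x). a k x)"
      using assms by (simp add: flow_def)
    ultimately have "continuous_map (prod_topology T Y) Y
        (e \<circ> ((\<lambda>(k, x). a k x) \<circ> (\<lambda>p. (fst p, e' (snd p)))))"
      using hm_maps(3) by (blast intro: continuous_map_compose)
    then show ?thesis by (simp add: o_def)
  qed
  then have cont: "continuous_map (prod_topology T Y) Y (\<lambda>(k, y). ?b k y)"
    by (rule continuous_map_eq) (auto simp: transport_action_def)
  have "X homeomorphic_space Y" using hm homeomorphic_space_def by blast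
  then have "compact_space Y" "Hausdorff_space Y" "topspace Y \<noteq> {}"
    using assms homeomorphic_compact_space[of X Y] homeomorphic_Hausdorff_space[of X Y]
      homeomorphic_empty_space[of X Y] by (simp_all add: flow_def)
  with act cont assms show ?thesis by (simp add: flow_def)
qed

lemma minimal_flow_transport:
  assumes "minimal_flow K T X a"
  shows "minimal_flow K T Y (transport_action Y e e' a)"
  unfolding minimal_flow_def
proof (intro conjI ballI)
  have fl: "flow K T X a" using assms by (simp add: minimal_flow_def)
  show "flow K T Y (transport_action Y e e' a)" by (rule flow_transport[OF fl])
  fix y assume y: "y \<in> topspace Y"
  have "orbit K (transport_action Y e e' a) y = e ` orbit K a (e' y)"
    using y by (auto simp: orbit_image transport_action_def)
  moreover have "orbit K a (e' y) \<subseteq> topspace X"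
    using flow_maps_to[OF fl] y hm_simps by (auto simp: orbit_image)
  moreover have "X closure_of orbit K a (e' y) = topspace X"
    using assms y hm_simps by (simp add: minimal_flow_def)
  ultimately show "Y closure_of orbit K (transport_action Y e e' a) y = topspace Y"
    using homeomorphic_map_closure_of[OF hm_maps(1)]
      homeomorphic_imp_surjective_map[OF hm_maps(1)] by metis
qed

lemma proximal_action_transport:
  assumes "proximal_action K X a"
  shows "proximal_action K Y (transport_action Y e e' a)"
  unfolding proximal_action_def
proof (intro ballI)
  fix x y assume xy: "x \<in> topspace Y" "y \<in> topspace Y"
  then obtain F z where F: "F \<noteq> bot" "eventually (\<lambda>k. k \<in> carrier K) F"
    "limitin X (\<lambda>k. a k (e' x)) z F" "limitin X (\<lambda>k. a k (e' y)) z F"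
    using assms hm_simps unfolding proximal_action_def by metis
  have "limitin Y (\<lambda>k. transport_action Y e e' a k x) (e z) F"
    "limitin Y (\<lambda>k. transport_action Y e e' a k y) (e z) F"
    using continuous_map_limit[OF hm_maps(3) F(3)] continuous_map_limit[OF hm_maps(3) F(4)] xy
    by (simp_all add: transport_action_def o_def)
  with F show "\<exists>F z. F \<noteq> bot \<and> eventually (\<lambda>k. k \<in> carrier K) F \<and>
      limitin Y (\<lambda>k. transport_action Y e e' a k x) z F \<and>
      limitin Y (\<lambda>k. transport_action Y e e' a k y) z F" by blast
qed

end

lemma space_borel_algebra [simp]: "space (borel_algebra X) = topspace X"
  by (auto simp: borel_algebra_def space_measure_of_conv)

lemma sets_borel_algebra: "sets (borel_algebra X) = sigma_sets (topspace X) {U. openin X U}"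
  unfolding borel_algebra_def by (rule sets_measure_of) (auto dest: openin_subset)

lemma openin_sets_borel_algebra: "openin X U \<Longrightarrow> U \<in> sets (borel_algebra X)"
  by (auto simp: sets_borel_algebra)

lemma continuous_map_measurable:
  assumes "continuous_map X Y f"
  shows "f \<in> measurable (borel_algebra X) (borel_algebra Y)"
proof (rule measurable_sigma_sets[OF sets_borel_algebra])
  show "{U. openin Y U} \<subseteq> Pow (topspace Y)" by (auto dest: openin_subset)
  show "f \<in> space (borel_algebra X) \<rightarrow> topspace Y" using assms by (auto simp: continuous_map_def)
  fix U assume "U \<in> {U. openin Y U}"
  then have "openin X {x \<in> topspace X. f x \<in> U}"
    using assms by (auto simp: continuous_map_def)
  moreover have "f -` U \<inter> space (borel_algebra X) = {x \<in> topspace X. f x \<in> U}" by auto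
  ultimately show "f -` U \<inter> space (borel_algebra X) \<in> sets (borel_algebra X)"
    by (simp add: openin_sets_borel_algebra)
qed

lemma continuous_real_measurable:
  assumes "continuous_map X euclideanreal f"
  shows "f \<in> borel_measurable (borel_algebra X)"
  using continuous_map_measurable[OF assms]
  by (simp add: borel_algebra_def borel_def)

lemma topspace_weak_star_topology [simp]:
  fixes X :: "'a topology"
  shows "topspace (weak_star_topology X) = prob_measures X"
proof -
  let ?B = "\<lambda>(f :: 'a \<Rightarrow> real) U. {\<mu> \<in> prob_measures X. integral\<^sup>L \<mu> f \<in> U}"
  have "prob_measures X = ?B (\<lambda>x. 0) UNIV" by simp
  moreover have "continuous_map X euclideanreal (\<lambda>x. 0)" by simp
  ultimately have "prob_measures X \<in> {?B f U | f U. continuous_map X euclideanreal f \<and> open U}"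
    using open_UNIV by blast
  then show ?thesis
    unfolding weak_star_topology_def topology_generated_by_topspace by blast
qed

context
  fixes X :: "'x topology" and Y :: "'y topology" and e e'
  assumes hm: "homeomorphic_maps X Y e e'"
begin

lemma hm_measurable: "e \<in> measurable (borel_algebra X) (borel_algebra Y)"
  by (rule continuous_map_measurable) (rule hm_maps[OF hm])

lemma emeasure_hm:
  assumes "\<mu> \<in> prob_measures X" "A \<in> sets (borel_algebra Y)"
  shows "emeasure (distr \<mu> (borel_algebra Y) e) A = emeasure \<mu> (e' ` A)"
proof -
  have *: "e \<in> measurable \<mu> (borel_algebra Y)"
    using hm_measurable assms measurable_cong_sets by (auto simp: prob_measures_def)
  have sub: "A \<subseteq> topspace Y" using assms(2) sets.sets_into_space by fastforce
  have "e -` A \<inter> space \<mu> = e' ` A"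
    using hm_vimage[OF hm sub] assms(1) by (simp add: prob_measures_def)
  then show ?thesis using emeasure_distr[OF * assms(2)] by simp
qed

end

lemma homeomorphic_maps_prob_measures:
  fixes X :: "'x topology" and Y :: "'y topology"
  assumes hm: "homeomorphic_maps X Y e e'" and \<mu>: "\<mu> \<in> prob_measures X"
  shows "distr \<mu> (borel_algebra Y) e \<in> prob_measures Y"
proof -
  let ?\<nu> = "distr \<mu> (borel_algebra Y) e"
  have hm': "homeomorphic_maps Y X e' e" using hm homeomorphic_maps_sym by blast
  have sets: "sets \<mu> = sets (borel_algebra X)" and prob: "prob_space \<mu>" and qr: "quasi_regular X \<mu>"
    using \<mu> by (auto simp: prob_measures_def)
  have meas: "e \<in> measurable \<mu> (borel_algebra Y)"
    using hm_measurable[OF hm] sets measurable_cong_sets by auto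
  note em = emeasure_hm[OF hm \<mu>]
  note si = hm_simps[OF hm]
  have img: "e' ` A \<in> sets (borel_algebra X)" if "A \<in> sets (borel_algebra Y)" for A
  proof -
    have sub: "A \<subseteq> topspace Y" using that sets.sets_into_space by fastforce
    have "e' ` A = e -` A \<inter> space (borel_algebra X)"
      using hm_vimage[OF hm sub] by simp
    then show ?thesis using measurable_sets[OF hm_measurable[OF hm] that] by simp
  qed
  have img': "e ` A \<in> sets (borel_algebra Y)" if "A \<in> sets (borel_algebra X)" for A
  proof -
    have sub: "A \<subseteq> topspace X" using that sets.sets_into_space by fastforce
    have "e ` A = e' -` A \<inter> space (borel_algebra Y)"
      using hm_vimage[OF hm' sub] by simp
    then show ?thesis using measurable_sets[OF hm_measurable[OF hm'] that] by simp
  qed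
  have ee: "e' ` e ` A = A" if "A \<subseteq> topspace X" for A using that by (force simp: si image_image)
  have ee': "e ` e' ` A = A" if "A \<subseteq> topspace Y" for A using that by (force simp: si image_image)
  have op: "openin X (e' ` U)" if "openin Y U" for U
    using that hm_maps(2)[OF hm] homeomorphic_imp_open_map open_map_def by blast
  have op': "openin Y (e ` U)" if "openin X U" for U
    using that hm_maps(1)[OF hm] homeomorphic_imp_open_map open_map_def by blast
  have "quasi_regular Y ?\<nu>"
    unfolding quasi_regular_def
  proof (intro conjI ballI allI impI)
    fix A assume "A \<in> sets ?\<nu>"
    then have A: "A \<in> sets (borel_algebra Y)" by simp
    then have sub: "A \<subseteq> topspace Y" using sets.sets_into_space by fastforce
    have eq: "(\<lambda>U. e' ` U) ` {U. openin Y U \<and> A \<subseteq> U} = {V. openin X V \<and> e' ` A \<subseteq> V}" (is "?L = ?R")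
    proof
      show "?L \<subseteq> ?R" using op by auto
      show "?R \<subseteq> ?L"
      proof
        fix V assume V: "V \<in> ?R"
        then have "V = e' ` (e ` V)" using ee[of V] openin_subset[of X V] by simp
        moreover have "A \<subseteq> e ` V" using V ee'[OF sub] image_mono[of "e' ` A" V e] by simp
        ultimately show "V \<in> ?L" using V op'[of V] by (intro image_eqI[of _ _ "e ` V"]) auto
      qed
    qed
    have "(INF V \<in> {V. openin X V \<and> e' ` A \<subseteq> V}. emeasure \<mu> V) =
        (INF U \<in> {U. openin Y U \<and> A \<subseteq> U}. emeasure \<mu> (e' ` U))"
      by (simp only: eq[symmetric] image_image)
    also have "\<dots> = (INF U \<in> {U. openin Y U \<and> A \<subseteq> U}. emeasure ?\<nu> U)"
      by (intro INF_cong refl) (simp add: em openin_sets_borel_algebra)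
    finally show "emeasure ?\<nu> A = (INF U \<in> {U. openin Y U \<and> A \<subseteq> U}. emeasure ?\<nu> U)"
      using qr img[OF A] sets em[OF A] by (simp add: quasi_regular_def)
  next
    fix U assume U: "openin Y U"
    have eq: "(\<lambda>C. e' ` C) ` {C. compactin Y C \<and> C \<subseteq> U \<and> C \<in> sets ?\<nu>} =
        {C. compactin X C \<and> C \<subseteq> e' ` U \<and> C \<in> sets \<mu>}" (is "?L = ?R")
    proof
      show "?L \<subseteq> ?R"
        using image_compactin[OF _ hm_maps(4)[OF hm]] img sets by auto
      show "?R \<subseteq> ?L"
      proof
        fix C assume C: "C \<in> ?R"
        then have "C = e' ` (e ` C)" using ee[of C] compactin_subset_topspace[of X C] by simp
        moreover have "e ` C \<subseteq> U"
          using C ee'[OF openin_subset[OF U]] image_mono[of C "e' ` U" e] by simp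
        moreover have "compactin Y (e ` C)"
          using C image_compactin[OF _ hm_maps(3)[OF hm]] by simp
        moreover have "e ` C \<in> sets ?\<nu>" using C img'[of C] sets by simp
        ultimately show "C \<in> ?L" by (intro image_eqI[of _ _ "e ` C"]) auto
      qed
    qed
    have "(SUP C \<in> {C. compactin X C \<and> C \<subseteq> e' ` U \<and> C \<in> sets \<mu>}. emeasure \<mu> C) =
        (SUP C \<in> {C. compactin Y C \<and> C \<subseteq> U \<and> C \<in> sets ?\<nu>}. emeasure \<mu> (e' ` C))"
      by (simp only: eq[symmetric] image_image)
    also have "\<dots> = (SUP C \<in> {C. compactin Y C \<and> C \<subseteq> U \<and> C \<in> sets ?\<nu>}. emeasure ?\<nu> C)"
      by (intro SUP_cong refl) (simp add: em)
    finally show "emeasure ?\<nu> U = (SUP C \<in> {C. compactin Y C \<and> C \<subseteq> U \<and> C \<in> sets ?\<nu>}. emeasure ?\<nu> C)"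
      using qr op[OF U] em[OF openin_sets_borel_algebra[OF U]] by (simp add: quasi_regular_def)
  qed
  then show ?thesis
    using prob_space.prob_space_distr[OF prob meas] by (simp add: prob_measures_def)
qed

lemma continuous_map_weak_star:
  fixes X :: "'x topology" and Y :: "'y topology"
  assumes hm: "homeomorphic_maps X Y e e'"
  shows "continuous_map (weak_star_topology X) (weak_star_topology Y)
    (\<lambda>\<mu>. distr \<mu> (borel_algebra Y) e)"
proof -
  let ?p = "\<lambda>\<mu>. distr \<mu> (borel_algebra Y) e"
  have "openin (weak_star_topology X)
      (?p -` {\<nu> \<in> prob_measures Y. integral\<^sup>L \<nu> f \<in> U} \<inter> topspace (weak_star_topology X))"
    if f: "continuous_map Y euclideanreal f" and U: "open U" for f :: "'y \<Rightarrow> real" and U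
  proof -
    have "integral\<^sup>L (?p \<mu>) f = integral\<^sup>L \<mu> (f \<circ> e)" if "\<mu> \<in> prob_measures X" for \<mu>
    proof -
      have "e \<in> measurable \<mu> (borel_algebra Y)"
        using hm_measurable[OF hm] that measurable_cong_sets by (auto simp: prob_measures_def)
      then show ?thesis using continuous_real_measurable[OF f] by (simp add: integral_distr o_def)
    qed
    then have "?p -` {\<nu> \<in> prob_measures Y. integral\<^sup>L \<nu> f \<in> U} \<inter> topspace (weak_star_topology X)
        = {\<mu> \<in> prob_measures X. integral\<^sup>L \<mu> (f \<circ> e) \<in> U}"
      using homeomorphic_maps_prob_measures[OF hm] by auto
    moreover have "continuous_map X euclideanreal (f \<circ> e)"
      using f hm_maps(3)[OF hm] continuous_map_compose by blast
    ultimately show ?thesis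
      using U unfolding weak_star_topology_def by (auto intro!: topology_generated_by_Basis)
  qed
  moreover have "?p ` topspace (weak_star_topology X) \<subseteq> topspace (weak_star_topology Y)"
    using homeomorphic_maps_prob_measures[OF hm] by auto
  ultimately show ?thesis
    unfolding weak_star_topology_def[of Y] topology_generated_by_topspace
    by (intro continuous_on_generated_topo) blast+
qed

lemma strongly_proximal_action_transport:
  fixes X :: "'x topology" and Y :: "'y topology"
  assumes hm: "homeomorphic_maps X Y e e'" and fl: "flow K T X a"
    and sp: "strongly_proximal_action K X a"
  shows "strongly_proximal_action K Y (transport_action Y e e' a)"
  unfolding strongly_proximal_action_def proximal_action_def topspace_weak_star_topology
proof (intro ballI)
  let ?b = "transport_action Y e e' a"
  let ?p = "\<lambda>\<mu>. distr \<mu> (borel_algebra Y) e" and ?q = "\<lambda>\<nu>. distr \<nu> (borel_algebra X) e'"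
  have hm': "homeomorphic_maps Y X e' e" using hm homeomorphic_maps_sym by blast
  fix \<mu> \<nu> assume \<mu>\<nu>: "\<mu> \<in> prob_measures Y" "\<nu> \<in> prob_measures Y"
  then have "?q \<mu> \<in> prob_measures X" "?q \<nu> \<in> prob_measures X"
    using homeomorphic_maps_prob_measures[OF hm'] by auto
  then obtain F z where F: "F \<noteq> bot" "eventually (\<lambda>k. k \<in> carrier K) F"
    "limitin (weak_star_topology X) (\<lambda>k. induced_action X a k (?q \<mu>)) z F"
    "limitin (weak_star_topology X) (\<lambda>k. induced_action X a k (?q \<nu>)) z F"
    using sp unfolding strongly_proximal_action_def proximal_action_def topspace_weak_star_topology
    by metis
  have eq: "?p (induced_action X a k (?q \<rho>)) = induced_action Y ?b k \<rho>"
    if k: "k \<in> carrier K" and \<rho>: "\<rho> \<in> prob_measures Y" for k \<rho>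
  proof -
    have s: "sets \<rho> = sets (borel_algebra Y)" and sp: "space \<rho> = topspace Y"
      using \<rho> by (auto simp: prob_measures_def)
    have m1: "e' \<in> measurable \<rho> (borel_algebra X)"
      using hm_measurable[OF hm'] s measurable_cong_sets by auto
    have m2: "a k \<in> measurable (borel_algebra X) (borel_algebra X)"
      by (rule continuous_map_measurable[OF flow_continuous[OF fl k]])
    have m3: "a k \<circ> e' \<in> measurable \<rho> (borel_algebra X)" by (rule measurable_comp[OF m1 m2])
    have "?p (induced_action X a k (?q \<rho>)) = distr \<rho> (borel_algebra Y) (e \<circ> (a k \<circ> e'))"
      unfolding induced_action_def
      by (simp add: distr_distr[OF m2 m1] distr_distr[OF hm_measurable[OF hm] m3])
    also have "\<dots> = induced_action Y ?b k \<rho>"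
      unfolding induced_action_def
      by (intro distr_cong) (auto simp: transport_action_def sp)
    finally show ?thesis .
  qed
  have lim: "limitin (weak_star_topology Y) (\<lambda>k. induced_action Y ?b k \<rho>) (?p z) F"
    if "\<rho> \<in> prob_measures Y" "limitin (weak_star_topology X) (\<lambda>k. induced_action X a k (?q \<rho>)) z F"
    for \<rho>
  proof (rule limitin_transform_eventually)
    show "\<forall>\<^sub>F k in F. ?p (induced_action X a k (?q \<rho>)) = induced_action Y ?b k \<rho>"
      using F(2) by eventually_elim (rule eq[OF _ that(1)])
    show "limitin (weak_star_topology Y) (\<lambda>k. ?p (induced_action X a k (?q \<rho>))) (?p z) F"
      using continuous_map_limit[OF continuous_map_weak_star[OF hm] that(2)] by (simp add: o_def)
  qed
  show "\<exists>F z. F \<noteq> bot \<and> eventually (\<lambda>k. k \<in> carrier K) F \<and>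
      limitin (weak_star_topology Y) (\<lambda>k. induced_action Y ?b k \<mu>) z F \<and>
      limitin (weak_star_topology Y) (\<lambda>k. induced_action Y ?b k \<nu>) z F"
    using F(1,2) lim[OF \<mu>\<nu>(1) F(3)] lim[OF \<mu>\<nu>(2) F(4)] by blast
qed

lemma homeomorphic_copy:
  fixes X :: "'x topology" and e :: "'x \<Rightarrow> 'y"
  assumes inj: "inj_on e (topspace X)"
  shows "\<exists>Y e'. homeomorphic_maps X Y e e'"
proof -
  let ?e' = "inv_into (topspace X) e"
  define Y where "Y = pullback_topology (e ` topspace X) ?e' X"
  have inv: "?e' (e x) = x" if "x \<in> topspace X" for x
    using inj that by (rule inv_into_f_f)
  have ts: "topspace Y = e ` topspace X"
    by (auto simp: Y_def topspace_pullback_topology inv)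
  have "continuous_map Y X ?e'"
    unfolding continuous_map_alt Y_def
    by (auto simp: openin_pullback_topology topspace_pullback_topology inv)
  moreover have "continuous_map X Y e"
    unfolding continuous_map_alt
  proof (intro conjI allI impI)
    fix V assume "openin Y V"
    then obtain U where U: "openin X U" "V = ?e' -` U \<inter> e ` topspace X"
      by (auto simp: Y_def openin_pullback_topology)
    have "e -` V \<inter> topspace X = U"
    proof -
      have "e x \<in> V \<longleftrightarrow> x \<in> U" if "x \<in> topspace X" for x
        using that inv[OF that] by (simp add: U(2))
      then show ?thesis using openin_subset[OF U(1)] by blast
    qed
    then show "openin X (e -` V \<inter> topspace X)" using U by simp
  qed (use ts in auto)
  ultimately have "homeomorphic_maps X Y e ?e'"
    by (auto simp: homeomorphic_maps_def ts inv)
  then show ?thesis by blast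
qed

lemma minimal_flow_copy:
  fixes X :: "'x topology" and K :: "('g, 'm) monoid_scheme"
  assumes min: "minimal_flow K T X a"
  shows "\<exists>(Y :: 'g set set topology) e e'. homeomorphic_maps X Y e e'"
proof -
  have fl: "flow K T X a" using min by (simp add: minimal_flow_def)
  then obtain x0 where x0: "x0 \<in> topspace X" unfolding flow_def by blast
  define e where "e x = {A. A \<subseteq> carrier K \<and> x \<in> X closure_of ((\<lambda>k. a k x0) ` A)}" for x
  have "inj_on e (topspace X)"
  proof (rule inj_onI, rule ccontr)
    fix x y assume xy: "x \<in> topspace X" "y \<in> topspace X" "e x = e y" "x \<noteq> y"
    then obtain U V where UV: "openin X U" "openin X V" "x \<in> U" "y \<in> V" "disjnt U V"
      using fl unfolding flow_def Hausdorff_space_def by metis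
    define A where "A = {k \<in> carrier K. a k x0 \<in> U}"
    have dense: "X closure_of (orbit K a x0) = topspace X"
      using min x0 by (simp add: minimal_flow_def)
    have "x \<in> X closure_of ((\<lambda>k. a k x0) ` A)"
      unfolding in_closure_of
    proof (intro conjI allI impI)
      fix W assume W: "x \<in> W \<and> openin X W"
      then have UW: "openin X (U \<inter> W)" "x \<in> U \<inter> W" using UV by auto
      have "x \<in> X closure_of (orbit K a x0)" using dense xy(1) by simp
      then obtain z where "z \<in> orbit K a x0" "z \<in> U \<inter> W"
        using UW unfolding in_closure_of by blast
      then show "\<exists>z. z \<in> (\<lambda>k. a k x0) ` A \<and> z \<in> W" by (auto simp: orbit_image A_def)
    qed (rule xy)
    then have "A \<in> e y" using xy(3) by (auto simp: e_def A_def)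
    then have "y \<in> X closure_of ((\<lambda>k. a k x0) ` A)" by (simp add: e_def)
    then obtain z where "z \<in> (\<lambda>k. a k x0) ` A" "z \<in> V"
      using UV(2,4) unfolding in_closure_of by blast
    then show False using UV(5) by (auto simp: A_def disjnt_iff)
  qed
  then show ?thesis using homeomorphic_copy[of e X] by blast
qed

lemma flow_factor_map_transport:
  fixes X :: "'x topology" and Y :: "'y topology" and Z :: "'z topology"
  assumes hm: "homeomorphic_maps Y Z e e'" and fl: "flow K T Y b"
    and f: "flow_factor_map K X a Z (transport_action Z e e' b) f"
  shows "flow_factor_map K X a Y b (e' \<circ> f)"
proof -
  have "f x \<in> topspace Z" if "x \<in> topspace X" for x
    using f that by (auto simp: flow_factor_map_def)
  moreover have "(e' \<circ> f) ` topspace X = topspace Y"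
    using homeomorphic_imp_surjective_map[OF hm_maps(2)[OF hm]] f
    unfolding flow_factor_map_def image_comp[symmetric] by metis
  moreover have "continuous_map X Y (e' \<circ> f)"
    using f hm_maps(4)[OF hm] continuous_map_compose by (auto simp: flow_factor_map_def)
  ultimately show ?thesis
    using f flow_maps_to[OF fl] hm_simps[OF hm]
    by (simp add: flow_factor_map_def transport_action_def)
qed

theorem universal_minimal_proximal_flow_factor:
  fixes K :: "('g, 'm) monoid_scheme" and Y :: "'y topology"
  assumes "universal_minimal_proximal_flow K T X a"
    and "minimal_flow K T Y b" "proximal_action K Y b"
  shows "\<exists>f. flow_factor_map K X a Y b f"
proof -
  obtain Z :: "'g set set topology" and e e' where hm: "homeomorphic_maps Y Z e e'"
    using minimal_flow_copy[OF assms(2)] by blast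
  obtain f where "flow_factor_map K X a Z (transport_action Z e e' b) f"
    using assms(1) minimal_flow_transport[OF hm assms(2)] proximal_action_transport[OF hm assms(3)]
    unfolding universal_minimal_proximal_flow_def by blast
  then show ?thesis
    using flow_factor_map_transport[OF hm] assms(2) unfolding minimal_flow_def by blast
qed

theorem universal_minimal_strongly_proximal_flow_factor:
  fixes K :: "('g, 'm) monoid_scheme" and Y :: "'y topology"
  assumes "universal_minimal_strongly_proximal_flow K T X a"
    and "minimal_flow K T Y b" "strongly_proximal_action K Y b"
  shows "\<exists>f. flow_factor_map K X a Y b f"
proof -
  obtain Z :: "'g set set topology" and e e' where hm: "homeomorphic_maps Y Z e e'"
    using minimal_flow_copy[OF assms(2)] by blast
  have fl: "flow K T Y b" using assms(2) by (simp add: minimal_flow_def)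
  obtain f where "flow_factor_map K X a Z (transport_action Z e e' b) f"
    using assms(1) minimal_flow_transport[OF hm assms(2)]
      strongly_proximal_action_transport[OF hm fl assms(3)]
    unfolding universal_minimal_strongly_proximal_flow_def by blast
  then show ?thesis using flow_factor_map_transport[OF hm fl] by blast
qed

end

theory Submission
  imports Defs "HOL-Probability.Giry_Monad"
begin

text \<open>The key fact is that a universal minimal (strongly) proximal flow of \<open>K\<close> remains universal when it is
  restricted to a subgroup \<open>L\<close> of finite index: a minimal proximal flow \<open>V\<close> of \<open>L\<close> is a factor of the
  coinduced flow of \<open>K\<close> on the \<open>L\<close>-equivariant maps \<open>K \<rightarrow> V\<close>, which is again proximal because for the
  normal core of \<open>L\<close> it embeds into a finite product of conjugates of \<open>V\<close>. So the universal flows of \<open>H\<close>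
  and of \<open>H\<^sup>g\<close> both restrict to a universal flow of \<open>H\<^sub>g\<close>, and uniqueness of universal flows provides
  the homeomorphisms \<open>hat g\<close>. Since endomorphisms of minimal proximal flows are trivial, these maps are unique,
  hence multiplicative in \<open>g\<close>.\<close>

section \<open>Charges\<close>

text \<open>A whole product of flows has to be brought to a point, and a measure on a product is not
  determined by its marginals; but marginals that are point masses do force a point mass. The
  argument needs a compact space of mass distributions on which push-forward is continuous. Finitely
  additive set functions supply it at once: they form a closed subset of a power of
  \<open>D\<close>, compact by Tychonoff. Regularity and integration enter only where
  \<open>contracting {0..1}\<close> is compared with strong proximality. For
  \<open>D = {0, 1/2, 1}\<close> a charge on a compact Hausdorff space behaves like a pair of
  points, the value 1/2 coming from the average of two point masses. The normal core is needed
  because an element of \<open>L\<close> may permute the cosets in K/L, hence the coordinates of the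
  coinduced flow, whereas an element of the core fixes every coset and acts on each coordinate
  separately. Finite index serves twice: finitely many coordinates determine an equivariant map, and
  contraction passes down to a subgroup by pigeonhole on coset representatives.\<close>

text \<open>A charge is a finitely additive probability on the Borel sets. Allowing only values in a closed
  set \<open>D\<close> covers both halves of the theorem: \<open>D = {0, 1/2, 1}\<close> captures proximality and
  \<open>D = {0..1}\<close> strong proximality.\<close>

definition charges :: "real set \<Rightarrow> 'x topology \<Rightarrow> ('x set \<Rightarrow> real) set"
  where "charges D X = {c. range c \<subseteq> D \<and> c (topspace X) = 1 \<and>
    (\<forall>A \<in> sets (borel_algebra X). \<forall>B \<in> sets (borel_algebra X).
       A \<inter> B = {} \<longrightarrow> c (A \<union> B) = c A + c B)}"

text \<open>The formula covers every set \<open>A\<close>, Borel or not, so each coordinate of the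
  push-forward is one coordinate of \<open>c\<close>; continuity in \<open>c\<close> is then
  immediate in the product topology.\<close>

definition push_charge :: "'x topology \<Rightarrow> ('x \<Rightarrow> 'y) \<Rightarrow> ('x set \<Rightarrow> real) \<Rightarrow> 'y set \<Rightarrow> real"
  where "push_charge X f c A = c {x \<in> topspace X. f x \<in> A}"

text \<open>A finitely additive point mass: full mass is asked only of the open neighbourhoods of
  \<open>x\<close>. A pointwise limit of point masses may give \<open>{x}\<close> mass 0, so a
  condition on \<open>{x}\<close> itself would not be closed.\<close>

definition point_charges :: "real set \<Rightarrow> 'x topology \<Rightarrow> ('x set \<Rightarrow> real) set"
  where "point_charges D X =
    {c \<in> charges D X. \<exists>x \<in> topspace X. \<forall>U. openin X U \<and> x \<in> U \<longrightarrow> c U = 1}"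

text \<open>For \<open>D\<close> as in \<open>charge_values\<close>, compactness turns this into:
  the orbit closure of every charge contains a point charge. One charge can replace the two points
  or measures of proximality because these can be averaged.\<close>

definition contracting ::
    "real set \<Rightarrow> ('g, 'm) monoid_scheme \<Rightarrow> 'x topology \<Rightarrow> ('g \<Rightarrow> 'x \<Rightarrow> 'x) \<Rightarrow> bool"
  where "contracting D K X a \<longleftrightarrow>
    (\<forall>c \<in> charges D X. \<exists>x \<in> topspace X. \<forall>U e. openin X U \<and> x \<in> U \<and> e > 0 \<longrightarrow>
       (\<exists>k \<in> carrier K. push_charge X (a k) c U > 1 - e))"

lemma topspace_borel [simp]: "topspace X \<in> sets (borel_algebra X)"
  by (rule openin_sets_borel_algebra) simp

lemma closedin_borel: "closedin X C \<Longrightarrow> C \<in> sets (borel_algebra X)"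
  using sets.compl_sets[OF openin_sets_borel_algebra[of X "topspace X - C"]]
  by (simp add: closedin_def double_diff)

lemma borel_vimage:
  assumes "continuous_map X Y f" "A \<in> sets (borel_algebra Y)"
  shows "{x \<in> topspace X. f x \<in> A} \<in> sets (borel_algebra X)"
  using measurable_sets[OF continuous_map_measurable[OF assms(1)] assms(2)]
  by (simp add: vimage_def Int_def conj_commute)

lemma point_charges_subset: "point_charges D X \<subseteq> charges D X"
  by (auto simp: point_charges_def)

text \<open>A closed bounded \<open>D\<close> makes the space of charges compact. The values 0, 1/2,
  1 make the average of two point masses a charge, which \<open>contracting_pairs\<close>
  exploits.\<close>

locale charge_values =
  fixes D :: "real set"
  assumes closed_D: "closed D" and D_unit: "D \<subseteq> {0..1}" and D_half: "{0, 1/2, 1} \<subseteq> D"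
begin

context
  fixes X :: "'x topology" and c
  assumes c: "c \<in> charges D X"
begin

lemma charge_bounds: "0 \<le> c A" "c A \<le> 1"
proof -
  have "c A \<in> D" using c by (auto simp: charges_def)
  then show "0 \<le> c A" "c A \<le> 1" using D_unit by auto
qed

lemma charge_total: "c (topspace X) = 1"
  using c by (simp add: charges_def)

lemma charge_Un_disjoint:
  assumes "A \<in> sets (borel_algebra X)" "B \<in> sets (borel_algebra X)" "A \<inter> B = {}"
  shows "c (A \<union> B) = c A + c B"
  using c assms by (simp add: charges_def)

lemma charge_empty: "c {} = 0"
  using charge_Un_disjoint[of "{}" "{}"] by simp

lemma charge_Diff:
  assumes "A \<in> sets (borel_algebra X)" "B \<in> sets (borel_algebra X)" "A \<subseteq> B"
  shows "c (B - A) = c B - c A"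
  using charge_Un_disjoint[of A "B - A"] assms by (simp add: Un_absorb1)

lemma charge_mono:
  assumes "A \<in> sets (borel_algebra X)" "B \<in> sets (borel_algebra X)" "A \<subseteq> B"
  shows "c A \<le> c B"
  using charge_Diff[OF assms] charge_bounds(1)[of "B - A"] by simp

lemma charge_Un_le:
  assumes "A \<in> sets (borel_algebra X)" "B \<in> sets (borel_algebra X)"
  shows "c (A \<union> B) \<le> c A + c B"
proof -
  have "c (A \<union> B) = c A + c (B - A)"
    using charge_Un_disjoint[of A "B - A"] assms by simp
  also have "c (B - A) \<le> c B" by (rule charge_mono) (use assms in auto)
  finally show ?thesis by simp
qed

lemma charge_UN_null:
  assumes "finite \<U>" "\<And>U. U \<in> \<U> \<Longrightarrow> openin X U \<and> c U = 0"
  shows "c (\<Union>\<U>) = 0"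
  using assms
proof (induction \<U>)
  case empty
  then show ?case by (simp add: charge_empty)
next
  case (insert U \<U>)
  have "openin X (\<Union>\<U>)" using insert.prems by blast
  then have "c (U \<union> \<Union>\<U>) \<le> c U + c (\<Union>\<U>)"
    using insert.prems by (intro charge_Un_le openin_sets_borel_algebra) auto
  also have "\<dots> = 0" using insert by simp
  finally show ?case using charge_bounds(1)[of "U \<union> \<Union>\<U>"] by simp
qed

text \<open>Compactness stands in for countable additivity: finitely many of the null open sets
  already cover the complement of \<open>U\<close>.\<close>

lemma charge_open_eq_1:
  assumes X: "compact_space X" and U: "openin X U"
    and null: "\<And>x. x \<in> topspace X \<Longrightarrow> x \<notin> U \<Longrightarrow> \<exists>V. openin X V \<and> x \<in> V \<and> c V = 0"
  shows "c U = 1"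
proof -
  let ?C = "topspace X - U"
  have "compactin X ?C" using X U by (intro closedin_compact_space) auto
  moreover have "\<forall>V \<in> {V. openin X V \<and> c V = 0}. openin X V"
    "?C \<subseteq> \<Union>{V. openin X V \<and> c V = 0}" using null by blast+
  ultimately obtain \<V> where \<V>: "finite \<V>" "\<V> \<subseteq> {V. openin X V \<and> c V = 0}" "?C \<subseteq> \<Union>\<V>"
    using compactinD[of X ?C "{V. openin X V \<and> c V = 0}"] by blast
  have op: "openin X (\<Union>\<V>)" using \<V>(2) by blast
  have "c (\<Union>\<V>) = 0" using \<V>(1,2) by (intro charge_UN_null) auto
  moreover have C: "?C \<in> sets (borel_algebra X)" using U by (intro closedin_borel) auto
  then have "c ?C \<le> c (\<Union>\<V>)"
    using op \<V>(3) by (intro charge_mono) (auto intro: openin_sets_borel_algebra)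
  ultimately have "c ?C = 0" using charge_bounds(1)[of ?C] by simp
  moreover have "c ?C = c (topspace X) - c U"
    using U openin_subset by (intro charge_Diff openin_sets_borel_algebra) auto
  ultimately show ?thesis by (simp add: charge_total)
qed

lemma push_charge_charges:
  assumes f: "continuous_map X Y f"
  shows "push_charge X f c \<in> charges D Y"
proof -
  have "{x \<in> topspace X. f x \<in> topspace Y} = topspace X"
    using f by (auto simp: continuous_map_def)
  moreover have "push_charge X f c (A \<union> B) = push_charge X f c A + push_charge X f c B"
    if AB: "A \<in> sets (borel_algebra Y)" "B \<in> sets (borel_algebra Y)" "A \<inter> B = {}" for A B
  proof -
    have "{x \<in> topspace X. f x \<in> A \<union> B} = {x \<in> topspace X. f x \<in> A} \<union> {x \<in> topspace X. f x \<in> B}"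
      by blast
    then show ?thesis
      using charge_Un_disjoint[OF borel_vimage[OF f AB(1)] borel_vimage[OF f AB(2)]] AB(3)
      by (auto simp: push_charge_def)
  qed
  moreover have "range (push_charge X f c) \<subseteq> D"
    using c by (auto simp: charges_def push_charge_def)
  ultimately show ?thesis
    by (simp add: charges_def push_charge_def charge_total)
qed

end

section \<open>Compactness of the space of charges, closedness of the point charges\<close>

lemma closed_charges: "closed (charges D X)"
proof -
  have "charges D X = (\<Inter>A. {c. c A \<in> D}) \<inter> {c. c (topspace X) = 1} \<inter>
      (\<Inter>A \<in> sets (borel_algebra X). \<Inter>B \<in> sets (borel_algebra X) \<inter> {B. A \<inter> B = {}}.
         {c. c (A \<union> B) = c A + c B})"
    by (auto simp: charges_def)
  moreover have "closed {c :: 'a set \<Rightarrow> real. c A \<in> D}" for A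
    using closed_vimage[OF closed_D continuous_on_product_coordinates[of A]]
    by (simp add: vimage_def)
  ultimately show ?thesis
    by (auto intro!: closed_Int closed_INT closed_Collect_eq continuous_intros
        continuous_on_product_coordinates)
qed

text \<open>Set functions carry the topology of pointwise convergence, so this is Tychonoff for a
  power of \<open>D\<close>.\<close>

lemma compact_charges: "compact (charges D X)"
proof -
  have "compact D"
    using closed_D D_unit bounded_subset[OF bounded_closed_interval]
    by (simp add: compact_eq_bounded_closed)
  then have "compactin (product_topology (\<lambda>A :: 'a set. euclidean) UNIV) (Pi\<^sub>E UNIV (\<lambda>_. D))"
    by (simp add: compactin_PiE)
  then have "compact (Pi\<^sub>E UNIV (\<lambda>_ :: 'a set. D))"
    by (simp add: euclidean_product_topology)
  moreover have "charges D X = Pi\<^sub>E UNIV (\<lambda>_. D) \<inter> charges D X"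
    by (auto simp: charges_def)
  ultimately show ?thesis using closed_charges compact_Int_closed by metis
qed

lemma continuous_on_push_charge: "continuous_on S (push_charge X f)"
  unfolding push_charge_def[abs_def]
  by (rule continuous_on_coordinatewise_then_product,
      rule continuous_on_subset[OF continuous_on_product_coordinates subset_UNIV])

text \<open>If \<open>c\<close> is no point charge, finitely many open sets \<open>U\<close> with
  \<open>c U < 1\<close> cover the space. The inequalities \<open>d U < 1\<close> for these
  \<open>U\<close> define an open neighbourhood of \<open>c\<close>, and no point charge
  \<open>d\<close> satisfies them all, since its point lies in one of the \<open>U\<close>.\<close>

lemma closed_point_charges:
  assumes X: "compact_space X"
  shows "closed (point_charges D X)"
proof (rule closed_limpt[THEN iffD2], intro allI impI)
  fix c assume "c islimpt point_charges D X"
  then have cl: "c \<in> closure (point_charges D X)" by (simp add: closure_def)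
  have c: "c \<in> charges D X"
    using closure_minimal[OF point_charges_subset closed_charges] cl by blast
  show "c \<in> point_charges D X"
  proof (rule ccontr)
    assume "c \<notin> point_charges D X"
    then have "\<forall>x \<in> topspace X. \<exists>U. openin X U \<and> x \<in> U \<and> c U < 1"
      using c charge_bounds(2)[OF c] by (auto simp: point_charges_def less_le)
    then have "topspace X \<subseteq> \<Union>{U. openin X U \<and> c U < 1}" by blast
    moreover have "compactin X (topspace X)" using X by (simp add: compact_space_def)
    moreover have "\<forall>U \<in> {U. openin X U \<and> c U < 1}. openin X U" by blast
    ultimately obtain \<V> where \<V>: "finite \<V>" "\<V> \<subseteq> {U. openin X U \<and> c U < 1}" "topspace X \<subseteq> \<Union>\<V>"
      using compactinD[of X "topspace X" "{U. openin X U \<and> c U < 1}"] by blast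
    let ?W = "\<Inter>U \<in> \<V>. {c :: 'a set \<Rightarrow> real. c U < 1}"
    have "open ?W"
      using \<V>(1) by (intro open_INT ballI open_Collect_less continuous_intros
        continuous_on_product_coordinates)
    moreover have "c \<in> ?W" using \<V>(2) by blast
    ultimately obtain d where d: "d \<in> point_charges D X" "d \<in> ?W"
      using cl open_Int_closure_eq_empty[of ?W "point_charges D X"] by blast
    then obtain x where x: "x \<in> topspace X" "\<And>U. openin X U \<Longrightarrow> x \<in> U \<Longrightarrow> d U = 1"
      by (auto simp: point_charges_def)
    obtain U where U: "U \<in> \<V>" "x \<in> U" using x(1) \<V>(3) by blast
    then have "d U = 1" using x(2) \<V>(2) by blast
    moreover have "d U < 1" using d(2) U(1) by blast
    ultimately show False by simp
  qed
qed

end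

section \<open>Flows of discrete groups\<close>

abbreviation discrete_flow ::
    "('g, 'm) monoid_scheme \<Rightarrow> 'x topology \<Rightarrow> ('g \<Rightarrow> 'x \<Rightarrow> 'x) \<Rightarrow> bool"
  where "discrete_flow K \<equiv> flow K (discrete_topology (carrier K))"

abbreviation discrete_minimal_flow ::
    "('g, 'm) monoid_scheme \<Rightarrow> 'x topology \<Rightarrow> ('g \<Rightarrow> 'x \<Rightarrow> 'x) \<Rightarrow> bool"
  where "discrete_minimal_flow K \<equiv> minimal_flow K (discrete_topology (carrier K))"

lemma flow_group: "flow K T X a \<Longrightarrow> group K"
  by (simp add: flow_def topological_group_def)

lemma flow_compact: "flow K T X a \<Longrightarrow> compact_space X"
  and flow_Hausdorff: "flow K T X a \<Longrightarrow> Hausdorff_space X"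
  and flow_nonempty: "flow K T X a \<Longrightarrow> topspace X \<noteq> {}"
  by (simp_all add: flow_def)

lemma flow_mult:
  assumes "flow K T X a" "k \<in> carrier K" "l \<in> carrier K" "x \<in> topspace X"
  shows "a (k \<otimes>\<^bsub>K\<^esub> l) x = a k (a l x)"
  using assms(1) group_action.composition_rule[of K "topspace X" a, OF _ assms(4,2,3)]
  by (simp add: flow_def)

lemma flow_one:
  assumes "flow K T X a" "x \<in> topspace X"
  shows "a \<one>\<^bsub>K\<^esub> x = x"
  using assms group_action.id_eq_one[of K "topspace X" a, THEN fun_cong, of x]
  by (simp add: flow_def)

lemma flow_inv_left:
  fixes K (structure)
  assumes "flow K T X a" "k \<in> carrier K" "x \<in> topspace X"
  shows "a (inv k) (a k x) = x"
proof -
  interpret group K by (rule flow_group[OF assms(1)])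
  have "a (inv k \<otimes> k) x = a (inv k) (a k x)"
    by (rule flow_mult[OF assms(1) inv_closed[OF assms(2)] assms(2,3)])
  then show ?thesis using assms(2) flow_one[OF assms(1,3)] by simp
qed

lemma flow_inv_right:
  fixes K (structure)
  assumes "flow K T X a" "k \<in> carrier K" "x \<in> topspace X"
  shows "a k (a (inv k) x) = x"
proof -
  interpret group K by (rule flow_group[OF assms(1)])
  show ?thesis using flow_inv_left[OF assms(1) inv_closed[OF assms(2)] assms(3)] assms(2) by simp
qed

lemma flow_Bij:
  assumes "flow K T X a" "k \<in> carrier K"
  shows "a k \<in> Bij (topspace X)"
  using assms group_action.bij_prop0[of K "topspace X" a] by (simp add: flow_def)

lemma minimal_flow_flow: "minimal_flow K T X a \<Longrightarrow> flow K T X a"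
  by (simp add: minimal_flow_def)

text \<open>Over a discrete group joint continuity reduces to continuity of each single map, because
  the preimage of an open set is a union of slices over the elements \<open>k\<close>.\<close>

lemma discrete_flowI:
  fixes K (structure)
  assumes "group K" "topspace X \<noteq> {}" "compact_space X" "Hausdorff_space X"
    and cont: "\<And>k. k \<in> carrier K \<Longrightarrow> continuous_map X X (a k)"
    and ext: "\<And>k. k \<in> carrier K \<Longrightarrow> a k \<in> extensional (topspace X)"
    and one: "\<And>x. x \<in> topspace X \<Longrightarrow> a \<one> x = x"
    and mult: "\<And>k l x. k \<in> carrier K \<Longrightarrow> l \<in> carrier K \<Longrightarrow> x \<in> topspace X \<Longrightarrow>
      a (k \<otimes> l) x = a k (a l x)"
  shows "discrete_flow K X a"
proof -
  interpret group K by fact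
  have to: "a k x \<in> topspace X" if "k \<in> carrier K" "x \<in> topspace X" for k x
    using cont[OF that(1)] that(2) by (auto simp: continuous_map_def)
  have inv: "a (inv k) (a k x) = x" "a k (a (inv k) x) = x"
    if "k \<in> carrier K" "x \<in> topspace X" for k x
    using that mult[of "inv k" k x] mult[of k "inv k" x] one by auto
  have Bij: "a k \<in> Bij (topspace X)" if k: "k \<in> carrier K" for k
  proof -
    have "bij_betw (a k) (topspace X) (topspace X)"
      using k to inv by (intro bij_betwI[where g = "a (inv k)"]) auto
    then show ?thesis using ext[OF k] by (simp add: Bij_def)
  qed
  have "a (k \<otimes> l) = compose (topspace X) (a k) (a l)"
    if kl: "k \<in> carrier K" "l \<in> carrier K" for k l
  proof
    fix x
    show "a (k \<otimes> l) x = compose (topspace X) (a k) (a l) x"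
      using kl mult ext[of "k \<otimes> l"] by (auto simp: compose_def extensional_def)
  qed
  then have "a \<in> hom K (BijGroup (topspace X))"
    using Bij by (simp add: hom_def BijGroup_def)
  then have "group_action K (topspace X) a"
    using is_group by (simp add: group_action_def group_hom_def group_hom_axioms_def group_BijGroup)
  moreover have "topological_group K (discrete_topology (carrier K))"
    unfolding topological_group_def using is_group
    by (auto simp flip: prod_topology_discrete_topology)
  moreover have "continuous_map (prod_topology (discrete_topology (carrier K)) X) X (\<lambda>(k, x). a k x)"
    unfolding continuous_map_def
  proof (intro conjI allI impI)
    show "(\<lambda>(k, x). a k x) \<in>
        topspace (prod_topology (discrete_topology (carrier K)) X) \<rightarrow> topspace X"
      using to by auto
    fix U assume U: "openin X U"
    have "{p \<in> topspace (prod_topology (discrete_topology (carrier K)) X). (case p of (k, x) \<Rightarrow> a k x) \<in> U}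
        = (\<Union>k \<in> carrier K. {k} \<times> {x \<in> topspace X. a k x \<in> U})"
      by auto
    moreover have "openin X {x \<in> topspace X. a k x \<in> U}" if "k \<in> carrier K" for k
      using cont[OF that] U by (auto simp: continuous_map_def)
    ultimately show "openin (prod_topology (discrete_topology (carrier K)) X)
        {p \<in> topspace (prod_topology (discrete_topology (carrier K)) X). (case p of (k, x) \<Rightarrow> a k x) \<in> U}"
      by (auto intro!: openin_Union simp: openin_prod_Times_iff)
  qed
  ultimately show ?thesis using assms(2-4) by (simp add: flow_def)
qed

section \<open>Invariant closed sets and minimal sets\<close>

definition invariant_closed ::
    "('g, 'm) monoid_scheme \<Rightarrow> 'x topology \<Rightarrow> ('g \<Rightarrow> 'x \<Rightarrow> 'x) \<Rightarrow> 'x set \<Rightarrow> bool"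
  where "invariant_closed K X a M \<longleftrightarrow>
    closedin X M \<and> M \<noteq> {} \<and> (\<forall>k \<in> carrier K. \<forall>x \<in> M. a k x \<in> M)"

lemma invariant_closed_subset: "invariant_closed K X a M \<Longrightarrow> M \<subseteq> topspace X"
  by (simp add: invariant_closed_def closedin_subset)

lemma orbit_closure_invariant:
  assumes fl: "flow K T X a" and x: "x \<in> topspace X"
  shows "invariant_closed K X a (X closure_of (orbit K a x))"
proof -
  interpret group K by (rule flow_group[OF fl])
  have orb: "orbit K a x \<subseteq> topspace X"
    using flow_maps_to[OF fl _ x] by (auto simp: orbit_image)
  have "a k y \<in> X closure_of (orbit K a x)"
    if k: "k \<in> carrier K" and y: "y \<in> X closure_of (orbit K a x)" for k y
  proof -
    have "a k ` orbit K a x \<subseteq> orbit K a x"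
      using flow_mult[OF fl k _ x] m_closed[OF k] by (force simp: orbit_image simp flip: flow_mult[OF fl k _ x])
    then have "X closure_of (a k ` orbit K a x) \<subseteq> X closure_of (orbit K a x)"
      by (rule closure_of_mono)
    then show ?thesis
      using continuous_map_image_closure_subset[OF flow_continuous[OF fl k], of "orbit K a x"] y by blast
  qed
  moreover have "x \<in> orbit K a x"
    using flow_one[OF fl x] one_closed by (force simp: orbit_image)
  then have "x \<in> X closure_of (orbit K a x)"
    using closure_of_subset[OF orb] by blast
  ultimately show ?thesis by (auto simp: invariant_closed_def)
qed

lemma minimal_flowD:
  assumes "minimal_flow K T X a" "invariant_closed K X a M"
  shows "M = topspace X"
proof -
  obtain x where x: "x \<in> M" using assms(2) by (auto simp: invariant_closed_def)
  then have "x \<in> topspace X" using invariant_closed_subset[OF assms(2)] by blast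
  moreover have "orbit K a x \<subseteq> M"
    using assms(2) x by (auto simp: invariant_closed_def orbit_image)
  then have "X closure_of (orbit K a x) \<subseteq> M"
    using assms(2) by (intro closure_of_minimal) (auto simp: invariant_closed_def)
  ultimately show ?thesis
    using assms invariant_closed_subset unfolding minimal_flow_def by blast
qed

lemma minimal_flowI:
  assumes "flow K T X a" "\<And>M. invariant_closed K X a M \<Longrightarrow> M = topspace X"
  shows "minimal_flow K T X a"
  unfolding minimal_flow_def
proof (intro conjI ballI)
  fix x assume "x \<in> topspace X"
  then show "X closure_of (orbit K a x) = topspace X"
    by (intro assms(2) orbit_closure_invariant[OF assms(1)])
qed (rule assms(1))

lemma exists_minimal_set:
  assumes fl: "flow K T X a"
  obtains M where "invariant_closed K X a M"
    "\<And>M'. invariant_closed K X a M' \<Longrightarrow> M' \<subseteq> M \<Longrightarrow> M' = M"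
proof -
  \<comment> \<open>Zorn's lemma is applied to the open complements of invariant closed sets, so
    that chains are bounded by their unions; invariance is therefore stated backwards. Compactness
    keeps the union of a chain from exhausting the space.\<close>
  define \<A> where "\<A> = {U. openin X U \<and> U \<noteq> topspace X \<and>
    (\<forall>k \<in> carrier K. \<forall>x \<in> topspace X. a k x \<in> U \<longrightarrow> x \<in> U)}"
  have A: "U \<in> \<A> \<longleftrightarrow> invariant_closed K X a (topspace X - U)" if "openin X U" for U
    using that flow_maps_to[OF fl] openin_subset[OF that]
    by (auto simp: \<A>_def invariant_closed_def closedin_def)
  have "\<exists>M \<in> \<A>. \<forall>U \<in> \<A>. M \<subseteq> U \<longrightarrow> U = M"
  proof (rule subset_Zorn_nonempty)
    have "{} \<noteq> topspace X" using flow_nonempty[OF fl] by metis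
    then have "{} \<in> \<A>" unfolding \<A>_def using openin_empty by blast
    then show "\<A> \<noteq> {}" by blast
    fix \<C> assume \<C>: "\<C> \<noteq> {}" "subset.chain \<A> \<C>"
    then have sub: "\<C> \<subseteq> \<A>" by (simp add: subset_chain_def)
    have "\<Union>\<C> \<noteq> topspace X"
    proof
      assume "\<Union>\<C> = topspace X"
      moreover have "compactin X (topspace X)"
        using flow_compact[OF fl] by (simp add: compact_space_def)
      moreover have "\<And>U. U \<in> \<C> \<Longrightarrow> openin X U" using sub by (auto simp: \<A>_def)
      ultimately have "\<exists>\<F>. finite \<F> \<and> \<F> \<subseteq> \<C> \<and> topspace X \<subseteq> \<Union>\<F>"
        by (intro compactinD) auto
      then obtain \<F> where \<F>: "finite \<F>" "\<F> \<subseteq> \<C>" "topspace X \<subseteq> \<Union>\<F>" by blast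
      have "\<F> \<noteq> {}" using \<F>(3) flow_nonempty[OF fl] by blast
      moreover have "subset.chain \<A> \<F>"
        unfolding subset_chain_def
      proof (intro conjI ballI)
        show "\<F> \<subseteq> \<A>" using \<F>(2) sub by (rule order_trans)
        fix U V assume "U \<in> \<F>" "V \<in> \<F>"
        then have "U \<in> \<C>" "V \<in> \<C>" using \<F>(2) by auto
        then show "U \<subseteq> V \<or> V \<subseteq> U" using \<C>(2) by (simp add: subset_chain_def)
      qed
      ultimately have "\<Union>\<F> \<in> \<F>" using Union_in_chain[OF \<F>(1)] by blast
      then have "\<Union>\<F> \<in> \<A>" using \<F>(2) sub by blast
      then have "\<Union>\<F> \<noteq> topspace X" "\<Union>\<F> \<subseteq> topspace X"
        unfolding \<A>_def using openin_subset by blast+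
      then show False using \<F>(3) by blast
    qed
    moreover have "openin X (\<Union>\<C>)" using sub by (auto simp: \<A>_def)
    moreover have "\<forall>k \<in> carrier K. \<forall>x \<in> topspace X. a k x \<in> \<Union>\<C> \<longrightarrow> x \<in> \<Union>\<C>"
      using sub by (auto simp: \<A>_def)
    ultimately show "\<Union>\<C> \<in> \<A>" by (simp add: \<A>_def)
  qed
  then obtain U where U: "U \<in> \<A>" "\<And>V. V \<in> \<A> \<Longrightarrow> U \<subseteq> V \<Longrightarrow> V = U" by blast
  have opU: "openin X U" using U(1) by (simp add: \<A>_def)
  show thesis
  proof (rule that)
    show "invariant_closed K X a (topspace X - U)" using A[OF opU] U(1) by simp
    fix M assume M: "invariant_closed K X a M" "M \<subseteq> topspace X - U"
    have sub: "M \<subseteq> topspace X" by (rule invariant_closed_subset[OF M(1)])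
    have op: "openin X (topspace X - M)" using M(1) by (simp add: invariant_closed_def closedin_def)
    have "topspace X - M \<in> \<A>" using A[OF op] M(1) double_diff[OF sub subset_refl] by simp
    moreover have "U \<subseteq> topspace X - M" using M(2) openin_subset[OF opU] by blast
    ultimately have "topspace X - M = U" by (rule U(2))
    then show "M = topspace X - U" using sub by blast
  qed
qed

lemma subflow:
  assumes fl: "discrete_flow K X a" and M: "invariant_closed K X a M"
  shows "discrete_flow K (subtopology X M) (\<lambda>k. restrict (a k) M)"
proof -
  have sub: "M \<subseteq> topspace X" by (rule invariant_closed_subset[OF M])
  then have ts: "topspace (subtopology X M) = M" by (rule topspace_subtopology_subset)
  have inv: "a k x \<in> M" if "k \<in> carrier K" "x \<in> M" for k x
    using M that by (simp add: invariant_closed_def)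
  show ?thesis
  proof (rule discrete_flowI)
    show "group K" by (rule flow_group[OF fl])
    show "topspace (subtopology X M) \<noteq> {}" using M unfolding ts invariant_closed_def by blast
    show "compact_space (subtopology X M)"
      using M flow_compact[OF fl]
      by (simp add: compact_space_subtopology closedin_compact_space invariant_closed_def)
    show "Hausdorff_space (subtopology X M)"
      by (rule Hausdorff_space_subtopology[OF flow_Hausdorff[OF fl]])
    fix k assume k: "k \<in> carrier K"
    have "continuous_map (subtopology X M) (subtopology X M) (a k)"
      using continuous_map_from_subtopology[OF flow_continuous[OF fl k]] inv[OF k]
      by (auto simp: continuous_map_in_subtopology ts)
    then show "continuous_map (subtopology X M) (subtopology X M) (restrict (a k) M)"
      by (rule continuous_map_eq) (simp add: ts)
    show "restrict (a k) M \<in> extensional (topspace (subtopology X M))"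
      unfolding ts by (rule restrict_extensional)
  next
    fix x assume x: "x \<in> topspace (subtopology X M)"
    then have "x \<in> M" "x \<in> topspace X" using sub ts by auto
    then show "restrict (a \<one>\<^bsub>K\<^esub>) M x = x" using flow_one[OF fl] by simp
    fix k l assume "k \<in> carrier K" "l \<in> carrier K"
    then show "restrict (a (k \<otimes>\<^bsub>K\<^esub> l)) M x = restrict (a k) M (restrict (a l) M x)"
      using \<open>x \<in> M\<close> \<open>x \<in> topspace X\<close> inv flow_mult[OF fl] by simp
  qed
qed

section \<open>Charges with point charges as images in finitely many contracting factors\<close>

context charge_values
begin

text \<open>Contraction of \<open>V\<close> provides, for each neighbourhood \<open>U\<close> of
  \<open>x\<close> and each \<open>e\<close>, a translate of \<open>c0\<close> whose image gives
  \<open>U\<close> mass above \<open>1 - e\<close>. These translates stay in \<open>E\<close>.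
  Finitely many such conditions follow from a single one, so compactness of \<open>E\<close> yields
  one charge that meets all of them.\<close>

lemma invariant_charges_meet_point_charges:
  assumes E: "E \<subseteq> charges D W" "closed E" "E \<noteq> {}"
    and inv: "\<And>n c. n \<in> carrier N \<Longrightarrow> c \<in> E \<Longrightarrow> push_charge W (a n) c \<in> E"
    and to: "\<And>n w. n \<in> carrier N \<Longrightarrow> w \<in> topspace W \<Longrightarrow> a n w \<in> topspace W"
    and V: "contracting D N V b"
    and p: "continuous_map W V p"
    and eqv: "\<And>n w. n \<in> carrier N \<Longrightarrow> w \<in> topspace W \<Longrightarrow> p (a n w) = b n (p w)"
  shows "\<exists>c \<in> E. push_charge W p c \<in> point_charges D V"
proof -
  have pto: "p w \<in> topspace V" if "w \<in> topspace W" for w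
    using p that by (auto simp: continuous_map_def)
  obtain c0 where c0: "c0 \<in> E" using E(3) by blast
  have "push_charge W p c0 \<in> charges D V"
    using push_charge_charges[OF _ p] E(1) c0 by blast
  then obtain x where x: "x \<in> topspace V"
    "\<And>U e. openin V U \<Longrightarrow> x \<in> U \<Longrightarrow> e > 0 \<Longrightarrow>
       \<exists>n \<in> carrier N. push_charge V (b n) (push_charge W p c0) U > 1 - e"
    using V unfolding contracting_def by metis
  define I where "I = {(U, e :: real). openin V U \<and> x \<in> U \<and> e > 0}"
  define A where "A = (\<lambda>(U, e). {c. push_charge W p c U \<ge> 1 - e})"
  have "compact E"
    using compact_Int_closed[OF compact_charges E(2)] E(1) by (metis inf.absorb_iff2)
  then have "E \<inter> \<Inter>(A ` I) \<noteq> {}"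
  proof (rule compact_imp_fip_image)
    show "closed (A i)" for i
      by (auto simp: A_def push_charge_def split: prod.split
          intro!: closed_Collect_le continuous_intros continuous_on_product_coordinates)
    fix J assume J: "finite J" "J \<subseteq> I"
    \<comment> \<open>Intersecting with \<open>topspace V\<close> here and inserting 1 into the
      minimum below take care of an empty \<open>J\<close>.\<close>
    define U where "U = \<Inter>(fst ` J) \<inter> topspace V"
    define e where "e = Min (insert 1 (snd ` J))"
    have "e > 0" using J by (auto simp: e_def I_def)
    moreover have "openin V U"
      unfolding U_def using J by (intro openin_INT) (auto simp: I_def)
    moreover have "x \<in> U" using J x(1) by (auto simp: U_def I_def)
    ultimately obtain n where n: "n \<in> carrier N"
      "push_charge V (b n) (push_charge W p c0) U > 1 - e" using x(2) by blast
    let ?c = "push_charge W (a n) c0"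
    have cE: "?c \<in> E" using inv[OF n(1) c0] .
    have "push_charge W p ?c S = push_charge V (b n) (push_charge W p c0) S" for S
    proof -
      have "{w \<in> topspace W. a n w \<in> {w \<in> topspace W. p w \<in> S}} =
          {w \<in> topspace W. p w \<in> {v \<in> topspace V. b n v \<in> S}}"
        using to[OF n(1)] eqv[OF n(1)] pto by auto
      then show ?thesis by (simp add: push_charge_def)
    qed
    then have big: "push_charge W p ?c U > 1 - e" using n(2) by simp
    have "push_charge W p ?c \<in> charges D V"
      using push_charge_charges[OF _ p] E(1) cE by blast
    then have mono: "push_charge W p ?c U \<le> push_charge W p ?c U'"
      if "openin V U'" "U \<subseteq> U'" for U'
      using that \<open>openin V U\<close> by (intro charge_mono openin_sets_borel_algebra)
    have "?c \<in> A i" if i: "i \<in> J" for i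
    proof -
      obtain U' e' where U': "i = (U', e')" by fastforce
      then have "openin V U'" using i J(2) by (auto simp: I_def)
      moreover have "U \<subseteq> U'" using i U' by (force simp: U_def)
      moreover have "e \<le> e'" using i U' J(1) unfolding e_def by (intro Min_le) force+
      ultimately show ?thesis using mono[of U'] big by (simp add: A_def U')
    qed
    then show "E \<inter> \<Inter>(A ` J) \<noteq> {}" using cE by blast
  qed
  then obtain c where c: "c \<in> E" "\<And>i. i \<in> I \<Longrightarrow> c \<in> A i" by blast
  have ch: "push_charge W p c \<in> charges D V"
    using push_charge_charges[OF _ p] E(1) c(1) by blast
  have "push_charge W p c U = 1" if U: "openin V U" "x \<in> U" for U
  proof (rule antisym)
    show "push_charge W p c U \<le> 1" by (rule charge_bounds[OF ch])
    show "1 \<le> push_charge W p c U"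
    proof (rule field_le_epsilon)
      fix e :: real assume "e > 0"
      then have "(U, e) \<in> I" using U by (simp add: I_def)
      from c(2)[OF this] show "1 \<le> push_charge W p c U + e" by (simp add: A_def)
    qed
  qed
  then show ?thesis using c(1) ch x(1) by (auto simp: point_charges_def)
qed

text \<open>The charges of \<open>E\<close> with point charges as images in the factors treated so
  far again form a closed, nonempty, invariant set, which takes the place of \<open>E\<close> for
  the next factor. Invariance holds because \<open>b i n\<close> carries a point charge at
  \<open>x\<close> to one at \<open>b i n x\<close>.\<close>

lemma joint_charges:
  assumes "finite I"
    and E: "E \<subseteq> charges D W" "closed E" "E \<noteq> {}"
    and inv: "\<And>n c. n \<in> carrier N \<Longrightarrow> c \<in> E \<Longrightarrow> push_charge W (a n) c \<in> E"
    and to: "\<And>n w. n \<in> carrier N \<Longrightarrow> w \<in> topspace W \<Longrightarrow> a n w \<in> topspace W"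
    and V: "\<And>i. i \<in> I \<Longrightarrow> flow N T (V i) (b i)" "\<And>i. i \<in> I \<Longrightarrow> contracting D N (V i) (b i)"
    and p: "\<And>i. i \<in> I \<Longrightarrow> continuous_map W (V i) (p i)"
    and eqv: "\<And>i n w. i \<in> I \<Longrightarrow> n \<in> carrier N \<Longrightarrow> w \<in> topspace W \<Longrightarrow> p i (a n w) = b i n (p i w)"
  shows "{c \<in> E. \<forall>i \<in> I. push_charge W (p i) c \<in> point_charges D (V i)} \<noteq> {}"
  using \<open>finite I\<close> V p eqv
proof (induction I)
  case empty
  then show ?case using E(3) by simp
next
  case (insert j I)
  let ?E = "{c \<in> E. \<forall>i \<in> I. push_charge W (p i) c \<in> point_charges D (V i)}"
  have "?E \<noteq> {}" by (rule insert.IH) (use insert.prems in auto)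
  moreover have "closed ?E"
  proof -
    have "?E = E \<inter> (\<Inter>i \<in> I. push_charge W (p i) -` point_charges D (V i))" by auto
    moreover have "closed (push_charge W (p i) -` point_charges D (V i))" if "i \<in> I" for i
      using that insert.prems(1) flow_compact
      by (intro closed_vimage closed_point_charges continuous_on_push_charge) blast+
    ultimately show ?thesis using E(2) by (auto intro!: closed_Int closed_INT)
  qed
  moreover have "push_charge W (a n) c \<in> ?E" if n: "n \<in> carrier N" and c: "c \<in> ?E" for n c
  proof -
    have "push_charge W (p i) (push_charge W (a n) c) \<in> point_charges D (V i)" if i: "i \<in> I" for i
    proof -
      have fl: "flow N T (V i) (b i)" using insert.prems(1) i by blast
      have pc: "push_charge W (p i) c \<in> point_charges D (V i)" using c i by blast
      have pto: "p i w \<in> topspace (V i)" if "w \<in> topspace W" for w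
        using insert.prems(3)[of i] i that by (auto simp: continuous_map_def)
      have eq: "push_charge W (p i) (push_charge W (a n) c) = push_charge (V i) (b i n) (push_charge W (p i) c)"
      proof
        fix S
        have "{w \<in> topspace W. a n w \<in> {w \<in> topspace W. p i w \<in> S}} =
            {w \<in> topspace W. p i w \<in> {v \<in> topspace (V i). b i n v \<in> S}}"
          using to[OF n] insert.prems(4)[of i n] i n pto by auto
        then show "push_charge W (p i) (push_charge W (a n) c) S =
            push_charge (V i) (b i n) (push_charge W (p i) c) S"
          by (simp add: push_charge_def)
      qed
      obtain x where x: "x \<in> topspace (V i)"
        "\<And>U. openin (V i) U \<Longrightarrow> x \<in> U \<Longrightarrow> push_charge W (p i) c U = 1"
        using pc by (auto simp: point_charges_def)
      have "push_charge (V i) (b i n) (push_charge W (p i) c) U = 1"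
        if U: "openin (V i) U" "b i n x \<in> U" for U
      proof -
        have "openin (V i) {v \<in> topspace (V i). b i n v \<in> U}"
          using flow_continuous[OF fl n] U(1) by (auto simp: continuous_map_def)
        then have "push_charge W (p i) c {v \<in> topspace (V i). b i n v \<in> U} = 1"
          using x U(2) by blast
        then show ?thesis by (simp only: push_charge_def)
      qed
      moreover have "push_charge (V i) (b i n) (push_charge W (p i) c) \<in> charges D (V i)"
        using push_charge_charges[OF _ flow_continuous[OF fl n]] pc point_charges_subset by blast
      moreover have "b i n x \<in> topspace (V i)" by (rule flow_maps_to[OF fl n x(1)])
      ultimately show ?thesis unfolding eq by (auto simp: point_charges_def)
    qed
    then show ?thesis using inv[OF n] c by blast
  qed
  ultimately have "\<exists>c \<in> ?E. push_charge W (p j) c \<in> point_charges D (V j)"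
    using E(1) to insert.prems
    by (intro invariant_charges_meet_point_charges[where N = N and a = a and b = "b j"]) auto
  then show ?case by auto
qed

text \<open>Finitely many factors that separate points suffice: some charge in the orbit closure has a point
  charge as its image in every factor, hence is itself a point charge.\<close>

lemma contracting_jointly_injective:
  assumes W: "flow N T' W a" and I: "finite I"
    and V: "\<And>i. i \<in> I \<Longrightarrow> flow N T (V i) (b i)" "\<And>i. i \<in> I \<Longrightarrow> contracting D N (V i) (b i)"
    and p: "\<And>i. i \<in> I \<Longrightarrow> continuous_map W (V i) (p i)"
    and eqv: "\<And>i n w. i \<in> I \<Longrightarrow> n \<in> carrier N \<Longrightarrow> w \<in> topspace W \<Longrightarrow> p i (a n w) = b i n (p i w)"
    and inj: "\<And>w w'. w \<in> topspace W \<Longrightarrow> w' \<in> topspace W \<Longrightarrow> (\<And>i. i \<in> I \<Longrightarrow> p i w = p i w') \<Longrightarrow> w = w'"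
  shows "contracting D N W a"
  unfolding contracting_def
proof
  fix c0 assume c0: "c0 \<in> charges D W"
  interpret N: group N by (rule flow_group[OF W])
  note to = flow_maps_to[OF W]
  define O0 where "O0 = (\<lambda>n. push_charge W (a n) c0) ` carrier N"
  let ?E = "closure O0"
  have O0: "O0 \<subseteq> charges D W"
    using push_charge_charges[OF c0 flow_continuous[OF W]] by (auto simp: O0_def)
  have push_push: "push_charge W (a n) (push_charge W (a m) c) = push_charge W (a (n \<otimes>\<^bsub>N\<^esub> m)) c"
    if nm: "n \<in> carrier N" "m \<in> carrier N" for n m c
  proof
    fix S
    have "{w \<in> topspace W. a m w \<in> {w \<in> topspace W. a n w \<in> S}} = {w \<in> topspace W. a (n \<otimes>\<^bsub>N\<^esub> m) w \<in> S}"
      using to[OF nm(2)] flow_mult[OF W nm] by auto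
    then show "push_charge W (a n) (push_charge W (a m) c) S = push_charge W (a (n \<otimes>\<^bsub>N\<^esub> m)) c S"
      by (simp add: push_charge_def)
  qed
  have inv: "push_charge W (a n) c \<in> ?E" if n: "n \<in> carrier N" and c: "c \<in> ?E" for n c
  proof -
    have "push_charge W (a n) ` O0 \<subseteq> O0"
      using push_push[OF n] n by (auto simp: O0_def)
    then have "push_charge W (a n) ` O0 \<subseteq> ?E" using closure_subset by blast
    then have "push_charge W (a n) ` ?E \<subseteq> ?E"
      by (intro image_closure_subset continuous_on_push_charge closed_closure)
    then show ?thesis using c by blast
  qed
  have E: "?E \<subseteq> charges D W" using O0 closed_charges by (rule closure_minimal)
  have "O0 \<noteq> {}" using N.one_closed by (auto simp: O0_def)
  then have "?E \<noteq> {}" using closure_subset by blast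
  then have "{c \<in> ?E. \<forall>i \<in> I. push_charge W (p i) c \<in> point_charges D (V i)} \<noteq> {}"
    by (intro joint_charges[OF I E closed_closure _ inv to V p eqv])
  then obtain c where c: "c \<in> ?E" "\<And>i. i \<in> I \<Longrightarrow> push_charge W (p i) c \<in> point_charges D (V i)"
    by blast
  have ch: "c \<in> charges D W" using c(1) E by blast
  \<comment> \<open>Support points of \<open>c\<close>. There is one, since otherwise compactness
    would make the empty set have mass 1. Two of them have the same image under every
    \<open>p i\<close>, namely the point of the image charge, so they coincide by joint injectivity.
    All other points then have null neighbourhoods.\<close>
  let ?supp = "\<lambda>w. \<forall>U. openin W U \<and> w \<in> U \<longrightarrow> c U > 0"
  have null: "\<exists>U. openin W U \<and> w \<in> U \<and> c U = 0" if "\<not> ?supp w" for w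
    using that charge_bounds(1)[OF ch] by (metis less_eq_real_def)
  have "\<exists>w \<in> topspace W. ?supp w"
  proof (rule ccontr)
    assume "\<not> ?thesis"
    then have "c {} = 1" using null by (intro charge_open_eq_1[OF ch flow_compact[OF W]]) auto
    then show False using charge_empty[OF ch] by simp
  qed
  then obtain w where w: "w \<in> topspace W" "?supp w" by blast
  have uniq: "w' = w" if w': "w' \<in> topspace W" "?supp w'" for w'
  proof (rule inj[OF w'(1) w(1)])
    fix i assume i: "i \<in> I"
    obtain x where x: "x \<in> topspace (V i)"
      "\<And>U. openin (V i) U \<Longrightarrow> x \<in> U \<Longrightarrow> push_charge W (p i) c U = 1"
      using c(2)[OF i] by (auto simp: point_charges_def)
    have "p i v = x" if v: "v \<in> topspace W" "?supp v" for v
    proof (rule ccontr)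
      assume ne: "p i v \<noteq> x"
      have "p i v \<in> topspace (V i)" using p[OF i] v(1) by (auto simp: continuous_map_def)
      then obtain A B where AB: "openin (V i) A" "openin (V i) B" "p i v \<in> A" "x \<in> B" "disjnt A B"
        using flow_Hausdorff[OF V(1)[OF i]] x(1) ne unfolding Hausdorff_space_def by metis
      let ?A = "{w \<in> topspace W. p i w \<in> A}" and ?B = "{w \<in> topspace W. p i w \<in> B}"
      have op: "openin W ?A" "openin W ?B"
        using p[OF i] AB(1,2) by (auto simp: continuous_map_def)
      have "?A \<inter> ?B = {}" using AB(5) by (auto simp: disjnt_iff)
      then have "c (?A \<union> ?B) = c ?A + c ?B"
        using op by (intro charge_Un_disjoint[OF ch] openin_sets_borel_algebra)
      moreover have "c ?A > 0" using v AB(3) op(1) by simp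
      moreover have "c ?B = 1" using x(2)[OF AB(2,4)] by (simp add: push_charge_def)
      ultimately show False using charge_bounds(2)[OF ch, of "?A \<union> ?B"] by simp
    qed
    then show "p i w' = p i w" using w w' by metis
  qed
  have c1: "c U = 1" if U: "openin W U" "w \<in> U" for U
  proof (rule charge_open_eq_1[OF ch flow_compact[OF W] U(1)])
    fix v assume v: "v \<in> topspace W" "v \<notin> U"
    then have "v \<noteq> w" using U(2) by blast
    then show "\<exists>V. openin W V \<and> v \<in> V \<and> c V = 0" using null[of v] uniq[OF v(1)] by argo
  qed
  have "\<exists>n \<in> carrier N. push_charge W (a n) c0 U > 1 - e"
    if U: "openin W U" "w \<in> U" "e > 0" for U e
  proof -
    let ?S = "{d. d U > 1 - e}"
    have "open ?S"
      by (intro open_Collect_less continuous_intros continuous_on_product_coordinates)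
    moreover have "c \<in> ?S" using c1[OF U(1,2)] U(3) by simp
    ultimately have "?S \<inter> O0 \<noteq> {}"
      using c(1) open_Int_closure_eq_empty[of ?S O0] by blast
    then show ?thesis by (auto simp: O0_def)
  qed
  then show "\<exists>x \<in> topspace W. \<forall>U e. openin W U \<and> x \<in> U \<and> e > 0 \<longrightarrow>
      (\<exists>n \<in> carrier N. push_charge W (a n) c0 U > 1 - e)"
    using w(1) by blast
qed

end

section \<open>Subgroups of finite index\<close>

text \<open>Finite index as K = R L with a finite set \<open>R\<close>, possibly with repeated
  cosets. Such an \<open>R\<close> is what the later arguments consume: it indexes the evaluation
  maps of the coinduced flow and the cases of the pigeonhole argument.\<close>

definition finite_index_subgroup :: "('g, 'm) monoid_scheme \<Rightarrow> 'g set \<Rightarrow> bool"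
  where "finite_index_subgroup K L \<longleftrightarrow> subgroup L K \<and>
    (\<exists>R. finite R \<and> R \<subseteq> carrier K \<and> (\<forall>k \<in> carrier K. \<exists>r \<in> R. inv\<^bsub>K\<^esub> r \<otimes>\<^bsub>K\<^esub> k \<in> L))"

definition core :: "('g, 'm) monoid_scheme \<Rightarrow> 'g set \<Rightarrow> 'g set"
  where "core K L = {n \<in> carrier K. \<forall>k \<in> carrier K. inv\<^bsub>K\<^esub> k \<otimes>\<^bsub>K\<^esub> n \<otimes>\<^bsub>K\<^esub> k \<in> L}"

lemma finite_index_subgroup_subgroup: "finite_index_subgroup K L \<Longrightarrow> subgroup L K"
  by (simp add: finite_index_subgroup_def)

lemma finite_index_subgroupE:
  assumes "finite_index_subgroup K L"
  obtains R where "finite R" "R \<subseteq> carrier K"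
    "\<And>k. k \<in> carrier K \<Longrightarrow> \<exists>r \<in> R. inv\<^bsub>K\<^esub> r \<otimes>\<^bsub>K\<^esub> k \<in> L"
  using assms unfolding finite_index_subgroup_def by blast

context group
begin

lemma mult_inv_cancel:
  assumes "x \<in> carrier G" "y \<in> carrier G"
  shows "x \<otimes> (inv x \<otimes> y) = y" "inv x \<otimes> (x \<otimes> y) = y"
  using assms by (simp_all flip: m_assoc)

text \<open>Pigeonhole criterion: \<open>\<phi>\<close> is a labelling with finitely many labels,
  and elements with equal labels lie in the same left coset. One preimage per label represents all
  cosets.\<close>

lemma finite_index_subgroupI:
  assumes "subgroup L G" "finite (\<phi> ` carrier G)"
    and "\<And>k k'. k \<in> carrier G \<Longrightarrow> k' \<in> carrier G \<Longrightarrow> \<phi> k = \<phi> k' \<Longrightarrow> inv k \<otimes> k' \<in> L"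
  shows "finite_index_subgroup G L"
proof -
  let ?R = "inv_into (carrier G) \<phi> ` \<phi> ` carrier G"
  have "\<exists>r \<in> ?R. inv r \<otimes> k \<in> L" if k: "k \<in> carrier G" for k
  proof (rule bexI)
    show "inv_into (carrier G) \<phi> (\<phi> k) \<in> ?R" using k by blast
    show "inv (inv_into (carrier G) \<phi> (\<phi> k)) \<otimes> k \<in> L"
      using k by (intro assms(3) inv_into_into f_inv_into_f) auto
  qed
  moreover have "?R \<subseteq> carrier G" by (auto intro: inv_into_into)
  ultimately show ?thesis using assms(1,2) unfolding finite_index_subgroup_def by blast
qed

text \<open>The label of an element of \<open>L\<close> is its coset representative modulo
  \<open>A\<close>. This representative need not lie in \<open>L\<close>, which is why the labelling
  criterion is used rather than the representatives themselves.\<close>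

lemma finite_index_subgroup_Int:
  assumes A: "finite_index_subgroup G A" and L: "subgroup L G"
  shows "finite_index_subgroup (G\<lparr>carrier := L\<rparr>) (A \<inter> L)"
proof -
  obtain R where R: "finite R" "R \<subseteq> carrier G" "\<And>k. k \<in> carrier G \<Longrightarrow> \<exists>r \<in> R. inv r \<otimes> k \<in> A"
    using finite_index_subgroupE[OF A] by blast
  then obtain \<phi> where \<phi>: "\<And>k. k \<in> carrier G \<Longrightarrow> \<phi> k \<in> R \<and> inv (\<phi> k) \<otimes> k \<in> A" by metis
  have sA: "subgroup A G" by (rule finite_index_subgroup_subgroup[OF A])
  have LG: "L \<subseteq> carrier G" using L by (rule subgroup.subset)
  interpret LL: group "G\<lparr>carrier := L\<rparr>" by (rule subgroup_imp_group[OF L])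
  show ?thesis
  proof (rule LL.finite_index_subgroupI)
    show "subgroup (A \<inter> L) (G\<lparr>carrier := L\<rparr>)"
      by (intro subgroup_incl subgroups_Inter_pair sA L) auto
    show "finite (\<phi> ` carrier (G\<lparr>carrier := L\<rparr>))"
      by (rule finite_subset[OF _ R(1)]) (use \<phi> LG in auto)
    fix k k' assume kk: "k \<in> carrier (G\<lparr>carrier := L\<rparr>)" "k' \<in> carrier (G\<lparr>carrier := L\<rparr>)" "\<phi> k = \<phi> k'"
    then have kL: "k \<in> L" "k' \<in> L" "k \<in> carrier G" "k' \<in> carrier G" using LG by auto
    then have r: "\<phi> k \<in> carrier G" using \<phi> R(2) by blast
    have "inv (inv (\<phi> k) \<otimes> k) \<otimes> (inv (\<phi> k) \<otimes> k') \<in> A"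
      using \<phi>[OF kL(3)] \<phi>[OF kL(4)] kk(3) sA by (metis subgroup.m_closed subgroup.m_inv_closed)
    also have "inv (inv (\<phi> k) \<otimes> k) \<otimes> (inv (\<phi> k) \<otimes> k') = inv k \<otimes> k'"
      using kL r by (simp add: inv_mult_group m_assoc mult_inv_cancel)
    finally show "inv\<^bsub>G\<lparr>carrier := L\<rparr>\<^esub> k \<otimes>\<^bsub>G\<lparr>carrier := L\<rparr>\<^esub> k' \<in> A \<inter> L"
      using kL L by (simp add: m_inv_consistent subgroup.m_closed subgroup.m_inv_closed)
  qed
qed

lemma core_subset: "core G L \<subseteq> L"
proof
  fix n assume "n \<in> core G L"
  then have "n \<in> carrier G" "inv \<one> \<otimes> n \<otimes> \<one> \<in> L" unfolding core_def by blast+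
  then show "n \<in> L" by simp
qed

lemma core_conj:
  assumes n: "n \<in> core G L" and k: "k \<in> carrier G"
  shows "inv k \<otimes> n \<otimes> k \<in> core G L"
proof -
  have nG: "n \<in> carrier G" using n by (simp add: core_def)
  have "inv h \<otimes> (inv k \<otimes> n \<otimes> k) \<otimes> h \<in> L" if h: "h \<in> carrier G" for h
  proof -
    have "inv (k \<otimes> h) \<otimes> n \<otimes> (k \<otimes> h) \<in> L" using n k h by (simp add: core_def)
    then show ?thesis using k h nG by (simp add: inv_mult_group m_assoc)
  qed
  then show ?thesis using nG k by (simp add: core_def)
qed

text \<open>The core is the kernel of the permutation action on the left cosets of \<open>L\<close>.
  The label of \<open>k\<close> records this permutation as the function from \<open>r\<close> to
  the representative of the coset of \<open>k \<otimes> r\<close>, and there are finitely many such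
  functions from \<open>R\<close> to \<open>R\<close>.\<close>

lemma finite_index_core:
  assumes L: "finite_index_subgroup G L"
  shows "finite_index_subgroup G (core G L)"
proof -
  obtain R where R: "finite R" "R \<subseteq> carrier G" "\<And>k. k \<in> carrier G \<Longrightarrow> \<exists>r \<in> R. inv r \<otimes> k \<in> L"
    using finite_index_subgroupE[OF L] by blast
  then obtain \<sigma> where \<sigma>: "\<And>k. k \<in> carrier G \<Longrightarrow> \<sigma> k \<in> R \<and> inv (\<sigma> k) \<otimes> k \<in> L" by metis
  have sL: "subgroup L G" by (rule finite_index_subgroup_subgroup[OF L])
  define \<phi> where "\<phi> k = (\<lambda>r \<in> R. \<sigma> (k \<otimes> r))" for k
  show ?thesis
  proof (rule finite_index_subgroupI)
    show "subgroup (core G L) G"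
    proof (rule subgroupI)
      show "core G L \<subseteq> carrier G" by (auto simp: core_def)
      have "\<one> \<in> core G L" using subgroup.one_closed[OF sL] by (simp add: core_def)
      then show "core G L \<noteq> {}" by blast
    next
      fix n assume n: "n \<in> core G L"
      then have nG: "n \<in> carrier G" by (simp add: core_def)
      have "inv k \<otimes> inv n \<otimes> k \<in> L" if k: "k \<in> carrier G" for k
      proof -
        have "inv (inv k \<otimes> n \<otimes> k) \<in> L"
          using n k by (intro subgroup.m_inv_closed[OF sL]) (simp add: core_def)
        then show ?thesis using k nG by (simp add: inv_mult_group m_assoc)
      qed
      then show "inv n \<in> core G L" using nG by (simp add: core_def)
      fix m assume m: "m \<in> core G L"
      then have mG: "m \<in> carrier G" by (simp add: core_def)
      have "inv k \<otimes> (n \<otimes> m) \<otimes> k \<in> L" if k: "k \<in> carrier G" for k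
      proof -
        have "(inv k \<otimes> n \<otimes> k) \<otimes> (inv k \<otimes> m \<otimes> k) \<in> L"
          using n m k by (simp add: core_def subgroup.m_closed[OF sL])
        also have "(inv k \<otimes> n \<otimes> k) \<otimes> (inv k \<otimes> m \<otimes> k) = inv k \<otimes> (n \<otimes> m) \<otimes> k"
          using k nG mG by (simp add: m_assoc mult_inv_cancel)
        finally show ?thesis .
      qed
      then show "n \<otimes> m \<in> core G L" using nG mG by (simp add: core_def)
    qed
    have "\<phi> ` carrier G \<subseteq> R \<rightarrow>\<^sub>E R" using \<sigma> R(2) by (auto simp: \<phi>_def)
    then show "finite (\<phi> ` carrier G)" by (rule finite_subset) (simp add: R(1) finite_PiE)
    fix k k' assume k: "k \<in> carrier G" "k' \<in> carrier G" "\<phi> k = \<phi> k'"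
    \<comment> \<open>Equal labels mean that \<open>k \<otimes> r\<close> and
      \<open>k' \<otimes> r\<close> lie in the same coset for each representative
      \<open>r\<close>.\<close>
    have 1: "inv r \<otimes> (inv k \<otimes> k') \<otimes> r \<in> L" if r: "r \<in> R" for r
    proof -
      have rG: "r \<in> carrier G" using r R(2) by blast
      let ?s = "\<sigma> (k \<otimes> r)"
      have s: "?s \<in> carrier G" "inv ?s \<otimes> (k \<otimes> r) \<in> L" using \<sigma> R(2) k rG by (meson m_closed subsetD)+
      have "?s = \<sigma> (k' \<otimes> r)" using k(3) r unfolding \<phi>_def by (metis restrict_apply')
      then have "inv ?s \<otimes> (k' \<otimes> r) \<in> L" using \<sigma>[of "k' \<otimes> r"] k rG by simp
      then have "inv (inv ?s \<otimes> (k \<otimes> r)) \<otimes> (inv ?s \<otimes> (k' \<otimes> r)) \<in> L"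
        by (rule subgroup.m_closed[OF sL subgroup.m_inv_closed[OF sL s(2)]])
      also have "inv (inv ?s \<otimes> (k \<otimes> r)) \<otimes> (inv ?s \<otimes> (k' \<otimes> r)) = inv r \<otimes> (inv k \<otimes> k') \<otimes> r"
        using s(1) k rG by (simp add: inv_mult_group m_assoc mult_inv_cancel)
      finally show ?thesis .
    qed
    \<comment> \<open>An arbitrary \<open>h\<close> is a representative times an element of
      \<open>L\<close>, and conjugating by the latter does not leave \<open>L\<close>.\<close>
    have "inv h \<otimes> (inv k \<otimes> k') \<otimes> h \<in> L" if h: "h \<in> carrier G" for h
    proof -
      let ?r = "\<sigma> h"
      have r: "?r \<in> R" "?r \<in> carrier G" "inv ?r \<otimes> h \<in> L" using \<sigma>[OF h] R(2) by auto
      have "inv (inv ?r \<otimes> h) \<otimes> (inv ?r \<otimes> (inv k \<otimes> k') \<otimes> ?r) \<otimes> (inv ?r \<otimes> h) \<in> L"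
        by (rule subgroup.m_closed[OF sL subgroup.m_closed[OF sL
              subgroup.m_inv_closed[OF sL r(3)] 1[OF r(1)]] r(3)])
      also have "inv (inv ?r \<otimes> h) \<otimes> (inv ?r \<otimes> (inv k \<otimes> k') \<otimes> ?r) \<otimes> (inv ?r \<otimes> h) =
          inv h \<otimes> (inv k \<otimes> k') \<otimes> h"
        using r(2) k h by (simp add: inv_mult_group m_assoc mult_inv_cancel)
      finally show ?thesis .
    qed
    then show "inv k \<otimes> k' \<in> core G L" using k by (simp add: core_def)
  qed
qed

end


section \<open>Restriction to a subgroup of finite index\<close>

lemma restrict_flow:
  assumes fl: "discrete_flow K X a" and L: "subgroup L K"
  shows "discrete_flow (K\<lparr>carrier := L\<rparr>) X a"
proof (rule discrete_flowI)
  have LK: "L \<subseteq> carrier K" using L by (rule subgroup.subset)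
  interpret group K by (rule flow_group[OF fl])
  show "group (K\<lparr>carrier := L\<rparr>)" by (rule subgroup_imp_group[OF L])
  show "topspace X \<noteq> {}" "compact_space X" "Hausdorff_space X"
    using flow_nonempty[OF fl] flow_compact[OF fl] flow_Hausdorff[OF fl] by auto
  show "continuous_map X X (a k)" if "k \<in> carrier (K\<lparr>carrier := L\<rparr>)" for k
    using flow_continuous[OF fl] that LK by auto
  show "a k \<in> extensional (topspace X)" if "k \<in> carrier (K\<lparr>carrier := L\<rparr>)" for k
    using flow_Bij[OF fl] that LK by (auto simp: Bij_def)
  show "a \<one>\<^bsub>K\<lparr>carrier := L\<rparr>\<^esub> x = x" if "x \<in> topspace X" for x
    using flow_one[OF fl that] by simp
  show "a (k \<otimes>\<^bsub>K\<lparr>carrier := L\<rparr>\<^esub> l) x = a k (a l x)"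
    if "k \<in> carrier (K\<lparr>carrier := L\<rparr>)" "l \<in> carrier (K\<lparr>carrier := L\<rparr>)" "x \<in> topspace X" for k l x
    using flow_mult[OF fl _ _ that(3)] that LK by auto
qed

lemma contracting_mono:
  assumes "contracting D (K\<lparr>carrier := L\<rparr>) X a" "L \<subseteq> carrier K"
  shows "contracting D K X a"
  using assms unfolding contracting_def by (simp, meson subsetD)

text \<open>Acting by n on r x gives the same point as applying r after (r^-1 n r), so it stays in
  the translate of \<open>M\<close>. The translate is closed because it is compact.\<close>

lemma invariant_closed_translate:
  fixes K (structure)
  assumes fl: "discrete_flow K X a" and N: "N \<subseteq> carrier K"
    and M: "invariant_closed (K\<lparr>carrier := N\<rparr>) X a M"
    and r: "r \<in> carrier K" and conj: "\<And>n. n \<in> N \<Longrightarrow> inv r \<otimes> n \<otimes> r \<in> N"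
  shows "invariant_closed (K\<lparr>carrier := N\<rparr>) X a (a r ` M)"
proof -
  interpret group K by (rule flow_group[OF fl])
  have sub: "M \<subseteq> topspace X" by (rule invariant_closed_subset[OF M])
  have inv: "a n x \<in> M" if "n \<in> N" "x \<in> M" for n x
    using M that by (simp add: invariant_closed_def)
  have "compactin X M"
    using M flow_compact[OF fl] by (simp add: closedin_compact_space invariant_closed_def)
  then have "compactin X (a r ` M)" by (rule image_compactin[OF _ flow_continuous[OF fl r]])
  then have "closedin X (a r ` M)" by (rule compactin_imp_closedin[OF flow_Hausdorff[OF fl]])
  moreover have "a n (a r x) \<in> a r ` M" if n: "n \<in> N" and x: "x \<in> M" for n x
  proof -
    have nK: "n \<in> carrier K" and xX: "x \<in> topspace X" using n x N sub by auto
    let ?m = "inv r \<otimes> n \<otimes> r"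
    have "a r (a ?m x) = a (r \<otimes> ?m) x" using flow_mult[OF fl r _ xX, of ?m] nK r by simp
    also have "r \<otimes> ?m = n \<otimes> r" using nK r by (simp add: m_assoc mult_inv_cancel)
    also have "a (n \<otimes> r) x = a n (a r x)" by (rule flow_mult[OF fl nK r xX])
    finally show ?thesis using inv[OF conj[OF n] x] by (metis imageI)
  qed
  ultimately show ?thesis using M by (auto simp: invariant_closed_def)
qed

context charge_values
begin

text \<open>If \<open>k\<close> concentrates \<open>c\<close> near \<open>x\<close> and
  \<open>inv r \<otimes> k\<close> lies in \<open>L\<close>, then \<open>inv r \<otimes> k\<close>
  concentrates \<open>c\<close> near \<open>a (inv r) x\<close>. As there are only finitely many
  \<open>r\<close>, one of these points serves for all neighbourhoods and all
  \<open>e\<close>.\<close>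

lemma contracting_restrict:
  fixes K (structure)
  assumes fl: "discrete_flow K X a" and a: "contracting D K X a" and L: "finite_index_subgroup K L"
  shows "contracting D (K\<lparr>carrier := L\<rparr>) X a"
  unfolding contracting_def
proof
  fix c assume c: "c \<in> charges D X"
  interpret group K by (rule flow_group[OF fl])
  obtain R where R: "finite R" "R \<subseteq> carrier K" "\<And>k. k \<in> carrier K \<Longrightarrow> \<exists>r \<in> R. inv r \<otimes> k \<in> L"
    using finite_index_subgroupE[OF L] by blast
  have LK: "L \<subseteq> carrier K"
    using finite_index_subgroup_subgroup[OF L] by (rule subgroup.subset)
  obtain x where x: "x \<in> topspace X"
    "\<And>U e. openin X U \<Longrightarrow> x \<in> U \<Longrightarrow> e > 0 \<Longrightarrow> \<exists>k \<in> carrier K. push_charge X (a k) c U > 1 - e"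
    using a c unfolding contracting_def by metis
  have "\<exists>r \<in> R. \<forall>U e. openin X U \<and> a (inv r) x \<in> U \<and> e > 0 \<longrightarrow>
      (\<exists>l \<in> L. push_charge X (a l) c U > 1 - e)"
  proof (rule ccontr)
    assume "\<not> ?thesis"
    then have "\<forall>r \<in> R. \<exists>U e. openin X U \<and> a (inv r) x \<in> U \<and> e > 0 \<and>
      (\<forall>l \<in> L. push_charge X (a l) c U \<le> 1 - e)" by (meson not_le_imp_less)
    then obtain U e where Ue: "\<And>r. r \<in> R \<Longrightarrow> openin X (U r) \<and> a (inv r) x \<in> U r \<and> e r > 0 \<and>
      (\<forall>l \<in> L. push_charge X (a l) c (U r) \<le> 1 - e r)" by metis
    \<comment> \<open>The bad neighbourhoods of the points \<open>a (inv r) x\<close> are pulled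
      back to neighbourhoods of \<open>x\<close>, where they can be intersected.\<close>
    define W where "W r = {y \<in> topspace X. a (inv r) y \<in> U r}" for r
    define d where "d = Min (insert 1 (e ` R))"
    have opW: "openin X (W r)" if "r \<in> R" for r
    proof -
      have "continuous_map X X (a (inv r))" using R(2) that by (intro flow_continuous[OF fl]) auto
      then show ?thesis using Ue[OF that] by (simp add: continuous_map_def W_def)
    qed
    have "openin X ((\<Inter>r \<in> R. W r) \<inter> topspace X)" by (rule openin_INT[OF R(1) opW])
    moreover have "x \<in> (\<Inter>r \<in> R. W r) \<inter> topspace X" using x(1) Ue by (simp add: W_def)
    moreover have "d > 0" using R(1) Ue by (auto simp: d_def)
    ultimately obtain k where k: "k \<in> carrier K"
      "push_charge X (a k) c ((\<Inter>r \<in> R. W r) \<inter> topspace X) > 1 - d" using x(2) by blast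
    obtain r where r: "r \<in> R" "inv r \<otimes> k \<in> L" using R(3)[OF k(1)] by blast
    let ?l = "inv r \<otimes> k"
    have rK: "r \<in> carrier K" using r(1) R(2) by blast
    have "a ?l y = a (inv r) (a k y)" if "y \<in> topspace X" for y
      using flow_mult[OF fl _ k(1) that, of "inv r"] rK by simp
    then have sub: "{y \<in> topspace X. a k y \<in> (\<Inter>r \<in> R. W r) \<inter> topspace X} \<subseteq> {y \<in> topspace X. a ?l y \<in> U r}"
      using r(1) by (auto simp: W_def)
    have "openin X {y \<in> topspace X. a k y \<in> (\<Inter>r \<in> R. W r) \<inter> topspace X}"
      using flow_continuous[OF fl k(1)] \<open>openin X ((\<Inter>r \<in> R. W r) \<inter> topspace X)\<close>
      unfolding continuous_map_def by blast
    moreover have "openin X {y \<in> topspace X. a ?l y \<in> U r}"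
      using flow_continuous[OF fl, of ?l] Ue[OF r(1)] r(2) LK unfolding continuous_map_def by blast
    ultimately have "push_charge X (a k) c ((\<Inter>r \<in> R. W r) \<inter> topspace X) \<le> push_charge X (a ?l) c (U r)"
      unfolding push_charge_def using sub by (intro charge_mono[OF c] openin_sets_borel_algebra)
    also have "\<dots> \<le> 1 - e r" using Ue[OF r(1)] r(2) by blast
    also have "\<dots> \<le> 1 - d" using R(1) r(1) by (simp add: d_def)
    finally show False using k(2) by simp
  qed
  then obtain r where r: "r \<in> R" "\<forall>U e. openin X U \<and> a (inv r) x \<in> U \<and> e > 0 \<longrightarrow>
      (\<exists>l \<in> L. push_charge X (a l) c U > 1 - e)" by blast
  moreover have "a (inv r) x \<in> topspace X"
    using r(1) R(2) by (intro flow_maps_to[OF fl _ x(1)]) auto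
  ultimately show "\<exists>x \<in> topspace X. \<forall>U e. openin X U \<and> x \<in> U \<and> e > 0 \<longrightarrow>
      (\<exists>k \<in> carrier (K\<lparr>carrier := L\<rparr>). push_charge X (a k) c U > 1 - e)" by auto
qed

text \<open>Contraction is applied to the average of the point masses at \<open>x\<close> and
  \<open>y\<close>: a set of mass above 1/2 must contain both points.\<close>

lemma contracting_pairs:
  assumes a: "contracting D K X a" and xy: "x \<in> topspace X" "y \<in> topspace X"
    and to: "\<And>k z. k \<in> carrier K \<Longrightarrow> z \<in> topspace X \<Longrightarrow> a k z \<in> topspace X"
  shows "\<exists>z \<in> topspace X. \<forall>U. openin X U \<and> z \<in> U \<longrightarrow> (\<exists>k \<in> carrier K. a k x \<in> U \<and> a k y \<in> U)"
proof -
  define c where "c A = (indicator A x + indicator A y) / (2 :: real)" for A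
  have "c \<in> charges D X"
    using D_half xy by (auto simp: charges_def c_def indicator_def)
  then obtain z where z: "z \<in> topspace X"
    "\<And>U e. openin X U \<Longrightarrow> z \<in> U \<Longrightarrow> e > 0 \<Longrightarrow> \<exists>k \<in> carrier K. push_charge X (a k) c U > 1 - e"
    using a unfolding contracting_def by metis
  have "\<exists>k \<in> carrier K. a k x \<in> U \<and> a k y \<in> U" if U: "openin X U" "z \<in> U" for U
  proof -
    obtain k where k: "k \<in> carrier K" "push_charge X (a k) c U > 1 - 1 / 2"
      using z(2)[OF U, of "1 / 2"] by auto
    then have "a k x \<in> U \<and> a k y \<in> U" using xy
      by (cases "a k x \<in> U"; cases "a k y \<in> U") (auto simp: push_charge_def c_def indicator_def)
    then show ?thesis using k(1) by blast
  qed
  then show ?thesis using z(1) by blast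
qed

text \<open>A pair with one point in each set is brought together at some \<open>z\<close>. Both
  sets are invariant and closed, so \<open>z\<close> lies in each of them.\<close>

lemma invariant_closed_meet:
  assumes fl: "flow K T X a" and a: "contracting D K X a"
    and M: "invariant_closed K X a M" and M': "invariant_closed K X a M'"
  shows "M \<inter> M' \<noteq> {}"
proof -
  obtain x y where xy: "x \<in> M" "y \<in> M'" using M M' unfolding invariant_closed_def by blast
  then have "x \<in> topspace X" "y \<in> topspace X"
    using invariant_closed_subset[OF M] invariant_closed_subset[OF M'] by auto
  then obtain z where z: "z \<in> topspace X"
    "\<And>U. openin X U \<Longrightarrow> z \<in> U \<Longrightarrow> \<exists>k \<in> carrier K. a k x \<in> U \<and> a k y \<in> U"
    using contracting_pairs[OF a] flow_maps_to[OF fl] by metis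
  have op: "openin X (topspace X - M)" "openin X (topspace X - M')"
    using M M' by (auto simp: invariant_closed_def)
  have "z \<in> M"
  proof (rule ccontr)
    assume "z \<notin> M"
    then obtain k where "k \<in> carrier K" "a k x \<notin> M" using z(1) z(2)[OF op(1)] by blast
    then show False using M xy(1) by (auto simp: invariant_closed_def)
  qed
  moreover have "z \<in> M'"
  proof (rule ccontr)
    assume "z \<notin> M'"
    then obtain k where "k \<in> carrier K" "a k y \<notin> M'" using z(1) z(2)[OF op(2)] by blast
    then show False using M' xy(2) by (auto simp: invariant_closed_def)
  qed
  ultimately show ?thesis by blast
qed

text \<open>For the normal core \<open>N\<close> of \<open>L\<close>, the translates of an \<open>N\<close>-minimal set are \<open>N\<close>-minimal. By proximality
  they all meet, so there is only one, and it is invariant under \<open>K\<close>.\<close>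

lemma minimal_restrict:
  fixes K (structure)
  assumes min: "discrete_minimal_flow K X a" and a: "contracting D K X a"
    and L: "finite_index_subgroup K L"
  shows "discrete_minimal_flow (K\<lparr>carrier := L\<rparr>) X a"
proof -
  have fl: "discrete_flow K X a" by (rule minimal_flow_flow[OF min])
  interpret group K by (rule flow_group[OF fl])
  let ?N = "core K L"
  have N: "finite_index_subgroup K ?N" by (rule finite_index_core[OF L])
  have sN: "subgroup ?N K" and sL: "subgroup L K"
    using N L by (auto intro: finite_index_subgroup_subgroup)
  have flN: "discrete_flow (K\<lparr>carrier := ?N\<rparr>) X a" by (rule restrict_flow[OF fl sN])
  have cN: "contracting D (K\<lparr>carrier := ?N\<rparr>) X a" by (rule contracting_restrict[OF fl a N])
  obtain M where M: "invariant_closed (K\<lparr>carrier := ?N\<rparr>) X a M"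
    "\<And>M'. invariant_closed (K\<lparr>carrier := ?N\<rparr>) X a M' \<Longrightarrow> M' \<subseteq> M \<Longrightarrow> M' = M"
    using exists_minimal_set[OF flN] by metis
  have sub: "M \<subseteq> topspace X" by (rule invariant_closed_subset[OF M(1)])
  have trans: "M \<subseteq> a r ` M" if r: "r \<in> carrier K" for r
  proof -
    have rM: "invariant_closed (K\<lparr>carrier := ?N\<rparr>) X a (a r ` M)"
      using core_conj r by (intro invariant_closed_translate[OF fl subgroup.subset[OF sN] M(1)]) auto
    have "M \<inter> a r ` M \<noteq> {}" by (rule invariant_closed_meet[OF flN cN M(1) rM])
    then have "invariant_closed (K\<lparr>carrier := ?N\<rparr>) X a (M \<inter> a r ` M)"
      using M(1) rM unfolding invariant_closed_def by blast
    then have "M \<inter> a r ` M = M" by (rule M(2)) simp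
    then show ?thesis by blast
  qed
  have "a r x \<in> M" if r: "r \<in> carrier K" and x: "x \<in> M" for r x
  proof -
    obtain y where y: "y \<in> M" "x = a (inv r) y" using trans[of "inv r"] r x by auto
    then show ?thesis using flow_inv_right[OF fl r] sub by auto
  qed
  then have "invariant_closed K X a M" using M(1) by (simp add: invariant_closed_def)
  then have MX: "M = topspace X" by (rule minimal_flowD[OF min])
  have "discrete_flow (K\<lparr>carrier := L\<rparr>) X a" by (rule restrict_flow[OF fl sL])
  then show ?thesis
  proof (rule minimal_flowI)
    fix M' assume M': "invariant_closed (K\<lparr>carrier := L\<rparr>) X a M'"
    then have "invariant_closed (K\<lparr>carrier := ?N\<rparr>) X a M'"
      using core_subset[of L] by (auto simp: invariant_closed_def)
    then show "M' = topspace X" using M(2) MX invariant_closed_subset[OF M'] by blast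
  qed
qed

end

section \<open>Coinduced flows\<close>

text \<open>When \<open>L\<close> is a subgroup acting by \<open>b\<close>, the value at
  \<open>k\<close> determines \<open>f\<close> on the whole coset of \<open>k\<close>, so this is a
  copy of the power of \<open>V\<close> over the left cosets of \<open>L\<close>. Realising it
  inside the power over all of \<open>K\<close> avoids a choice of representatives, and left
  translation becomes the action.\<close>

definition coinduced_space ::
    "('g, 'm) monoid_scheme \<Rightarrow> 'g set \<Rightarrow> 'v topology \<Rightarrow> ('g \<Rightarrow> 'v \<Rightarrow> 'v) \<Rightarrow> ('g \<Rightarrow> 'v) topology"
  where "coinduced_space K L V b = subtopology (product_topology (\<lambda>_. V) (carrier K))
    {f. \<forall>k \<in> carrier K. \<forall>l \<in> L. f (k \<otimes>\<^bsub>K\<^esub> l) = b (inv\<^bsub>K\<^esub> l) (f k)}"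

definition coinduced_action ::
    "('g, 'm) monoid_scheme \<Rightarrow> 'g set \<Rightarrow> 'v topology \<Rightarrow> ('g \<Rightarrow> 'v \<Rightarrow> 'v) \<Rightarrow> 'g \<Rightarrow> ('g \<Rightarrow> 'v) \<Rightarrow> 'g \<Rightarrow> 'v"
  where "coinduced_action K L V b k =
    (\<lambda>f \<in> topspace (coinduced_space K L V b). \<lambda>h \<in> carrier K. f (inv\<^bsub>K\<^esub> k \<otimes>\<^bsub>K\<^esub> h))"

lemma coinduced_spaceE:
  fixes K (structure)
  assumes "f \<in> topspace (coinduced_space K L V b)"
  shows "f \<in> carrier K \<rightarrow>\<^sub>E topspace V"
    "k \<in> carrier K \<Longrightarrow> l \<in> L \<Longrightarrow> f (k \<otimes> l) = b (inv l) (f k)"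
  using assms by (auto simp: coinduced_space_def)

lemma coinduced_spaceI:
  fixes K (structure)
  assumes "f \<in> carrier K \<rightarrow>\<^sub>E topspace V"
    "\<And>k l. k \<in> carrier K \<Longrightarrow> l \<in> L \<Longrightarrow> f (k \<otimes> l) = b (inv l) (f k)"
  shows "f \<in> topspace (coinduced_space K L V b)"
  using assms by (auto simp: coinduced_space_def)

lemma coinduced_action_apply:
  assumes "f \<in> topspace (coinduced_space K L V b)" "h \<in> carrier K"
  shows "coinduced_action K L V b k f h = f (inv\<^bsub>K\<^esub> k \<otimes>\<^bsub>K\<^esub> h)"
  using assms by (simp add: coinduced_action_def)

lemma continuous_map_coinduced_eval:
  assumes "k \<in> carrier K"
  shows "continuous_map (coinduced_space K L V b) V (\<lambda>f. f k)"
  unfolding coinduced_space_def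
  by (intro continuous_map_from_subtopology continuous_map_product_coordinates assms)

context group
begin

context
  fixes L and V :: "'v topology" and b
  assumes L: "subgroup L G" and V: "discrete_flow (G\<lparr>carrier := L\<rparr>) V b"
begin

lemma coinduced_action_in_space:
  assumes k: "k \<in> carrier G" and f: "f \<in> topspace (coinduced_space G L V b)"
  shows "coinduced_action G L V b k f \<in> topspace (coinduced_space G L V b)"
proof (rule coinduced_spaceI)
  show "coinduced_action G L V b k f \<in> carrier G \<rightarrow>\<^sub>E topspace V"
    using coinduced_spaceE(1)[OF f] f k by (auto simp: coinduced_action_def)
  fix h l assume h: "h \<in> carrier G" and l: "l \<in> L"
  then have lG: "l \<in> carrier G" using subgroup.subset[OF L] by blast
  have "f ((inv k \<otimes> h) \<otimes> l) = b (inv l) (f (inv k \<otimes> h))"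
    using k h by (intro coinduced_spaceE(2)[OF f _ l]) simp
  then show "coinduced_action G L V b k f (h \<otimes> l) = b (inv l) (coinduced_action G L V b k f h)"
    using k h lG by (simp add: coinduced_action_apply[OF f] m_assoc)
qed

lemma coinduced_flow: "discrete_flow G (coinduced_space G L V b) (coinduced_action G L V b)"
proof (rule discrete_flowI)
  let ?W = "coinduced_space G L V b"
  let ?P = "product_topology (\<lambda>_. V) (carrier G)"
  let ?a = "coinduced_action G L V b"
  have LG: "L \<subseteq> carrier G" by (rule subgroup.subset[OF L])
  show "group G" by (rule is_group)
  have H: "Hausdorff_space V" and C: "compact_space V" and "topspace V \<noteq> {}"
    using flow_Hausdorff[OF V] flow_compact[OF V] flow_nonempty[OF V] by auto
  then obtain v where v: "v \<in> topspace V" by blast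
  have P: "compact_space ?P" "Hausdorff_space ?P"
    using C H by (simp_all add: compact_space_product_topology Hausdorff_space_product_topology)
  let ?eq = "\<lambda>k l. {f \<in> topspace ?P. f (k \<otimes> l) = b (inv l) (f k)}"
  have "closedin ?P (?eq k l)" if k: "k \<in> carrier G" and l: "l \<in> L" for k l
  proof (rule closedin_continuous_maps_eq[OF H])
    show "continuous_map ?P V (\<lambda>f. f (k \<otimes> l))"
      using k l LG by (intro continuous_map_product_coordinates) auto
    have "continuous_map V V (b (inv l))"
      by (rule flow_continuous[OF V]) (use l subgroup.m_inv_closed[OF L] in simp)
    then have "continuous_map ?P V (b (inv l) \<circ> (\<lambda>f. f k))"
      by (rule continuous_map_compose[rotated]) (rule continuous_map_product_coordinates[OF k])
    then show "continuous_map ?P V (\<lambda>f. b (inv l) (f k))" by (simp add: o_def)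
  qed
  then have "closedin ?P (topspace ?P \<inter> (\<Inter>k \<in> carrier G. \<Inter>l \<in> L. ?eq k l))"
    using one_closed subgroup.one_closed[OF L] by (intro closedin_Int closedin_INT closedin_topspace) blast+
  moreover have eq: "topspace ?P \<inter> (\<Inter>k \<in> carrier G. \<Inter>l \<in> L. ?eq k l) =
      topspace ?P \<inter> {f. \<forall>k \<in> carrier G. \<forall>l \<in> L. f (k \<otimes> l) = b (inv l) (f k)}"
    by auto
  have "?W = subtopology ?P (topspace ?P \<inter> (\<Inter>k \<in> carrier G. \<Inter>l \<in> L. ?eq k l))"
    unfolding eq coinduced_space_def subtopology_restrict by (rule refl)
  ultimately show "compact_space ?W"
    using P(1) by (simp add: compact_space_subtopology closedin_compact_space)
  show "Hausdorff_space ?W"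
    unfolding coinduced_space_def by (rule Hausdorff_space_subtopology[OF P(2)])
  show "topspace ?W \<noteq> {}"
  proof -
    \<comment> \<open>\<open>s k\<close> represents the coset of \<open>k\<close> and depends on
      that coset only, because the predicate under \<open>SOME\<close> does. Hence the map from
      \<open>k\<close> to \<open>b (inv k \<otimes> s k) v\<close> satisfies the equivariance
      condition.\<close>
    define s where "s k = (SOME r. r \<in> carrier G \<and> inv k \<otimes> r \<in> L)" for k
    have s: "s k \<in> carrier G \<and> inv k \<otimes> s k \<in> L" if k: "k \<in> carrier G" for k
      unfolding s_def by (rule someI[of _ k]) (use k subgroup.one_closed[OF L] in simp)
    have sl: "s (k \<otimes> l) = s k" if k: "k \<in> carrier G" and l: "l \<in> L" for k l
    proof -
      have lG: "l \<in> carrier G" using l LG by blast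
      have "inv (k \<otimes> l) \<otimes> r \<in> L \<longleftrightarrow> inv k \<otimes> r \<in> L" if r: "r \<in> carrier G" for r
      proof -
        have eq: "inv (k \<otimes> l) \<otimes> r = inv l \<otimes> (inv k \<otimes> r)"
          using k r lG by (simp add: inv_mult_group m_assoc)
        have eq': "inv k \<otimes> r = l \<otimes> (inv l \<otimes> (inv k \<otimes> r))"
          using k r lG by (simp add: mult_inv_cancel)
        show ?thesis
          unfolding eq using eq' l by (metis subgroup.m_closed[OF L] subgroup.m_inv_closed[OF L])
      qed
      then have "(\<lambda>r. r \<in> carrier G \<and> inv (k \<otimes> l) \<otimes> r \<in> L) = (\<lambda>r. r \<in> carrier G \<and> inv k \<otimes> r \<in> L)"
        by blast
      then show ?thesis by (simp add: s_def)
    qed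
    have "(\<lambda>k \<in> carrier G. b (inv k \<otimes> s k) v) \<in> topspace ?W"
    proof (rule coinduced_spaceI)
      show "(\<lambda>k \<in> carrier G. b (inv k \<otimes> s k) v) \<in> carrier G \<rightarrow>\<^sub>E topspace V"
        using flow_maps_to[OF V _ v] s by auto
      fix k l assume k: "k \<in> carrier G" and l: "l \<in> L"
      then have lG: "l \<in> carrier G" using LG by blast
      have "inv (k \<otimes> l) \<otimes> s k = inv l \<otimes> (inv k \<otimes> s k)"
        using k s[OF k] lG by (simp add: inv_mult_group m_assoc)
      then have "b (inv (k \<otimes> l) \<otimes> s (k \<otimes> l)) v = b (inv l \<otimes> (inv k \<otimes> s k)) v"
        using sl[OF k l] by simp
      also have "\<dots> = b (inv l) (b (inv k \<otimes> s k) v)"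
        using flow_mult[OF V _ _ v, of "inv l" "inv k \<otimes> s k"] s[OF k] subgroup.m_inv_closed[OF L l] by simp
      finally show "(\<lambda>k \<in> carrier G. b (inv k \<otimes> s k) v) (k \<otimes> l) =
          b (inv l) ((\<lambda>k \<in> carrier G. b (inv k \<otimes> s k) v) k)"
        using k lG by simp
    qed
    then show ?thesis by blast
  qed
  fix k assume k: "k \<in> carrier G"
  show "?a k \<in> extensional (topspace ?W)" by (simp add: coinduced_action_def)
  have "continuous_map ?W ?P (?a k)"
  proof (rule continuous_map_coordinatewise_then_product)
    fix h assume h: "h \<in> carrier G"
    have "continuous_map ?W V (\<lambda>f. f (inv k \<otimes> h))"
      using k h by (intro continuous_map_coinduced_eval) simp
    then show "continuous_map ?W V (\<lambda>f. ?a k f h)"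
      by (rule continuous_map_eq) (simp add: coinduced_action_apply h)
  qed (simp add: coinduced_action_def)
  then show "continuous_map ?W ?W (?a k)"
    using coinduced_action_in_space[OF k]
    by (subst (2) coinduced_space_def) (auto simp: continuous_map_in_subtopology coinduced_space_def)
next
  fix f assume f: "f \<in> topspace (coinduced_space G L V b)"
  have ext: "f \<in> extensional (carrier G)" using coinduced_spaceE(1)[OF f] by (simp add: PiE_def)
  show "coinduced_action G L V b \<one> f = f"
  proof
    fix h show "coinduced_action G L V b \<one> f h = f h"
      using f ext by (cases "h \<in> carrier G") (simp_all add: coinduced_action_def extensional_def)
  qed
  fix k l assume k: "k \<in> carrier G" and l: "l \<in> carrier G"
  show "coinduced_action G L V b (k \<otimes> l) f = coinduced_action G L V b k (coinduced_action G L V b l f)"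
  proof
    fix h
    have "coinduced_action G L V b l f \<in> topspace (coinduced_space G L V b)"
      by (rule coinduced_action_in_space[OF l f])
    then show "coinduced_action G L V b (k \<otimes> l) f h =
        coinduced_action G L V b k (coinduced_action G L V b l f) h"
      using f k l by (cases "h \<in> carrier G")
        (simp_all add: coinduced_action_def inv_mult_group m_assoc)
  qed
qed

end

end

context charge_values
begin

text \<open>For n in the core, (n f)(r) = f(n^-1 r) = (r^-1 n r) f(r). So evaluation at
  \<open>r\<close> is equivariant for the core when \<open>V\<close> carries its action twisted by
  conjugation with \<open>r\<close>. The evaluations at the finitely many representatives separate
  points, and each twisted flow is contracting, so \<open>contracting_jointly_injective\<close>
  applies. Contraction under the core implies contraction under \<open>K\<close>.\<close>

lemma contracting_coinduced:
  fixes K (structure)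
  assumes K: "group K" and L: "finite_index_subgroup K L"
    and V: "discrete_flow (K\<lparr>carrier := L\<rparr>) V b" and b: "contracting D (K\<lparr>carrier := L\<rparr>) V b"
  shows "contracting D K (coinduced_space K L V b) (coinduced_action K L V b)"
proof -
  interpret group K by fact
  let ?N = "core K L"
  let ?W = "coinduced_space K L V b" and ?a = "coinduced_action K L V b"
  have sL: "subgroup L K" by (rule finite_index_subgroup_subgroup[OF L])
  have N: "finite_index_subgroup K ?N" by (rule finite_index_core[OF L])
  have sN: "subgroup ?N K" by (rule finite_index_subgroup_subgroup[OF N])
  have NK: "?N \<subseteq> carrier K" and NL: "?N \<subseteq> L" by (rule subgroup.subset[OF sN], rule core_subset)
  have W: "discrete_flow K ?W ?a" by (rule coinduced_flow[OF sL V])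
  obtain R where R: "finite R" "R \<subseteq> carrier K" "\<And>k. k \<in> carrier K \<Longrightarrow> \<exists>r \<in> R. inv r \<otimes> k \<in> L"
    using finite_index_subgroupE[OF L] by blast
  have "?N \<inter> L = ?N" using NL by blast
  then have "finite_index_subgroup (K\<lparr>carrier := L\<rparr>) ?N"
    using finite_index_subgroup_Int[OF N sL] by simp
  then have VN: "discrete_flow (K\<lparr>carrier := ?N\<rparr>) V b" "contracting D (K\<lparr>carrier := ?N\<rparr>) V b"
    using restrict_flow[OF V finite_index_subgroup_subgroup] contracting_restrict[OF V b] by force+
  define c where "c r n = b (inv r \<otimes> n \<otimes> r)" for r n
  have "contracting D (K\<lparr>carrier := ?N\<rparr>) ?W ?a"
  proof (rule contracting_jointly_injective[where I = R and V = "\<lambda>_. V" and b = c and p = "\<lambda>r f. f r"])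
    show "discrete_flow (K\<lparr>carrier := ?N\<rparr>) ?W ?a" by (rule restrict_flow[OF W sN])
    fix r assume "r \<in> R"
    then have r: "r \<in> carrier K" using R(2) by blast
    note conj = core_conj[OF _ r]
    show "discrete_flow (K\<lparr>carrier := ?N\<rparr>) V (c r)"
    proof (rule discrete_flowI)
      show "group (K\<lparr>carrier := ?N\<rparr>)" by (rule subgroup_imp_group[OF sN])
      show "topspace V \<noteq> {}" "compact_space V" "Hausdorff_space V"
        using flow_nonempty[OF V] flow_compact[OF V] flow_Hausdorff[OF V] by auto
      show "continuous_map V V (c r n)" if "n \<in> carrier (K\<lparr>carrier := ?N\<rparr>)" for n
        unfolding c_def using conj that by (intro flow_continuous[OF VN(1)]) simp
      show "c r n \<in> extensional (topspace V)" if "n \<in> carrier (K\<lparr>carrier := ?N\<rparr>)" for n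
        using flow_Bij[OF VN(1), of "inv r \<otimes> n \<otimes> r"] conj that by (simp add: c_def Bij_def)
      fix x assume x: "x \<in> topspace V"
      show "c r \<one>\<^bsub>K\<lparr>carrier := ?N\<rparr>\<^esub> x = x" using flow_one[OF V x] r by (simp add: c_def)
      fix n m assume "n \<in> carrier (K\<lparr>carrier := ?N\<rparr>)" "m \<in> carrier (K\<lparr>carrier := ?N\<rparr>)"
      then have nm: "n \<in> ?N" "m \<in> ?N" "n \<in> carrier K" "m \<in> carrier K" using NK by auto
      have "inv r \<otimes> (n \<otimes> m) \<otimes> r =
          (inv r \<otimes> n \<otimes> r) \<otimes> (inv r \<otimes> m \<otimes> r)"
        using nm r by (simp add: m_assoc mult_inv_cancel)
      then show "c r (n \<otimes>\<^bsub>K\<lparr>carrier := ?N\<rparr>\<^esub> m) x = c r n (c r m x)"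
        using flow_mult[OF VN(1) _ _ x] conj nm by (simp add: c_def)
    qed
    show "contracting D (K\<lparr>carrier := ?N\<rparr>) V (c r)"
      unfolding contracting_def
    proof
      fix d assume "d \<in> charges D V"
      then have "\<exists>x \<in> topspace V. \<forall>U e. openin V U \<and> x \<in> U \<and> e > 0 \<longrightarrow>
          (\<exists>n \<in> ?N. push_charge V (b n) d U > 1 - e)"
        using VN(2) by (simp add: contracting_def)
      then obtain x where x: "x \<in> topspace V" "\<And>U e. openin V U \<Longrightarrow> x \<in> U \<Longrightarrow> e > 0 \<Longrightarrow>
          \<exists>n \<in> ?N. push_charge V (b n) d U > 1 - e"
        by blast
      have "\<exists>n \<in> ?N. push_charge V (c r n) d U > 1 - e" if U: "openin V U" "x \<in> U" "e > 0" for U e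
      proof -
        obtain n where n: "n \<in> ?N" "push_charge V (b n) d U > 1 - e" using x(2)[OF U] by blast
        have nK: "n \<in> carrier K" using n(1) NK by blast
        \<comment> \<open>Normality with the inverse of \<open>r\<close>: the twist sends
          \<open>r \<otimes> n \<otimes> inv r\<close> back to \<open>n\<close>, so every map of the
          original action of the core occurs in the twisted one.\<close>
        have "inv (inv r) \<otimes> n \<otimes> inv r \<in> ?N" by (rule core_conj[OF n(1)]) (use r in simp)
        then have "r \<otimes> n \<otimes> inv r \<in> ?N" using r by simp
        moreover have "c r (r \<otimes> n \<otimes> inv r) = b n"
          using r nK by (simp add: c_def m_assoc mult_inv_cancel)
        ultimately show ?thesis using n(2) by metis
      qed
      then show "\<exists>x \<in> topspace V. \<forall>U e. openin V U \<and> x \<in> U \<and> e > 0 \<longrightarrow>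
          (\<exists>n \<in> carrier (K\<lparr>carrier := ?N\<rparr>). push_charge V (c r n) d U > 1 - e)"
        using x(1) by auto
    qed
    show "continuous_map ?W V (\<lambda>f. f r)" by (rule continuous_map_coinduced_eval[OF r])
    fix n f assume "n \<in> carrier (K\<lparr>carrier := ?N\<rparr>)" and f: "f \<in> topspace ?W"
    then have n: "n \<in> ?N" "n \<in> carrier K" using NK by auto
    let ?m = "inv r \<otimes> n \<otimes> r"
    have "?m \<in> L" using conj[OF n(1)] NL by blast
    then have mL: "inv ?m \<in> L" "inv (inv ?m) = ?m"
      using n r subgroup.m_inv_closed[OF sL] by auto
    have "f (r \<otimes> inv ?m) = b ?m (f r)"
      using coinduced_spaceE(2)[OF f r mL(1)] mL(2) by simp
    moreover have "r \<otimes> inv ?m = inv n \<otimes> r"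
      using n r by (simp add: inv_mult_group m_assoc mult_inv_cancel)
    ultimately show "?a n f r = c r n (f r)"
      by (simp add: coinduced_action_apply[OF f r] c_def)
  next
    fix f g assume f: "f \<in> topspace ?W" and g: "g \<in> topspace ?W" and eq: "\<And>r. r \<in> R \<Longrightarrow> f r = g r"
    show "f = g"
    proof (rule PiE_ext)
      show "f \<in> carrier K \<rightarrow>\<^sub>E topspace V" "g \<in> carrier K \<rightarrow>\<^sub>E topspace V"
        using coinduced_spaceE(1) f g by blast+
      fix k assume k: "k \<in> carrier K"
      obtain r where r: "r \<in> R" "inv r \<otimes> k \<in> L" using R(3)[OF k] by blast
      have rK: "r \<in> carrier K" using r(1) R(2) by blast
      have "h k = b (inv (inv r \<otimes> k)) (h r)" if "h \<in> topspace ?W" for h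
        using coinduced_spaceE(2)[OF that rK r(2)] rK k by (simp add: mult_inv_cancel)
      then show "f k = g k" using f g eq[OF r(1)] by metis
    qed
  qed (rule R(1))
  then show ?thesis by (rule contracting_mono[OF _ NK])
qed

end

section \<open>Universal flows and their restriction to subgroups of finite index\<close>

definition universal_flow ::
    "real set \<Rightarrow> ('g, 'm) monoid_scheme \<Rightarrow> 'x topology \<Rightarrow> ('g \<Rightarrow> 'x \<Rightarrow> 'x) \<Rightarrow> bool"
  where "universal_flow D K X a \<longleftrightarrow>
    discrete_minimal_flow K X a \<and> contracting D K X a \<and>
    (\<forall>(Y :: 'g set set topology) b.
       discrete_minimal_flow K Y b \<and> contracting D K Y b \<longrightarrow> (\<exists>f. flow_factor_map K X a Y b f))"

lemma universal_flow_minimal: "universal_flow D K X a \<Longrightarrow> discrete_minimal_flow K X a"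
  and universal_flow_contracting: "universal_flow D K X a \<Longrightarrow> contracting D K X a"
  by (simp_all add: universal_flow_def)

lemma universal_flow_flow: "universal_flow D K X a \<Longrightarrow> discrete_flow K X a"
  by (rule minimal_flow_flow[OF universal_flow_minimal])

context charge_values
begin

text \<open>The case of a single factor. It transfers contraction both to a copy of a flow on
  another type and to a subflow.\<close>

lemma contracting_injective:
  assumes "flow K T' W a" "flow K T V b" "contracting D K V b" "continuous_map W V p"
    and "\<And>k w. k \<in> carrier K \<Longrightarrow> w \<in> topspace W \<Longrightarrow> p (a k w) = b k (p w)"
    and "inj_on p (topspace W)"
  shows "contracting D K W a"
  using assms
  by (intro contracting_jointly_injective[where I = "{()}" and V = "\<lambda>_. V" and b = "\<lambda>_. b" and p = "\<lambda>_. p"])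
    (auto dest: inj_onD)

text \<open>The flows coinduced below consist of functions and so lie outside the test type
  \<open>'g set set\<close>. Copying a minimal flow into that type frees universality from
  it.\<close>

lemma universal_flow_factor:
  fixes K :: "('g, 'm) monoid_scheme" and Y :: "'y topology"
  assumes X: "universal_flow D K X a" and Y: "discrete_minimal_flow K Y b" "contracting D K Y b"
  shows "\<exists>f. flow_factor_map K X a Y b f"
proof -
  obtain Z :: "'g set set topology" and e e' where hm: "homeomorphic_maps Y Z e e'"
    using minimal_flow_copy[OF Y(1)] by blast
  let ?c = "transport_action Z e e' b"
  have fl: "discrete_flow K Y b" by (rule minimal_flow_flow[OF Y(1)])
  have Z: "discrete_minimal_flow K Z ?c" by (rule minimal_flow_transport[OF hm Y(1)])
  have "contracting D K Z ?c"
  proof (rule contracting_injective[OF minimal_flow_flow[OF Z] fl Y(2)])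
    show "continuous_map Z Y e'" by (rule hm_maps[OF hm])
    show "inj_on e' (topspace Z)" by (rule inj_on_inverseI[of _ e]) (rule hm_simps[OF hm])
    show "e' (?c k w) = b k (e' w)" if "k \<in> carrier K" "w \<in> topspace Z" for k w
      using that hm_simps[OF hm] flow_maps_to[OF fl] by (simp add: transport_action_def)
  qed
  then obtain f where "flow_factor_map K X a Z ?c f"
    using X Z unfolding universal_flow_def by blast
  then show ?thesis using flow_factor_map_transport[OF hm fl] by blast
qed

text \<open>Frobenius reciprocity: a \<open>K\<close>-map from \<open>X\<close> into the flow
  coinduced from \<open>V\<close>, followed by evaluation at the unit, is an \<open>L\<close>-map
  from \<open>X\<close> to \<open>V\<close>. It is onto because its image is closed and invariant
  and \<open>V\<close> is minimal. Contraction and minimality of \<open>X\<close> under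
  \<open>L\<close> are \<open>contracting_restrict\<close> and
  \<open>minimal_restrict\<close>.\<close>

theorem universal_flow_restrict:
  fixes K (structure)
  assumes X: "universal_flow D K X a" and L: "finite_index_subgroup K L"
  shows "universal_flow D (K\<lparr>carrier := L\<rparr>) X a"
proof -
  have min: "discrete_minimal_flow K X a" and con: "contracting D K X a"
    using X by (auto simp: universal_flow_def)
  have fl: "discrete_flow K X a" by (rule minimal_flow_flow[OF min])
  interpret group K by (rule flow_group[OF fl])
  have sL: "subgroup L K" by (rule finite_index_subgroup_subgroup[OF L])
  have minL: "discrete_minimal_flow (K\<lparr>carrier := L\<rparr>) X a" by (rule minimal_restrict[OF min con L])
  have "\<exists>f. flow_factor_map (K\<lparr>carrier := L\<rparr>) X a V b f"
    if V: "discrete_minimal_flow (K\<lparr>carrier := L\<rparr>) V b" "contracting D (K\<lparr>carrier := L\<rparr>) V b"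
    for V :: "'a set set topology" and b
  proof -
    have flV: "discrete_flow (K\<lparr>carrier := L\<rparr>) V b" by (rule minimal_flow_flow[OF V(1)])
    let ?W = "coinduced_space K L V b" and ?a = "coinduced_action K L V b"
    have W: "discrete_flow K ?W ?a" by (rule coinduced_flow[OF sL flV])
    have cW: "contracting D K ?W ?a" by (rule contracting_coinduced[OF is_group L flV V(2)])
    \<comment> \<open>The coinduced flow need not be minimal, so universality of \<open>X\<close> is
      applied to a minimal subflow of it.\<close>
    obtain M where M: "invariant_closed K ?W ?a M"
      "\<And>M'. invariant_closed K ?W ?a M' \<Longrightarrow> M' \<subseteq> M \<Longrightarrow> M' = M"
      using exists_minimal_set[OF W] by metis
    have sub: "M \<subseteq> topspace ?W" by (rule invariant_closed_subset[OF M(1)])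
    let ?Y = "subtopology ?W M" and ?c = "\<lambda>k. restrict (?a k) M"
    have ts: "topspace ?Y = M" by (rule topspace_subtopology_subset[OF sub])
    have Y: "discrete_flow K ?Y ?c" by (rule subflow[OF W M(1)])
    have "discrete_minimal_flow K ?Y ?c"
    proof (rule minimal_flowI[OF Y])
      fix M' assume M': "invariant_closed K ?Y ?c M'"
      then have sub': "M' \<subseteq> M" using invariant_closed_subset ts by metis
      have "closedin ?W M'"
        using M' M(1) closedin_trans_full by (auto simp: invariant_closed_def)
      then have "invariant_closed K ?W ?a M'"
        using M' sub' by (fastforce simp: invariant_closed_def)
      then show "M' = topspace ?Y" using M(2) sub' ts by metis
    qed
    moreover have "contracting D K ?Y ?c"
      by (rule contracting_injective[OF Y W cW, where p = "\<lambda>w. w"])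
        (auto simp: ts continuous_map_from_subtopology inj_on_def)
    ultimately obtain f where f: "flow_factor_map K X a ?Y ?c f"
      using universal_flow_factor[OF X] by blast
    have fM: "f x \<in> M" if "x \<in> topspace X" for x
      using f that ts by (auto simp: flow_factor_map_def)
    define h where "h x = f x \<one>" for x
    have "continuous_map X ?W f"
      using f by (simp add: flow_factor_map_def continuous_map_in_subtopology)
    then have "continuous_map X V ((\<lambda>w. w \<one>) \<circ> f)"
      by (rule continuous_map_compose) (rule continuous_map_coinduced_eval[OF one_closed])
    then have cont: "continuous_map X V h" by (simp add: o_def h_def[abs_def])
    have eqv: "h (a l x) = b l (h x)" if l: "l \<in> L" and x: "x \<in> topspace X" for l x
    proof -
      have lK: "l \<in> carrier K" using l subgroup.subset[OF sL] by blast
      have fx: "f x \<in> topspace ?W" "f x \<in> M" using fM[OF x] sub by auto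
      have "f (a l x) = ?a l (f x)" using f lK x fx(2) by (auto simp: flow_factor_map_def)
      then have "h (a l x) = f x (inv l)"
        using lK by (simp add: h_def coinduced_action_apply[OF fx(1)])
      also have "\<dots> = f x (\<one> \<otimes> inv l)" using lK by simp
      also have "\<dots> = b (inv (inv l)) (f x \<one>)"
        by (rule coinduced_spaceE(2)[OF fx(1) one_closed subgroup.m_inv_closed[OF sL l]])
      finally show ?thesis using lK by (simp add: h_def)
    qed
    have "h ` topspace X = topspace V"
    proof (rule minimal_flowD[OF V(1)])
      have "compactin V (h ` topspace X)"
        by (rule image_compactin[OF _ cont]) (use flow_compact[OF fl] in \<open>simp add: compact_space_def\<close>)
      then have "closedin V (h ` topspace X)"
        by (rule compactin_imp_closedin[OF flow_Hausdorff[OF flV]])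
      moreover have "b l (h x) \<in> h ` topspace X" if l: "l \<in> L" and x: "x \<in> topspace X" for l x
      proof -
        have "a l x \<in> topspace X"
          using l x subgroup.subset[OF sL] by (intro flow_maps_to[OF fl]) auto
        then show ?thesis using eqv[OF l x] by (metis imageI)
      qed
      moreover have "h ` topspace X \<noteq> {}" using flow_nonempty[OF fl] by blast
      ultimately show "invariant_closed (K\<lparr>carrier := L\<rparr>) V b (h ` topspace X)"
        by (auto simp: invariant_closed_def)
    qed
    then have "flow_factor_map (K\<lparr>carrier := L\<rparr>) X a V b h"
      using cont eqv by (simp add: flow_factor_map_def)
    then show ?thesis by blast
  qed
  then show ?thesis
    using minL contracting_restrict[OF fl con L] by (simp add: universal_flow_def)
qed

end

section \<open>Proximality\<close>

text \<open>This removes filters from proximality: what matters is that every neighbourhood of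
  \<open>z\<close> is visited by both maps at a common \<open>k\<close>.\<close>

lemma common_limit_iff:
  "(\<exists>F. F \<noteq> bot \<and> eventually (\<lambda>k. k \<in> S) F \<and> limitin X p z F \<and> limitin X q z F) \<longleftrightarrow>
    z \<in> topspace X \<and> (\<forall>U. openin X U \<and> z \<in> U \<longrightarrow> (\<exists>k \<in> S. p k \<in> U \<and> q k \<in> U))"
proof (intro iffI conjI allI impI)
  assume "\<exists>F. F \<noteq> bot \<and> eventually (\<lambda>k. k \<in> S) F \<and> limitin X p z F \<and> limitin X q z F"
  then obtain F where F: "F \<noteq> bot" "eventually (\<lambda>k. k \<in> S) F" "limitin X p z F" "limitin X q z F"
    by blast
  then show "z \<in> topspace X" by (simp add: limitin_def)
  fix U assume "openin X U \<and> z \<in> U"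
  then have "eventually (\<lambda>k. p k \<in> U) F" "eventually (\<lambda>k. q k \<in> U) F"
    using F(3,4) by (auto simp: limitin_def)
  then have "eventually (\<lambda>k. k \<in> S \<and> p k \<in> U \<and> q k \<in> U) F"
    using F(2) by eventually_elim simp
  then show "\<exists>k \<in> S. p k \<in> U \<and> q k \<in> U" using eventually_happens'[OF F(1)] by blast
next
  assume z: "z \<in> topspace X \<and> (\<forall>U. openin X U \<and> z \<in> U \<longrightarrow> (\<exists>k \<in> S. p k \<in> U \<and> q k \<in> U))"
  \<comment> \<open>The sets \<open>A U\<close> of common visits form a filter base, since
    \<open>A (U \<inter> V)\<close> lies in both \<open>A U\<close> and \<open>A V\<close>. The
    filter they generate is proper because no \<open>A U\<close> is empty.\<close>
  define A where "A U = {k \<in> S. p k \<in> U \<and> q k \<in> U}" for U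
  define F where "F = (INF U \<in> {U. openin X U \<and> z \<in> U}. principal (A U))"
  have ev: "eventually P F \<longleftrightarrow> (\<exists>U \<in> {U. openin X U \<and> z \<in> U}. eventually P (principal (A U)))" for P
    unfolding F_def
  proof (rule eventually_INF_base)
    show "{U. openin X U \<and> z \<in> U} \<noteq> {}" using z by blast
    fix U V assume UV: "U \<in> {U. openin X U \<and> z \<in> U}" "V \<in> {U. openin X U \<and> z \<in> U}"
    then have "principal (A (U \<inter> V)) \<le> inf (principal (A U)) (principal (A V))"
      by (auto simp: A_def)
    moreover have "U \<inter> V \<in> {U. openin X U \<and> z \<in> U}" using UV by auto
    ultimately show "\<exists>W \<in> {U. openin X U \<and> z \<in> U}. principal (A W) \<le> inf (principal (A U)) (principal (A V))"
      by blast
  qed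
  have "F \<noteq> bot"
  proof
    assume "F = bot"
    then have "eventually (\<lambda>_. False) F" by simp
    then obtain U where "openin X U" "z \<in> U" "A U = {}"
      unfolding ev eventually_principal by blast
    then show False using z by (auto simp: A_def)
  qed
  moreover have "eventually (\<lambda>k. k \<in> S) F"
    unfolding ev eventually_principal using z by (auto simp: A_def)
  moreover have "eventually (\<lambda>k. p k \<in> U) F" "eventually (\<lambda>k. q k \<in> U) F" if "openin X U" "z \<in> U" for U
    unfolding ev eventually_principal using that by (auto simp: A_def)
  then have "limitin X p z F" "limitin X q z F" using z by (auto simp: limitin_def)
  ultimately show "\<exists>F. F \<noteq> bot \<and> eventually (\<lambda>k. k \<in> S) F \<and> limitin X p z F \<and> limitin X q z F"
    by blast
qed

lemma proximal_action_iff: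
  "proximal_action K X a \<longleftrightarrow> (\<forall>x \<in> topspace X. \<forall>y \<in> topspace X. \<exists>z \<in> topspace X.
    \<forall>U. openin X U \<and> z \<in> U \<longrightarrow> (\<exists>k \<in> carrier K. a k x \<in> U \<and> a k y \<in> U))"
proof -
  have "(\<exists>F z. F \<noteq> bot \<and> eventually (\<lambda>k. k \<in> carrier K) F \<and> limitin X (\<lambda>k. a k x) z F \<and>
      limitin X (\<lambda>k. a k y) z F) \<longleftrightarrow>
    (\<exists>z \<in> topspace X. \<forall>U. openin X U \<and> z \<in> U \<longrightarrow> (\<exists>k \<in> carrier K. a k x \<in> U \<and> a k y \<in> U))" for x y
    using common_limit_iff[of "carrier K" X "\<lambda>k. a k x" _ "\<lambda>k. a k y"] by (subst ex_comm) (simp add: Bex_def)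
  then show ?thesis by (simp add: proximal_action_def)
qed

interpretation pairs: charge_values "{0, 1/2, 1}"
  by unfold_locales auto

interpretation all_charges: charge_values "{0..1}"
  by unfold_locales auto

text \<open>Every neighbourhood of a support point has mass at least 1/2, the smallest positive
  value. Three support points would have disjoint open neighbourhoods of total mass at least 3/2. So
  the support has one or two points, and open sets containing it have mass 1.\<close>

lemma two_point_support:
  assumes c: "c \<in> charges {0, 1/2, 1} X" and X: "compact_space X" "Hausdorff_space X"
  obtains x y where "x \<in> topspace X" "y \<in> topspace X"
    "\<And>U. openin X U \<Longrightarrow> x \<in> U \<Longrightarrow> y \<in> U \<Longrightarrow> c U = 1"
proof -
  let ?S = "{x \<in> topspace X. \<forall>U. openin X U \<and> x \<in> U \<longrightarrow> c U > 0}"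
  have half: "c U \<ge> 1/2" if "c U > 0" for U
  proof -
    have "c U \<in> {0, 1/2, 1}" using c rangeI[of c U] unfolding charges_def by blast
    then show ?thesis using that by auto
  qed
  have null: "\<exists>V. openin X V \<and> x \<in> V \<and> c V = 0" if "x \<in> topspace X" "x \<notin> ?S" for x
    using that pairs.charge_bounds(1)[OF c] by (simp, metis less_eq_real_def)
  have three: False if xyz: "x \<in> ?S" "y \<in> ?S" "z \<in> ?S" and ne: "x \<noteq> y" "x \<noteq> z" "y \<noteq> z" for x y z
  proof -
    have ts: "x \<in> topspace X" "y \<in> topspace X" "z \<in> topspace X" using xyz by auto
    have pos: "\<And>U. openin X U \<Longrightarrow> x \<in> U \<Longrightarrow> c U > 0" "\<And>U. openin X U \<Longrightarrow> y \<in> U \<Longrightarrow> c U > 0"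
      "\<And>U. openin X U \<Longrightarrow> z \<in> U \<Longrightarrow> c U > 0" using xyz by auto
    obtain A B where AB: "openin X A" "openin X B" "x \<in> A" "y \<in> B" "disjnt A B"
      using X(2) ts ne(1) unfolding Hausdorff_space_def by metis
    obtain C E where CE: "openin X C" "openin X E" "x \<in> C" "z \<in> E" "disjnt C E"
      using X(2) ts ne(2) unfolding Hausdorff_space_def by metis
    obtain P Q where PQ: "openin X P" "openin X Q" "y \<in> P" "z \<in> Q" "disjnt P Q"
      using X(2) ts ne(3) unfolding Hausdorff_space_def by metis
    have op: "openin X (A \<inter> C)" "openin X (B \<inter> P)" "openin X (E \<inter> Q)"
      using AB CE PQ by auto
    have disj: "(A \<inter> C) \<inter> (B \<inter> P) = {}" "(A \<inter> C \<union> B \<inter> P) \<inter> (E \<inter> Q) = {}"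
      using AB(5) CE(5) PQ(5) by (auto simp: disjnt_iff)
    have "c (A \<inter> C) \<ge> 1/2" "c (B \<inter> P) \<ge> 1/2" "c (E \<inter> Q) \<ge> 1/2"
      using AB(3,4) CE(3,4) PQ(3,4)
      by (intro half pos(1)[OF op(1)] pos(2)[OF op(2)] pos(3)[OF op(3)]; blast)+
    moreover have "c (A \<inter> C \<union> B \<inter> P \<union> E \<inter> Q) = c (A \<inter> C \<union> B \<inter> P) + c (E \<inter> Q)"
      using op disj by (intro pairs.charge_Un_disjoint[OF c] openin_sets_borel_algebra) auto
    moreover have "c (A \<inter> C \<union> B \<inter> P) = c (A \<inter> C) + c (B \<inter> P)"
      using op disj by (intro pairs.charge_Un_disjoint[OF c] openin_sets_borel_algebra) auto
    ultimately show False using pairs.charge_bounds(2)[OF c, of "A \<inter> C \<union> B \<inter> P \<union> E \<inter> Q"] by simp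
  qed
  have "?S \<noteq> {}"
  proof
    assume "?S = {}"
    then have "c {} = 1" using null by (intro pairs.charge_open_eq_1[OF c X(1)]) auto
    then show False using pairs.charge_empty[OF c] by simp
  qed
  then obtain x where x: "x \<in> ?S" by blast
  \<comment> \<open>A support with a single point is covered by \<open>y = x\<close>.\<close>
  obtain y where y: "y \<in> ?S" "?S \<subseteq> {x, y}"
  proof (cases "?S \<subseteq> {x}")
    case True
    then show ?thesis using x by (intro that[of x]) auto
  next
    case False
    then obtain y where y: "y \<in> ?S" "y \<noteq> x" by blast
    then have "?S \<subseteq> {x, y}" using three[OF x y(1)] by blast
    then show ?thesis by (rule that[OF y(1)])
  qed
  have "c U = 1" if U: "openin X U" "x \<in> U" "y \<in> U" for U
  proof (rule pairs.charge_open_eq_1[OF c X(1) U(1)])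
    fix w assume w: "w \<in> topspace X" "w \<notin> U"
    then have "w \<notin> ?S" using y(2) U by blast
    then show "\<exists>V. openin X V \<and> w \<in> V \<and> c V = 0" by (rule null[OF w(1)])
  qed
  then show thesis using x y(1) that by blast
qed

text \<open>By \<open>two_point_support\<close>, such a charge is concentrated at two points, and
  bringing these two into \<open>U\<close> gives \<open>U\<close> full mass. The converse is
  \<open>contracting_pairs\<close>.\<close>

theorem proximal_iff_contracting:
  assumes fl: "flow K T X a"
  shows "proximal_action K X a \<longleftrightarrow> contracting {0, 1/2, 1} K X a"
proof
  assume "contracting {0, 1/2, 1} K X a"
  then show "proximal_action K X a"
    unfolding proximal_action_iff
    by (intro ballI pairs.contracting_pairs flow_maps_to[OF fl])
next
  assume prox: "proximal_action K X a"
  show "contracting {0, 1/2, 1} K X a"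
    unfolding contracting_def
  proof
    fix c assume c: "c \<in> charges {0, 1/2, 1} X"
    obtain x y where xy: "x \<in> topspace X" "y \<in> topspace X"
      "\<And>U. openin X U \<Longrightarrow> x \<in> U \<Longrightarrow> y \<in> U \<Longrightarrow> c U = 1"
      using two_point_support[OF c flow_compact[OF fl] flow_Hausdorff[OF fl]] by metis
    obtain z where z: "z \<in> topspace X"
      "\<And>U. openin X U \<Longrightarrow> z \<in> U \<Longrightarrow> \<exists>k \<in> carrier K. a k x \<in> U \<and> a k y \<in> U"
      using prox xy(1,2) unfolding proximal_action_iff by metis
    have "\<exists>k \<in> carrier K. push_charge X (a k) c U > 1 - e"
      if U: "openin X U" "z \<in> U" "e > 0" for U e
    proof -
      obtain k where k: "k \<in> carrier K" "a k x \<in> U" "a k y \<in> U" using z(2)[OF U(1,2)] by blast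
      have "openin X {w \<in> topspace X. a k w \<in> U}"
        using flow_continuous[OF fl k(1)] U(1) by (simp add: continuous_map_def)
      then have "push_charge X (a k) c U = 1"
        unfolding push_charge_def using k xy by (intro xy(3)) auto
      then have "push_charge X (a k) c U > 1 - e" using U(3) by simp
      then show ?thesis using k(1) by blast
    qed
    then show "\<exists>x \<in> topspace X. \<forall>U e. openin X U \<and> x \<in> U \<and> e > 0 \<longrightarrow>
        (\<exists>k \<in> carrier K. push_charge X (a k) c U > 1 - e)"
      using z(1) by blast
  qed
qed


section \<open>From charges to measures\<close>

text \<open>The Riesz--Halmos construction: the inner content of open sets by closed sets is countably
  subadditive by compactness, and it generates an outer measure for which Borel sets are measurable.\<close>

definition inner_content :: "'x topology \<Rightarrow> ('x set \<Rightarrow> real) \<Rightarrow> 'x set \<Rightarrow> ennreal"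
  where "inner_content X c U = (SUP C \<in> {C. closedin X C \<and> C \<subseteq> U}. ennreal (c C))"

definition content_outer :: "'x topology \<Rightarrow> ('x set \<Rightarrow> real) \<Rightarrow> 'x set \<Rightarrow> ennreal"
  where "content_outer X c A = (INF U \<in> {U. openin X U \<and> A \<subseteq> U}. inner_content X c U)"

lemma inner_content_mono: "U \<subseteq> V \<Longrightarrow> inner_content X c U \<le> inner_content X c V"
  unfolding inner_content_def by (rule SUP_subset_mono) auto

lemma inner_content_ge: "closedin X C \<Longrightarrow> C \<subseteq> U \<Longrightarrow> ennreal (c C) \<le> inner_content X c U"
  unfolding inner_content_def by (rule SUP_upper) simp

lemma content_outer_mono: "A \<subseteq> B \<Longrightarrow> content_outer X c A \<le> content_outer X c B"
  unfolding content_outer_def by (rule INF_superset_mono) auto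

lemma content_outer_le: "openin X U \<Longrightarrow> A \<subseteq> U \<Longrightarrow> content_outer X c A \<le> inner_content X c U"
  unfolding content_outer_def by (rule INF_lower) simp

lemma content_outer_open:
  assumes "openin X U"
  shows "content_outer X c U = inner_content X c U"
proof (rule antisym)
  show "content_outer X c U \<le> inner_content X c U" using assms by (intro content_outer_le) auto
  show "inner_content X c U \<le> content_outer X c U"
    unfolding content_outer_def by (rule INF_greatest) (auto intro: inner_content_mono)
qed

context
  fixes X :: "'x topology" and c
  assumes X: "compact_space X" "Hausdorff_space X" and c: "c \<in> charges {0..1} X"
begin

lemma inner_content_le:
  assumes "openin X U"
  shows "inner_content X c U \<le> ennreal (c U)"
  unfolding inner_content_def
  using assms by (intro SUP_least ennreal_leI all_charges.charge_mono[OF c])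
    (auto intro: closedin_borel openin_sets_borel_algebra)

lemma inner_content_topspace: "inner_content X c (topspace X) = 1"
  using inner_content_le[of "topspace X"] inner_content_ge[of X "topspace X" "topspace X" c]
  by (simp add: all_charges.charge_total[OF c])

lemma inner_content_empty: "inner_content X c {} = 0"
  using inner_content_le[of "{}"] by (simp add: all_charges.charge_empty[OF c])

text \<open>Normality separates the disjoint closed sets \<open>C - U\<close> and
  \<open>C - V\<close> by open sets \<open>P\<close> and \<open>Q\<close>. Then \<open>C - P\<close>
  lies in \<open>U\<close>, \<open>C - Q\<close> lies in \<open>V\<close>, and together they are all
  of \<open>C\<close>.\<close>

lemma inner_content_Un:
  assumes U: "openin X U" and V: "openin X V"
  shows "inner_content X c (U \<union> V) \<le> inner_content X c U + inner_content X c V"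
  unfolding inner_content_def[of X c "U \<union> V"]
proof (rule SUP_least)
  fix C assume "C \<in> {C. closedin X C \<and> C \<subseteq> U \<union> V}"
  then have C: "closedin X C" "C \<subseteq> U \<union> V" by auto
  have "normal_space X" using X by (simp add: compact_Hausdorff_or_regular_imp_normal_space)
  moreover have "closedin X (C - U) \<and> closedin X (C - V) \<and> disjnt (C - U) (C - V)"
    using C U V by (auto simp: closedin_diff disjnt_iff)
  ultimately have "\<exists>P Q. openin X P \<and> openin X Q \<and> C - U \<subseteq> P \<and> C - V \<subseteq> Q \<and> disjnt P Q"
    unfolding normal_space_def by blast
  then obtain P Q where PQ: "openin X P" "openin X Q" "C - U \<subseteq> P" "C - V \<subseteq> Q" "disjnt P Q"
    by blast
  have cl: "closedin X (C - P)" "closedin X (C - Q)" using C PQ by (auto simp: closedin_diff)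
  have "C = (C - P) \<union> (C - Q)" using PQ(5) by (auto simp: disjnt_iff)
  then have "c C \<le> c (C - P) + c (C - Q)"
    using all_charges.charge_Un_le[OF c closedin_borel[OF cl(1)] closedin_borel[OF cl(2)]] by simp
  then have "ennreal (c C) \<le> ennreal (c (C - P)) + ennreal (c (C - Q))"
    using all_charges.charge_bounds(1)[OF c] by (simp flip: ennreal_plus add: ennreal_leI)
  also have "\<dots> \<le> inner_content X c U + inner_content X c V"
    using cl PQ(3,4) by (intro add_mono inner_content_ge) auto
  finally show "ennreal (c C) \<le> inner_content X c U + inner_content X c V" .
qed

text \<open>A closed \<open>C\<close> inside the union is compact and so is covered by finitely many
  of the sets. In this way finite additivity of \<open>c\<close> yields a countable
  inequality.\<close>

lemma inner_content_UN:
  assumes U: "\<And>i :: nat. openin X (U i)"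
  shows "inner_content X c (\<Union>i. U i) \<le> (\<Sum>i. inner_content X c (U i))"
  unfolding inner_content_def[of X c "\<Union>i. U i"]
proof (rule SUP_least)
  fix C assume "C \<in> {C. closedin X C \<and> C \<subseteq> (\<Union>i. U i)}"
  then have C: "closedin X C" "C \<subseteq> (\<Union>i. U i)" by auto
  have fin: "inner_content X c (\<Union>i<n. U i) \<le> (\<Sum>i<n. inner_content X c (U i))" for n
  proof (induction n)
    case 0
    then show ?case by (simp add: inner_content_empty)
  next
    case (Suc n)
    have "inner_content X c (\<Union>i<Suc n. U i) = inner_content X c ((\<Union>i<n. U i) \<union> U n)"
      by (simp add: lessThan_Suc Un_commute)
    also have "\<dots> \<le> inner_content X c (\<Union>i<n. U i) + inner_content X c (U n)"
      using U by (intro inner_content_Un) auto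
    finally show ?case using Suc by (simp add: add_right_mono order_trans)
  qed
  have "compactin X C" using C(1) X(1) by (rule closedin_compact_space[rotated])
  then obtain \<F> where \<F>: "finite \<F>" "\<F> \<subseteq> range U" "C \<subseteq> \<Union>\<F>"
    using compactinD[of X C "range U"] U C(2) by auto
  then obtain J where J: "finite J" "\<F> = U ` J" using finite_subset_image[of \<F> U UNIV] by blast
  obtain n where n: "J \<subseteq> {..<n}" using J(1) finite_nat_iff_bounded by blast
  have "C \<subseteq> (\<Union>i<n. U i)" using \<F>(3) J(2) n by blast
  then have "ennreal (c C) \<le> inner_content X c (\<Union>i<n. U i)" by (rule inner_content_ge[OF C(1)])
  also have "\<dots> \<le> (\<Sum>i<n. inner_content X c (U i))" by (rule fin)
  also have "\<dots> \<le> (\<Sum>i. inner_content X c (U i))" by (rule sum_le_suminf) auto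
  finally show "ennreal (c C) \<le> (\<Sum>i. inner_content X c (U i))" .
qed

lemma content_outer_countably_subadditive:
  "countably_subadditive (Pow (topspace X)) (content_outer X c)"
  unfolding countably_subadditive_def
proof (intro allI impI)
  fix A :: "nat \<Rightarrow> 'x set" assume A: "range A \<subseteq> Pow (topspace X)"
  let ?O = "content_outer X c"
  show "?O (\<Union>i. A i) \<le> (\<Sum>n. ?O (A n))"
  proof (rule ennreal_le_epsilon)
    fix e :: real assume e: "0 < e"
    have "\<exists>U. openin X U \<and> A n \<subseteq> U \<and> inner_content X c U \<le> ?O (A n) + e * (1/2)^Suc n" for n
    proof -
      have "A n \<subseteq> topspace X" using A by auto
      then have "?O (A n) \<le> inner_content X c (topspace X)" by (intro content_outer_le) auto
      then have "?O (A n) < top_class.top" by (simp add: inner_content_topspace le_less_trans)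
      moreover have "0 < e * (1/2)^Suc n" using e by simp
      ultimately have "?O (A n) < ?O (A n) + e * (1/2)^Suc n"
        by (auto simp: less_top)
      then show ?thesis
        unfolding content_outer_def[of X c "A n"] INF_less_iff
        by (metis (mono_tags, lifting) content_outer_def less_imp_le mem_Collect_eq)
    qed
    then obtain U where U: "\<And>n. openin X (U n)" "\<And>n. A n \<subseteq> U n"
      "\<And>n. inner_content X c (U n) \<le> ?O (A n) + e * (1/2)^Suc n" by metis
    have "?O (\<Union>i. A i) \<le> inner_content X c (\<Union>i. U i)"
      using U by (intro content_outer_le) auto
    also have "\<dots> \<le> (\<Sum>n. inner_content X c (U n))" by (rule inner_content_UN[OF U(1)])
    also have "\<dots> \<le> (\<Sum>n. ?O (A n) + e * (1/2) ^ Suc n)"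
      by (intro suminf_le U) auto
    also have "\<dots> = (\<Sum>n. ?O (A n)) + (\<Sum>n. ennreal e * ennreal ((1/2) ^ Suc n))"
      using e by (subst suminf_add[symmetric])
        (auto simp del: ennreal_suminf_cmult simp add: ennreal_mult[symmetric])
    also have "\<dots> = (\<Sum>n. ?O (A n)) + e"
      unfolding ennreal_suminf_cmult
      by (subst suminf_ennreal_eq[OF zero_le_power power_half_series]) auto
    finally show "?O (\<Union>i. A i) \<le> (\<Sum>n. ?O (A n)) + e" .
  qed
qed

lemma content_outer_measure_space: "outer_measure_space (Pow (topspace X)) (content_outer X c)"
proof -
  have "content_outer X c {} = 0" by (simp add: content_outer_open inner_content_empty)
  then show ?thesis
    using content_outer_mono content_outer_countably_subadditive
    by (auto simp: outer_measure_space_def positive_def increasing_def)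
qed

text \<open>The Caratheodory condition for \<open>V\<close> is tested on open \<open>U\<close>
  containing \<open>x\<close>. A closed \<open>C\<close> inside \<open>V \<inter> U\<close> and a
  closed \<open>E\<close> inside \<open>U - C\<close> are disjoint, so their masses add up to at
  most the content of \<open>U\<close>. The supremum over \<open>E\<close> bounds the part of
  \<open>x\<close> outside \<open>V\<close>, and the supremum over \<open>C\<close> the part
  inside.\<close>

lemma open_in_lambda_system:
  assumes V: "openin X V"
  shows "V \<in> lambda_system (topspace X) (Pow (topspace X)) (content_outer X c)"
proof -
  let ?O = "content_outer X c"
  have Vsub: "V \<subseteq> topspace X" by (rule openin_subset[OF V])
  interpret sigma_algebra "topspace X" "Pow (topspace X)" by (rule sigma_algebra_Pow)
  have oms: "positive (Pow (topspace X)) ?O" "countably_subadditive (Pow (topspace X)) ?O"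
    using content_outer_measure_space by (auto simp: outer_measure_space_def)
  have sub: "?O x \<le> ?O (V \<inter> x) + ?O ((topspace X - V) \<inter> x)" if "x \<subseteq> topspace X" for x
  proof -
    have "subadditive (Pow (topspace X)) ?O"
      by (rule countably_subadditive_subadditive[OF oms])
    moreover have "x = (V \<inter> x) \<union> ((topspace X - V) \<inter> x)" using that by blast
    ultimately show ?thesis
      using that subadditiveD[of "Pow (topspace X)" ?O "V \<inter> x" "(topspace X - V) \<inter> x"] Vsub
      by auto
  qed
  have super: "?O (V \<inter> x) + ?O ((topspace X - V) \<inter> x) \<le> ?O x" if x: "x \<subseteq> topspace X" for x
    unfolding content_outer_def[of X c x]
  proof (rule INF_greatest)
    fix U assume "U \<in> {U. openin X U \<and> x \<subseteq> U}"
    then have U: "openin X U" "x \<subseteq> U" by auto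
    have opVU: "openin X (V \<inter> U)" using V U by auto
    have "ennreal (c C) + ?O ((topspace X - V) \<inter> x) \<le> inner_content X c U"
      if C: "closedin X C" "C \<subseteq> V \<inter> U" for C
    proof -
      have op: "openin X (U - C)" using U(1) C(1) by (simp add: openin_diff)
      have "(topspace X - V) \<inter> x \<subseteq> U - C" using U C by blast
      then have "?O ((topspace X - V) \<inter> x) \<le> inner_content X c (U - C)"
        by (rule content_outer_le[OF op])
      then have "ennreal (c C) + ?O ((topspace X - V) \<inter> x) \<le> ennreal (c C) + inner_content X c (U - C)"
        by (rule add_left_mono)
      also have "\<dots> = (SUP E \<in> {E. closedin X E \<and> E \<subseteq> U - C}. ennreal (c C) + ennreal (c E))"
        unfolding inner_content_def by (rule ennreal_SUP_add_right) (auto intro: exI[of _ "{}"])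
      also have "\<dots> \<le> inner_content X c U"
      proof (rule SUP_least)
        fix E assume "E \<in> {E. closedin X E \<and> E \<subseteq> U - C}"
        then have E: "closedin X E" "E \<subseteq> U - C" by auto
        have "c (C \<union> E) = c C + c E"
          using C E by (intro all_charges.charge_Un_disjoint[OF c] closedin_borel) auto
        then have "ennreal (c C) + ennreal (c E) = ennreal (c (C \<union> E))"
          using all_charges.charge_bounds(1)[OF c] by (simp flip: ennreal_plus)
        also have "\<dots> \<le> inner_content X c U" using C E by (intro inner_content_ge closedin_Un) auto
        finally show "ennreal (c C) + ennreal (c E) \<le> inner_content X c U" .
      qed
      finally show ?thesis .
    qed
    then have "(SUP C \<in> {C. closedin X C \<and> C \<subseteq> V \<inter> U}. ennreal (c C) + ?O ((topspace X - V) \<inter> x))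
        \<le> inner_content X c U" by (intro SUP_least) auto
    moreover have "(SUP C \<in> {C. closedin X C \<and> C \<subseteq> V \<inter> U}. ennreal (c C) + ?O ((topspace X - V) \<inter> x))
        = inner_content X c (V \<inter> U) + ?O ((topspace X - V) \<inter> x)"
      unfolding inner_content_def by (rule ennreal_SUP_add_left) (auto intro: exI[of _ "{}"])
    moreover have "?O (V \<inter> x) \<le> inner_content X c (V \<inter> U)"
      using U by (intro content_outer_le[OF opVU]) auto
    ultimately show "?O (V \<inter> x) + ?O ((topspace X - V) \<inter> x) \<le> inner_content X c U"
      by (metis add_right_mono order_trans)
  qed
  show ?thesis
    using Vsub sub super by (auto simp: lambda_system_def intro: antisym)
qed

text \<open>Equality cannot be expected, since \<open>c\<close> need not be inner regular. The
  inequality on open sets is enough for its purpose: a lower bound on the measure of an open set is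
  a lower bound on its charge, and contraction asks for such bounds.\<close>

lemma charge_dominates_measure:
  "\<exists>\<mu> \<in> prob_measures X. \<forall>U. openin X U \<longrightarrow> measure \<mu> U \<le> c U"
proof -
  let ?O = "content_outer X c"
  let ?L = "lambda_system (topspace X) (Pow (topspace X)) ?O"
  interpret sigma_algebra "topspace X" "Pow (topspace X)" by (rule sigma_algebra_Pow)
  have ms: "measure_space (topspace X) ?L ?O"
    by (rule caratheodory_lemma[OF content_outer_measure_space])
  have sub: "sets (borel_algebra X) \<subseteq> ?L"
    unfolding sets_borel_algebra
    by (rule sigma_algebra.sigma_sets_subset)
      (use ms open_in_lambda_system in \<open>auto simp: measure_space_def\<close>)
  define \<mu> where "\<mu> = measure_of (topspace X) (sets (borel_algebra X)) ?O"
  have sa: "sigma_algebra (topspace X) (sets (borel_algebra X))"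
    using sets.sigma_algebra_axioms[of "borel_algebra X"] by simp
  have sets: "sets \<mu> = sets (borel_algebra X)"
    unfolding \<mu>_def by (rule sigma_algebra.sets_measure_of_eq[OF sa])
  have space: "space \<mu> = topspace X"
    unfolding \<mu>_def using sigma_algebra.space_measure_of_eq[OF sa] by simp
  have em: "emeasure \<mu> A = ?O A" if "A \<in> sets (borel_algebra X)" for A
    unfolding \<mu>_def
  proof (rule emeasure_measure_of_sigma[OF sa _ _ that])
    show "positive (sets (borel_algebra X)) ?O"
      using ms by (simp add: measure_space_def positive_def)
    show "countably_additive (sets (borel_algebra X)) ?O"
      using ms sub unfolding measure_space_def countably_additive_def by blast
  qed
  have "emeasure \<mu> (space \<mu>) = 1"
    by (simp add: space em content_outer_open inner_content_topspace)
  then have prob: "prob_space \<mu>" by (rule prob_spaceI)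
  have "quasi_regular X \<mu>"
    unfolding quasi_regular_def sets
  proof (intro conjI ballI allI impI)
    fix A assume "A \<in> sets (borel_algebra X)"
    then have "emeasure \<mu> A = (INF U \<in> {U. openin X U \<and> A \<subseteq> U}. inner_content X c U)"
      by (simp add: em content_outer_def)
    also have "\<dots> = (INF U \<in> {U. openin X U \<and> A \<subseteq> U}. emeasure \<mu> U)"
      by (intro INF_cong refl) (simp add: em content_outer_open openin_sets_borel_algebra)
    finally show "emeasure \<mu> A = (INF U \<in> {U. openin X U \<and> A \<subseteq> U}. emeasure \<mu> U)" .
  next
    fix U assume U: "openin X U"
    show "emeasure \<mu> U = (SUP C \<in> {C. compactin X C \<and> C \<subseteq> U \<and> C \<in> sets (borel_algebra X)}. emeasure \<mu> C)"
      (is "_ = ?S")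
    proof (rule antisym)
      \<comment> \<open>On closed sets the comparison goes the other way: every open set around
        \<open>C\<close> has content at least \<open>c C\<close>. Hence the suprema defining the
        inner content are bounded by measures of compact sets.\<close>
      have "ennreal (c C) \<le> emeasure \<mu> C" if C: "closedin X C" for C
        unfolding em[OF closedin_borel[OF C]] content_outer_def
        by (rule INF_greatest) (auto intro: inner_content_ge[OF C])
      moreover have "compactin X C" if "closedin X C" for C
        using that X(1) by (simp add: closedin_compact_space)
      ultimately have "inner_content X c U \<le> ?S"
        unfolding inner_content_def by (intro SUP_mono) (auto intro: closedin_borel)
      then show "emeasure \<mu> U \<le> ?S"
        using U by (simp add: em content_outer_open openin_sets_borel_algebra)
      show "?S \<le> emeasure \<mu> U"
        using U by (intro SUP_least emeasure_mono) (auto simp: sets openin_sets_borel_algebra)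
    qed
  qed
  moreover have "measure \<mu> U \<le> c U" if U: "openin X U" for U
  proof -
    have "emeasure \<mu> U \<le> ennreal (c U)"
      using inner_content_le[OF U] U by (simp add: em content_outer_open openin_sets_borel_algebra)
    then show ?thesis
      using all_charges.charge_bounds(1)[OF c] by (simp add: measure_def enn2real_leI)
  qed
  ultimately show ?thesis using prob sets space by (auto simp: prob_measures_def)
qed

end


section \<open>Strong proximality\<close>

lemma return_prob_measures:
  assumes X: "Hausdorff_space X" and x: "x \<in> topspace X"
  shows "return (borel_algebra X) x \<in> prob_measures X"
proof -
  let ?R = "return (borel_algebra X) x"
  have "quasi_regular X ?R"
    unfolding quasi_regular_def
  proof (intro conjI ballI allI impI)
    fix A assume "A \<in> sets ?R"
    then have A: "A \<in> sets (borel_algebra X)" by simp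
    then have sub: "A \<subseteq> topspace X" using sets.sets_into_space by fastforce
    have em: "emeasure ?R U = indicator U x" if "openin X U" for U
      using that by (simp add: openin_sets_borel_algebra)
    show "emeasure ?R A = (INF U \<in> {U. openin X U \<and> A \<subseteq> U}. emeasure ?R U)"
    proof (rule antisym)
      show "emeasure ?R A \<le> (INF U \<in> {U. openin X U \<and> A \<subseteq> U}. emeasure ?R U)"
        by (intro INF_greatest emeasure_mono) (auto intro: openin_sets_borel_algebra)
      show "(INF U \<in> {U. openin X U \<and> A \<subseteq> U}. emeasure ?R U) \<le> emeasure ?R A"
      proof (cases "x \<in> A")
        case True
        have "(INF U \<in> {U. openin X U \<and> A \<subseteq> U}. emeasure ?R U) \<le> emeasure ?R (topspace X)"
          by (rule INF_lower) (use sub in simp)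
        then show ?thesis using True A x by simp
      next
        case False
        have "closedin X {x}" using X x by (simp add: closedin_Hausdorff_sing_eq)
        then have "openin X (topspace X - {x})" by (simp add: closedin_def)
        then have "(INF U \<in> {U. openin X U \<and> A \<subseteq> U}. emeasure ?R U) \<le> emeasure ?R (topspace X - {x})"
          using sub False by (intro INF_lower) auto
        also have "\<dots> = 0" using em[OF \<open>openin X (topspace X - {x})\<close>] by simp
        finally show ?thesis by simp
      qed
    qed
  next
    fix U assume U: "openin X U"
    show "emeasure ?R U = (SUP C \<in> {C. compactin X C \<and> C \<subseteq> U \<and> C \<in> sets ?R}. emeasure ?R C)"
      (is "_ = ?S")
    proof (rule antisym)
      show "?S \<le> emeasure ?R U"
        using U by (intro SUP_least emeasure_mono) (auto intro: openin_sets_borel_algebra)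
      show "emeasure ?R U \<le> ?S"
      proof (cases "x \<in> U")
        case True
        have "closedin X {x}" using X x by (simp add: closedin_Hausdorff_sing_eq)
        then have s: "{x} \<in> sets (borel_algebra X)" by (rule closedin_borel)
        have "emeasure ?R {x} \<le> ?S"
          using True x s by (intro SUP_upper) simp
        then show ?thesis using True s U by (simp add: openin_sets_borel_algebra)
      next
        case False
        then show ?thesis using U by (simp add: openin_sets_borel_algebra)
      qed
    qed
  qed
  then show ?thesis using x by (simp add: prob_measures_def prob_space_return)
qed

lemma prob_measures_measurable:
  assumes "\<mu> \<in> prob_measures X" "continuous_map X Y f"
  shows "f \<in> measurable \<mu> (borel_algebra Y)"
  using continuous_map_measurable[OF assms(2)] assms(1) measurable_cong_sets
  by (auto simp: prob_measures_def)

lemma prob_measures_borel_measurable: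
  assumes "\<mu> \<in> prob_measures X" "continuous_map X euclideanreal f"
  shows "f \<in> borel_measurable \<mu>"
  using continuous_real_measurable[OF assms(2)] assms(1) measurable_cong_sets
  by (auto simp: prob_measures_def)

lemma continuous_real_bounded:
  assumes "compact_space X" "continuous_map X euclideanreal f"
  obtains M where "M > 0" "\<And>x. x \<in> topspace X \<Longrightarrow> \<bar>f x\<bar> \<le> M"
proof -
  have "compactin euclideanreal (f ` topspace X)"
    using assms by (intro image_compactin) (simp add: compact_space_def)
  then have "bounded (f ` topspace X)" by (simp add: compact_imp_bounded)
  then show thesis using that by (force simp: bounded_pos)
qed

lemma prob_measures_integrable:
  assumes X: "compact_space X" and f: "continuous_map X euclideanreal f" and \<mu>: "\<mu> \<in> prob_measures X"
  shows "integrable \<mu> f"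
proof -
  interpret prob_space \<mu> using \<mu> by (simp add: prob_measures_def)
  obtain M where "\<And>x. x \<in> topspace X \<Longrightarrow> \<bar>f x\<bar> \<le> M" using continuous_real_bounded[OF X f] by metis
  then show ?thesis
    using prob_measures_borel_measurable[OF \<mu> f] \<mu>
    by (intro integrable_const_bound[where B = M] AE_I2) (auto simp: prob_measures_def)
qed

text \<open>Measures with almost all their mass near \<open>x\<close> are weak-* close to the point
  mass at \<open>x\<close>. The property passes to finite intersections and to unions, so induction
  over the generated topology leaves only the test by a single continuous function.\<close>

lemma weak_star_nhd_return:
  fixes X :: "'x topology"
  assumes X: "compact_space X" and x: "x \<in> topspace X"
    and W: "openin (weak_star_topology X) W" "return (borel_algebra X) x \<in> W"
  shows "\<exists>U e. openin X U \<and> x \<in> U \<and> e > 0 \<and> (\<forall>\<rho> \<in> prob_measures X. measure \<rho> U > 1 - e \<longrightarrow> \<rho> \<in> W)"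
proof -
  let ?R = "return (borel_algebra X) x"
  define good where "good W U e \<longleftrightarrow> openin X U \<and> x \<in> U \<and> e > (0 :: real) \<and>
    (\<forall>\<rho> \<in> prob_measures X. measure \<rho> U > 1 - e \<longrightarrow> \<rho> \<in> W)" for W U e
  have "generate_topology_on {{\<mu> \<in> prob_measures X. integral\<^sup>L \<mu> f \<in> U} | f U.
      continuous_map X euclideanreal f \<and> open U} W"
    using W(1) by (simp add: weak_star_topology_def openin_topology_generated_by_iff)
  then have "?R \<in> W \<Longrightarrow> \<exists>U e. good W U e"
  proof (induction rule: generate_topology_on.induct)
    case Empty
    then show ?case by simp
  next
    case (Int A B)
    then obtain U e V d where *: "good A U e" "good B V d" by blast
    have "good (A \<inter> B) (U \<inter> V) (min e d)"
      unfolding good_def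
    proof (intro conjI ballI impI)
      show "openin X (U \<inter> V)" "x \<in> U \<inter> V" "min e d > 0" using * by (auto simp: good_def)
      fix \<rho> assume \<rho>: "\<rho> \<in> prob_measures X" "measure \<rho> (U \<inter> V) > 1 - min e d"
      interpret prob_space \<rho> using \<rho> by (simp add: prob_measures_def)
      have s: "sets \<rho> = sets (borel_algebra X)" using \<rho> by (simp add: prob_measures_def)
      have "measure \<rho> (U \<inter> V) \<le> measure \<rho> U" "measure \<rho> (U \<inter> V) \<le> measure \<rho> V"
        using * by (auto simp: good_def s intro!: finite_measure_mono openin_sets_borel_algebra)
      then have "measure \<rho> U > 1 - e" "measure \<rho> V > 1 - d" using \<rho>(2) by linarith+
      then show "\<rho> \<in> A \<inter> B" using * \<rho>(1) by (simp add: good_def)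
    qed
    then show ?case by blast
  next
    case (UN \<K>)
    then obtain A U e where "A \<in> \<K>" "good A U e" by blast
    then have "good (\<Union>\<K>) U e" unfolding good_def by blast
    then show ?case by blast
  next
    case (Basis S)
    then obtain f U where f: "continuous_map X euclideanreal f" and U: "open U"
      and S: "S = {\<mu> \<in> prob_measures X. integral\<^sup>L \<mu> f \<in> U}" by blast
    have "integral\<^sup>L ?R f = f x"
      using x continuous_real_measurable[OF f] by (intro integral_return) auto
    then have "f x \<in> U" using Basis.prems S by simp
    then obtain r where r: "r > 0" "ball (f x) r \<subseteq> U" using U open_contains_ball by blast
    obtain M where M: "M > 0" "\<And>y. y \<in> topspace X \<Longrightarrow> \<bar>f y\<bar> \<le> M"
      using continuous_real_bounded[OF X f] by metis
    define V where "V = {y \<in> topspace X. f y \<in> ball (f x) (r / 2)}"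
    have V: "openin X V"
      unfolding V_def by (rule openin_continuous_map_preimage[OF f]) simp
    \<comment> \<open>On \<open>V\<close> the integrand \<open>\<bar>f y - f x\<bar>\<close> is
      below \<open>r / 2\<close>. Off \<open>V\<close> it is at most \<open>2 * M\<close>, on a set
      of mass below \<open>r / (4 * M)\<close>, which contributes less than another
      \<open>r / 2\<close>.\<close>
    have "good S V (r / (4 * M))"
      unfolding good_def
    proof (intro conjI ballI impI)
      show "openin X V" by (rule V)
      show "x \<in> V" using x r by (simp add: V_def)
      show "r / (4 * M) > 0" using r M by simp
      fix \<rho> assume \<rho>: "\<rho> \<in> prob_measures X" "measure \<rho> V > 1 - r / (4 * M)"
      interpret prob_space \<rho> using \<rho> by (simp add: prob_measures_def)
      have s: "sets \<rho> = sets (borel_algebra X)" "space \<rho> = topspace X"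
        using \<rho> by (simp_all add: prob_measures_def)
      have int: "integrable \<rho> f" by (rule prob_measures_integrable[OF X f \<rho>(1)])
      have Vs: "V \<in> sets \<rho>" "topspace X - V \<in> sets \<rho>"
        using V unfolding s by (auto intro: openin_sets_borel_algebra closedin_borel)
      have mV: "measure \<rho> (topspace X - V) < r / (4 * M)"
        using prob_compl[OF Vs(1)] \<rho>(2) s by simp
      have "\<bar>integral\<^sup>L \<rho> f - f x\<bar> = \<bar>\<integral>y. (f y - f x) \<partial>\<rho>\<bar>"
        using int by (simp add: prob_space)
      also have "\<dots> \<le> (\<integral>y. \<bar>f y - f x\<bar> \<partial>\<rho>)" by (rule integral_abs_bound)
      also have "\<dots> \<le> (\<integral>y. r / 2 + 2 * M * indicator (topspace X - V) y \<partial>\<rho>)"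
      proof (rule integral_mono)
        show "integrable \<rho> (\<lambda>y. \<bar>f y - f x\<bar>)" using int by simp
        show "integrable \<rho> (\<lambda>y. r / 2 + 2 * M * indicator (topspace X - V) y)"
          using Vs(2) by (simp add: emeasure_eq_measure)
        fix y assume "y \<in> space \<rho>"
        then have y: "y \<in> topspace X" by (simp add: s)
        show "\<bar>f y - f x\<bar> \<le> r / 2 + 2 * M * indicator (topspace X - V) y"
        proof (cases "y \<in> V")
          case True
          then show ?thesis by (simp add: V_def dist_real_def abs_minus_commute)
        next
          case False
          then show ?thesis using M(2)[OF y] M(2)[OF x] y r(1) by simp
        qed
      qed
      also have "\<dots> = r / 2 + 2 * M * measure \<rho> (topspace X - V)"
        using Vs(2) by (simp add: prob_space emeasure_eq_measure)
      also have "\<dots> < r / 2 + 2 * M * (r / (4 * M))"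
        using mult_strict_left_mono[OF mV, of "2 * M"] M(1) by simp
      also have "\<dots> = r" using M(1) by simp
      finally have "integral\<^sup>L \<rho> f \<in> ball (f x) r" by (simp add: dist_real_def abs_minus_commute)
      then show "\<rho> \<in> S" using r(2) \<rho>(1) S by blast
    qed
    then show ?case by blast
  qed
  then show ?thesis using W(2) unfolding good_def by blast
qed

lemma induced_action_prob_measures:
  assumes fl: "flow K T X a" and k: "k \<in> carrier K" and \<mu>: "\<mu> \<in> prob_measures X"
  shows "induced_action X a k \<mu> \<in> prob_measures X"
proof -
  interpret group K by (rule flow_group[OF fl])
  have "homeomorphic_maps X X (a k) (a (inv\<^bsub>K\<^esub> k))"
    using flow_continuous[OF fl] flow_inv_left[OF fl k] flow_inv_right[OF fl k] k
    by (simp add: homeomorphic_maps_def)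
  then show ?thesis
    unfolding induced_action_def by (rule homeomorphic_maps_prob_measures[OF _ \<mu>])
qed

lemma measure_induced_action:
  assumes fl: "flow K T X a" and k: "k \<in> carrier K" and \<mu>: "\<mu> \<in> prob_measures X"
    and A: "A \<in> sets (borel_algebra X)"
  shows "measure (induced_action X a k \<mu>) A = push_charge X (a k) (measure \<mu>) A"
proof -
  have "a k \<in> measurable \<mu> (borel_algebra X)"
    by (rule prob_measures_measurable[OF \<mu> flow_continuous[OF fl k]])
  moreover have "a k -` A \<inter> space \<mu> = {x \<in> topspace X. a k x \<in> A}"
    using \<mu> by (auto simp: prob_measures_def)
  ultimately show ?thesis
    using A by (simp add: induced_action_def measure_distr push_charge_def)
qed

lemma integral_induced_action:
  assumes fl: "flow K T X a" and k: "k \<in> carrier K" and \<mu>: "\<mu> \<in> prob_measures X"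
    and f: "continuous_map X euclideanreal f"
  shows "integral\<^sup>L (induced_action X a k \<mu>) f = (\<integral>x. f (a k x) \<partial>\<mu>)"
  unfolding induced_action_def
  by (rule integral_distr[OF prob_measures_measurable[OF \<mu> flow_continuous[OF fl k]]
        continuous_real_measurable[OF f]])

text \<open>Contraction is applied to the average of the two measures. If the average gives a set
  mass above \<open>1 - e / 2\<close>, each measure gives it mass above \<open>1 - e\<close>, so
  both translates approach the same point mass.\<close>

lemma contracting_imp_strongly_proximal:
  assumes fl: "flow K T X a" and a: "contracting {0..1} K X a"
  shows "strongly_proximal_action K X a"
  unfolding strongly_proximal_action_def proximal_action_iff topspace_weak_star_topology
proof (intro ballI)
  fix \<mu> \<nu> assume \<mu>: "\<mu> \<in> prob_measures X" and \<nu>: "\<nu> \<in> prob_measures X"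
  \<comment> \<open>As \<open>measure\<close> is 0 outside the sigma-algebra, \<open>c\<close> has
    values in \<open>{0..1}\<close> on all sets, as a charge must.\<close>
  define c where "c A = (measure \<mu> A + measure \<nu> A) / 2" for A
  interpret M: prob_space \<mu> using \<mu> by (simp add: prob_measures_def)
  interpret N: prob_space \<nu> using \<nu> by (simp add: prob_measures_def)
  have s: "sets \<mu> = sets (borel_algebra X)" "sets \<nu> = sets (borel_algebra X)"
    "space \<mu> = topspace X" "space \<nu> = topspace X"
    using \<mu> \<nu> by (simp_all add: prob_measures_def)
  have "c \<in> charges {0..1} X"
  proof -
    have "c A \<in> {0..1}" for A
      using add_mono[OF M.prob_le_1[of A] N.prob_le_1[of A]] by (simp add: c_def)
    moreover have "c (topspace X) = 1" using M.prob_space N.prob_space by (simp add: c_def s)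
    moreover have "c (A \<union> B) = c A + c B"
      if "A \<in> sets (borel_algebra X)" "B \<in> sets (borel_algebra X)" "A \<inter> B = {}" for A B
      using that M.finite_measure_Union[of A B] N.finite_measure_Union[of A B]
      by (simp add: c_def s field_simps)
    ultimately show ?thesis by (auto simp: charges_def)
  qed
  then obtain x where x: "x \<in> topspace X" "\<And>U e. openin X U \<Longrightarrow> x \<in> U \<Longrightarrow> e > 0 \<Longrightarrow>
      \<exists>k \<in> carrier K. push_charge X (a k) c U > 1 - e"
    using a unfolding contracting_def by metis
  let ?R = "return (borel_algebra X) x"
  have "\<exists>k \<in> carrier K. induced_action X a k \<mu> \<in> W \<and> induced_action X a k \<nu> \<in> W"
    if W: "openin (weak_star_topology X) W" "?R \<in> W" for W
  proof -
    obtain U e where U: "openin X U" "x \<in> U" "e > 0"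
      "\<And>\<rho>. \<rho> \<in> prob_measures X \<Longrightarrow> measure \<rho> U > 1 - e \<Longrightarrow> \<rho> \<in> W"
      using weak_star_nhd_return[OF flow_compact[OF fl] x(1) W] by metis
    have "e / 2 > 0" using U(3) by simp
    then obtain k where k: "k \<in> carrier K" "push_charge X (a k) c U > 1 - e / 2"
      using x(2)[OF U(1,2)] by blast
    define P where "P = {x \<in> topspace X. a k x \<in> U}"
    have "1 - e / 2 < (measure \<mu> P + measure \<nu> P) / 2"
      using k(2) by (simp add: push_charge_def c_def P_def)
    then have "measure \<mu> P > 1 - e" "measure \<nu> P > 1 - e"
      using M.prob_le_1[of P] N.prob_le_1[of P] by argo+
    then have "induced_action X a k \<mu> \<in> W" "induced_action X a k \<nu> \<in> W"
      using U(1) k(1) \<mu> \<nu>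
      by (auto intro!: U(4) induced_action_prob_measures[OF fl]
          simp: measure_induced_action[OF fl] push_charge_def openin_sets_borel_algebra P_def)
    then show ?thesis using k(1) by blast
  qed
  moreover have "?R \<in> prob_measures X" by (rule return_prob_measures[OF flow_Hausdorff[OF fl] x(1)])
  ultimately show "\<exists>z \<in> prob_measures X. \<forall>W. openin (weak_star_topology X) W \<and> z \<in> W \<longrightarrow>
      (\<exists>k \<in> carrier K. induced_action X a k \<mu> \<in> W \<and> induced_action X a k \<nu> \<in> W)"
    by blast
qed

lemma Urysohn_point:
  assumes X: "compact_space X" "Hausdorff_space X" and U: "openin X U" "x \<in> U"
  obtains g :: "'x \<Rightarrow> real" and V where "continuous_map X euclideanreal g"
    "\<And>y. y \<in> topspace X \<Longrightarrow> 0 \<le> g y \<and> g y \<le> indicator U y"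
    "openin X V" "x \<in> V" "\<And>y. y \<in> V \<Longrightarrow> g y = 1"
proof -
  have x: "x \<in> topspace X" using U openin_subset by blast
  have "normal_space X" using X by (simp add: compact_Hausdorff_or_regular_imp_normal_space)
  moreover have "closedin X (topspace X - U)" "closedin X {x}" "disjnt (topspace X - U) {x}"
    using X U x by (auto simp: closedin_Hausdorff_sing_eq)
  ultimately obtain f where f: "continuous_map X (top_of_set {0..1 :: real}) f"
    "f ` (topspace X - U) \<subseteq> {0}" "f ` {x} \<subseteq> {1}"
    using Urysohn_lemma[of X "topspace X - U" "{x}" 0 1] by auto
  have cf: "continuous_map X euclideanreal f" and f01: "\<And>y. y \<in> topspace X \<Longrightarrow> f y \<in> {0..1}"
    using f(1) by (auto simp: continuous_map_in_subtopology)
  show thesis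
  proof (rule that)
    \<comment> \<open>Doubling and truncating makes the function equal to 1 on a whole neighbourhood
      of \<open>x\<close> rather than at \<open>x\<close> alone.\<close>
    show "continuous_map X euclideanreal (\<lambda>y. min 1 (2 * f y))"
      by (intro continuous_map_real_min continuous_map_real_mult cf) auto
    show "0 \<le> min 1 (2 * f y) \<and> min 1 (2 * f y) \<le> indicator U y" if "y \<in> topspace X" for y
      using f01[OF that] f(2) that by (cases "y \<in> U") auto
    show "openin X {y \<in> topspace X. f y \<in> {1/2<..}}"
      by (rule openin_continuous_map_preimage[OF cf]) simp
    show "x \<in> {y \<in> topspace X. f y \<in> {1/2<..}}" using f(3) x by simp
    show "min 1 (2 * f y) = 1" if "y \<in> {y \<in> topspace X. f y \<in> {1/2<..}}" for y using that by simp
  qed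
qed

text \<open>Suppose that contraction fails for \<open>c\<close>, and replace \<open>c\<close> by a
  measure \<open>\<mu>\<close> that it dominates on open sets. Strong proximality brings
  \<open>\<mu>\<close> and the point mass at some \<open>x0\<close> together under a common
  \<open>k\<close>. The point \<open>a k x0\<close> lies in some \<open>V x\<close>, where
  \<open>g x\<close> is 1, so the translate of \<open>\<mu>\<close> has an integral of
  \<open>g x\<close> above \<open>1 - e x\<close>. As \<open>g x\<close> is at most the indicator of
  \<open>U x\<close>, this forces too much charge on \<open>U x\<close>.\<close>

lemma strongly_proximal_imp_contracting:
  fixes X :: "'x topology"
  assumes fl: "flow K T X a" and sp: "strongly_proximal_action K X a"
  shows "contracting {0..1} K X a"
  unfolding contracting_def
proof (rule ballI, rule ccontr)
  note X = flow_compact[OF fl] flow_Hausdorff[OF fl]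
  fix c assume c: "c \<in> charges {0..1} X"
    and "\<not> (\<exists>x \<in> topspace X. \<forall>U e. openin X U \<and> x \<in> U \<and> e > 0 \<longrightarrow>
      (\<exists>k \<in> carrier K. push_charge X (a k) c U > 1 - e))"
  then have "\<forall>x \<in> topspace X. \<exists>U e. openin X U \<and> x \<in> U \<and> e > 0 \<and>
      (\<forall>k \<in> carrier K. push_charge X (a k) c U \<le> 1 - e)" by (meson not_le_imp_less)
  then obtain U e where U: "\<And>x. x \<in> topspace X \<Longrightarrow> openin X (U x) \<and> x \<in> U x \<and> e x > 0 \<and>
      (\<forall>k \<in> carrier K. push_charge X (a k) c (U x) \<le> 1 - e x)" by metis
  have "\<forall>x \<in> topspace X. \<exists>g V. continuous_map X euclideanreal g \<and>
      (\<forall>y \<in> topspace X. 0 \<le> g y \<and> g y \<le> indicator (U x) y) \<and>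
      openin X V \<and> x \<in> V \<and> (\<forall>y \<in> V. g y = 1)"
    using Urysohn_point[OF X] U by metis
  then obtain g V where g: "\<And>x. x \<in> topspace X \<Longrightarrow> continuous_map X euclideanreal (g x)"
    "\<And>x y. x \<in> topspace X \<Longrightarrow> y \<in> topspace X \<Longrightarrow> 0 \<le> g x y \<and> g x y \<le> indicator (U x) y"
    and V: "\<And>x. x \<in> topspace X \<Longrightarrow> openin X (V x) \<and> x \<in> V x"
    and gV: "\<And>x y. x \<in> topspace X \<Longrightarrow> y \<in> V x \<Longrightarrow> g x y = 1" by metis
  \<comment> \<open>The relevant \<open>x\<close> depends on where \<open>k\<close> moves
    \<open>x0\<close>, so \<open>k\<close> must be good for all candidates at once. A finite
    subcover leaves finitely many functions to control, hence one weak-* neighbourhood.\<close>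
  have "\<exists>\<F>. finite \<F> \<and> \<F> \<subseteq> V ` topspace X \<and> topspace X \<subseteq> \<Union>\<F>"
    using X(1) V by (intro compactinD) (auto simp: compact_space_def)
  then obtain \<F> where \<F>: "finite \<F>" "\<F> \<subseteq> V ` topspace X" "topspace X \<subseteq> \<Union>\<F>" by blast
  obtain S where S: "finite S" "S \<subseteq> topspace X" "\<F> = V ` S"
    using finite_subset_image[OF \<F>(1,2)] by blast
  obtain \<mu> where \<mu>: "\<mu> \<in> prob_measures X" "\<And>U. openin X U \<Longrightarrow> measure \<mu> U \<le> c U"
    using charge_dominates_measure[OF X c] by blast
  obtain x0 where x0: "x0 \<in> topspace X" using flow_nonempty[OF fl] by blast
  let ?R = "return (borel_algebra X) x0"
  have R: "?R \<in> prob_measures X" by (rule return_prob_measures[OF X(2) x0])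
  obtain \<nu> where \<nu>: "\<nu> \<in> prob_measures X"
    "\<And>W. openin (weak_star_topology X) W \<Longrightarrow> \<nu> \<in> W \<Longrightarrow>
       \<exists>k \<in> carrier K. induced_action X a k \<mu> \<in> W \<and> induced_action X a k ?R \<in> W"
    using sp \<mu>(1) R
    unfolding strongly_proximal_action_def proximal_action_iff topspace_weak_star_topology by metis
  \<comment> \<open>Both integrals lie within \<open>e x / 3\<close> of that for
    \<open>\<nu>\<close>, hence within \<open>2 * e x / 3\<close>, and so less than
    \<open>e x\<close>, of each other.\<close>
  define B where "B x = {\<rho> \<in> prob_measures X. integral\<^sup>L \<rho> (g x) \<in> ball (integral\<^sup>L \<nu> (g x)) (e x / 3)}" for x
  let ?W = "(\<Inter>x \<in> S. B x) \<inter> topspace (weak_star_topology X)"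
  have "openin (weak_star_topology X) ?W"
  proof (rule openin_INT[OF S(1)])
    fix x assume "x \<in> S"
    then have "continuous_map X euclideanreal (g x)" using g(1) S(2) by blast
    then show "openin (weak_star_topology X) (B x)"
      unfolding weak_star_topology_def B_def by (intro topology_generated_by_Basis) blast
  qed
  moreover have "\<nu> \<in> ?W" using \<nu>(1) U S(2) by (auto simp: B_def)
  ultimately have "\<exists>k \<in> carrier K. induced_action X a k \<mu> \<in> ?W \<and> induced_action X a k ?R \<in> ?W"
    by (rule \<nu>(2))
  then obtain k where k: "k \<in> carrier K"
    "\<And>x. x \<in> S \<Longrightarrow> induced_action X a k \<mu> \<in> B x \<and> induced_action X a k ?R \<in> B x"
    by blast
  have "a k x0 \<in> topspace X" by (rule flow_maps_to[OF fl k(1) x0])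
  then obtain x where x: "x \<in> S" "a k x0 \<in> V x" using \<F>(3) S(3) by blast
  then have xX: "x \<in> topspace X" using S(2) by blast
  have gx: "continuous_map X euclideanreal (g x)" by (rule g(1)[OF xX])
  have gk: "continuous_map X euclideanreal (\<lambda>y. g x (a k y))"
    using continuous_map_compose[OF flow_continuous[OF fl k(1)] gx] by (simp add: o_def)
  have "integral\<^sup>L (induced_action X a k ?R) (g x) = g x (a k x0)"
    unfolding integral_induced_action[OF fl k(1) R gx]
    using x0 continuous_real_measurable[OF gk] by (intro integral_return) auto
  then have "integral\<^sup>L (induced_action X a k ?R) (g x) = 1" using gV[OF xX x(2)] by simp
  moreover have "dist (integral\<^sup>L \<nu> (g x)) (integral\<^sup>L (induced_action X a k ?R) (g x)) < e x / 3"
    "dist (integral\<^sup>L \<nu> (g x)) (integral\<^sup>L (induced_action X a k \<mu>) (g x)) < e x / 3"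
    using k(2)[OF x(1)] by (auto simp: B_def)
  ultimately have big: "integral\<^sup>L (induced_action X a k \<mu>) (g x) > 1 - e x"
    unfolding dist_real_def using U[OF xX] by linarith
  interpret prob_space \<mu> using \<mu>(1) by (simp add: prob_measures_def)
  have s: "sets \<mu> = sets (borel_algebra X)" "space \<mu> = topspace X"
    using \<mu>(1) by (simp_all add: prob_measures_def)
  let ?P = "{y \<in> topspace X. a k y \<in> U x}"
  have opP: "openin X ?P"
    using flow_continuous[OF fl k(1)] U[OF xX] by (simp add: continuous_map_def)
  then have P: "?P \<in> sets \<mu>" using s openin_sets_borel_algebra by blast
  have "integral\<^sup>L (induced_action X a k \<mu>) (g x) = (\<integral>y. g x (a k y) \<partial>\<mu>)"
    by (rule integral_induced_action[OF fl k(1) \<mu>(1) gx])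
  also have "\<dots> \<le> (\<integral>y. indicator ?P y \<partial>\<mu>)"
  proof (rule integral_mono)
    show "integrable \<mu> (\<lambda>y. g x (a k y))" by (rule prob_measures_integrable[OF X(1) gk \<mu>(1)])
    show "integrable \<mu> (indicator ?P :: 'x \<Rightarrow> real)" using P by (simp add: emeasure_eq_measure)
    fix y assume "y \<in> space \<mu>"
    then have y: "y \<in> topspace X" by (simp add: s)
    then show "g x (a k y) \<le> indicator ?P y"
      using g(2)[OF xX flow_maps_to[OF fl k(1) y]] by (simp add: indicator_def)
  qed
  also have "\<dots> = measure \<mu> ?P" using P by simp
  also have "\<dots> \<le> c ?P" by (rule \<mu>(2)[OF opP])
  also have "\<dots> \<le> 1 - e x" using U[OF xX] k(1) by (simp add: push_charge_def)
  finally show False using big by simp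
qed

theorem strongly_proximal_iff_contracting:
  "flow K T X a \<Longrightarrow> strongly_proximal_action K X a \<longleftrightarrow> contracting {0..1} K X a"
  using contracting_imp_strongly_proximal strongly_proximal_imp_contracting by blast

section \<open>Rigidity and uniqueness\<close>

context charge_values
begin

text \<open>The coincidence set is closed and invariant, so by minimality it is empty or everything.
  If it were empty, the image of the pair \<open>(f, g)\<close> would be a compact invariant set off
  the diagonal, while contraction brings the points \<open>f z\<close> and \<open>g z\<close>
  arbitrarily close to a point of the diagonal.\<close>

lemma equivariant_maps_agree:
  assumes Z: "minimal_flow K T Z a" and X: "flow K T' X b" "contracting D K X b"
    and f: "continuous_map Z X f" "\<And>k z. k \<in> carrier K \<Longrightarrow> z \<in> topspace Z \<Longrightarrow> f (a k z) = b k (f z)"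
    and g: "continuous_map Z X g" "\<And>k z. k \<in> carrier K \<Longrightarrow> z \<in> topspace Z \<Longrightarrow> g (a k z) = b k (g z)"
    and z: "z \<in> topspace Z"
  shows "f z = g z"
proof -
  have flZ: "flow K T Z a" by (rule minimal_flow_flow[OF Z])
  let ?E = "{z \<in> topspace Z. f z = g z}"
  have "?E \<noteq> {}"
  proof
    assume E: "?E = {}"
    have "f z \<in> topspace X" "g z \<in> topspace X" using f(1) g(1) z by (auto simp: continuous_map_def)
    then obtain w where w: "w \<in> topspace X"
      "\<And>U. openin X U \<Longrightarrow> w \<in> U \<Longrightarrow> \<exists>k \<in> carrier K. b k (f z) \<in> U \<and> b k (g z) \<in> U"
      using contracting_pairs[OF X(2)] flow_maps_to[OF X(1)] by metis
    let ?P = "(\<lambda>z. (f z, g z)) ` topspace Z"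
    have "continuous_map Z (prod_topology X X) (\<lambda>z. (f z, g z))"
      using f(1) g(1) by (simp add: continuous_map_pairedI)
    then have "compactin (prod_topology X X) ?P"
      using flow_compact[OF flZ] by (intro image_compactin) (auto simp: compact_space_def)
    then have "closedin (prod_topology X X) ?P"
      using flow_Hausdorff[OF X(1)]
      by (intro compactin_imp_closedin) (auto simp: Hausdorff_space_prod_topology)
    then have "openin (prod_topology X X) (topspace (prod_topology X X) - ?P)" by blast
    moreover have "(w, w) \<in> topspace (prod_topology X X) - ?P" using w(1) E by auto
    ultimately have "\<exists>U V. openin X U \<and> openin X V \<and> w \<in> U \<and> w \<in> V \<and>
        U \<times> V \<subseteq> topspace (prod_topology X X) - ?P"
      unfolding openin_prod_topology_alt by blast
    then obtain U V where UV: "openin X U" "openin X V" "w \<in> U" "w \<in> V"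
      "U \<times> V \<subseteq> topspace (prod_topology X X) - ?P" by blast
    then have "openin X (U \<inter> V)" "w \<in> U \<inter> V" by auto
    then obtain k where k: "k \<in> carrier K" "b k (f z) \<in> U \<inter> V" "b k (g z) \<in> U \<inter> V"
      using w(2) by blast
    then have "(f (a k z), g (a k z)) \<in> U \<times> V" using f(2) g(2) z by simp
    moreover have "a k z \<in> topspace Z" by (rule flow_maps_to[OF flZ k(1) z])
    ultimately show False using UV(5) by blast
  qed
  moreover have "closedin Z ?E"
    by (rule closedin_continuous_maps_eq[OF flow_Hausdorff[OF X(1)] f(1) g(1)])
  ultimately have "invariant_closed K Z a ?E"
    using f(2) g(2) flow_maps_to[OF flZ] by (simp add: invariant_closed_def)
  then have "?E = topspace Z" by (rule minimal_flowD[OF Z])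
  then show ?thesis using z by blast
qed

text \<open>Universality gives equivariant maps both ways. Their composites are equivariant
  endomorphisms, hence identities by \<open>equivariant_maps_agree\<close>.\<close>

lemma universal_flow_unique:
  fixes X :: "'x topology" and Y :: "'y topology"
  assumes X: "universal_flow D K X a" and Y: "universal_flow D K Y b"
  obtains f g where "homeomorphic_maps X Y f g"
    "\<And>k x. k \<in> carrier K \<Longrightarrow> x \<in> topspace X \<Longrightarrow> f (a k x) = b k (f x)"
proof -
  note mX = universal_flow_minimal[OF X] and mY = universal_flow_minimal[OF Y]
  note cX = universal_flow_contracting[OF X] and cY = universal_flow_contracting[OF Y]
  note flX = universal_flow_flow[OF X] and flY = universal_flow_flow[OF Y]
  obtain f where "flow_factor_map K X a Y b f" using universal_flow_factor[OF X mY cY] by blast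
  then have f: "continuous_map X Y f"
    "\<And>k x. k \<in> carrier K \<Longrightarrow> x \<in> topspace X \<Longrightarrow> f (a k x) = b k (f x)"
    by (auto simp: flow_factor_map_def)
  obtain g where "flow_factor_map K Y b X a g" using universal_flow_factor[OF Y mX cX] by blast
  then have g: "continuous_map Y X g"
    "\<And>k y. k \<in> carrier K \<Longrightarrow> y \<in> topspace Y \<Longrightarrow> g (b k y) = a k (g y)"
    by (auto simp: flow_factor_map_def)
  have to: "\<And>x. x \<in> topspace X \<Longrightarrow> f x \<in> topspace Y" "\<And>y. y \<in> topspace Y \<Longrightarrow> g y \<in> topspace X"
    using f(1) g(1) by (auto simp: continuous_map_def)
  have gf: "continuous_map X X (\<lambda>x. g (f x))" and fg: "continuous_map Y Y (\<lambda>y. f (g y))"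
    using continuous_map_compose[OF f(1) g(1)] continuous_map_compose[OF g(1) f(1)]
    by (simp_all add: o_def)
  have "g (f x) = x" if "x \<in> topspace X" for x
    by (rule equivariant_maps_agree[OF mX flX cX gf _ _ _ that]) (use f(2) g(2) to in auto)
  moreover have "f (g y) = y" if "y \<in> topspace Y" for y
    by (rule equivariant_maps_agree[OF mY flY cY fg _ _ _ that]) (use f(2) g(2) to in auto)
  ultimately have "homeomorphic_maps X Y f g" using f(1) g(1) by (simp add: homeomorphic_maps_def)
  then show thesis using f(2) that by blast
qed

end

section \<open>Twisting an action by a group isomorphism\<close>

context
  fixes K :: "('g, 'm) monoid_scheme" and K' :: "('g, 'm) monoid_scheme" and \<phi>
  assumes K: "group K" and iso: "\<phi> \<in> iso K K'"
begin

lemma iso_closed: "k \<in> carrier K \<Longrightarrow> \<phi> k \<in> carrier K'"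
  and iso_mult: "k \<in> carrier K \<Longrightarrow> l \<in> carrier K \<Longrightarrow> \<phi> (k \<otimes>\<^bsub>K\<^esub> l) = \<phi> k \<otimes>\<^bsub>K'\<^esub> \<phi> l"
  and iso_image: "\<phi> ` carrier K = carrier K'"
  using iso by (auto simp: iso_def hom_def bij_betw_def)

lemma flow_twist:
  assumes "discrete_flow K' X a"
  shows "discrete_flow K X (\<lambda>k. a (\<phi> k))"
proof (rule discrete_flowI)
  show "group K" by (rule K)
  show "topspace X \<noteq> {}" "compact_space X" "Hausdorff_space X"
    using flow_nonempty[OF assms] flow_compact[OF assms] flow_Hausdorff[OF assms] by auto
  show "continuous_map X X (a (\<phi> k))" if "k \<in> carrier K" for k
    by (rule flow_continuous[OF assms iso_closed[OF that]])
  show "a (\<phi> k) \<in> extensional (topspace X)" if "k \<in> carrier K" for k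
    using flow_Bij[OF assms iso_closed[OF that]] by (simp add: Bij_def)
  have "\<phi> \<one>\<^bsub>K\<^esub> = \<one>\<^bsub>K'\<^esub>"
    using hom_one[OF _ K flow_group[OF assms]] iso by (auto simp: iso_def)
  then show "a (\<phi> \<one>\<^bsub>K\<^esub>) x = x" if "x \<in> topspace X" for x using flow_one[OF assms that] by simp
  show "a (\<phi> (k \<otimes>\<^bsub>K\<^esub> l)) x = a (\<phi> k) (a (\<phi> l) x)"
    if "k \<in> carrier K" "l \<in> carrier K" "x \<in> topspace X" for k l x
    using that by (simp add: iso_mult flow_mult[OF assms] iso_closed)
qed

lemma minimal_flow_twist:
  assumes "discrete_minimal_flow K' X a"
  shows "discrete_minimal_flow K X (\<lambda>k. a (\<phi> k))"
proof (rule minimal_flowI)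
  show "discrete_flow K X (\<lambda>k. a (\<phi> k))" by (rule flow_twist[OF minimal_flow_flow[OF assms]])
  fix M assume "invariant_closed K X (\<lambda>k. a (\<phi> k)) M"
  then have "invariant_closed K' X a M"
    unfolding invariant_closed_def iso_image[symmetric] by simp
  then show "M = topspace X" by (rule minimal_flowD[OF assms])
qed

lemma contracting_twist:
  assumes "contracting D K' X a"
  shows "contracting D K X (\<lambda>k. a (\<phi> k))"
  using assms unfolding contracting_def iso_image[symmetric] by simp

end

text \<open>A test flow of \<open>K\<close> becomes one of \<open>K'\<close> through the inverse of
  \<open>\<phi>\<close>, and the same factor map serves for both.\<close>

lemma (in charge_values) universal_flow_twist:
  fixes K :: "('g, 'm) monoid_scheme" and K' :: "('g, 'm) monoid_scheme" and X :: "'x topology"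
  assumes K: "group K" and iso: "\<phi> \<in> iso K K'" and X: "universal_flow D K' X a"
  shows "universal_flow D K X (\<lambda>k. a (\<phi> k))"
  unfolding universal_flow_def
proof (intro conjI allI impI)
  show "discrete_minimal_flow K X (\<lambda>k. a (\<phi> k))"
    by (rule minimal_flow_twist[OF K iso universal_flow_minimal[OF X]])
  show "contracting D K X (\<lambda>k. a (\<phi> k))"
    by (rule contracting_twist[OF K iso universal_flow_contracting[OF X]])
  fix Y :: "'g set set topology" and b
  assume Y: "discrete_minimal_flow K Y b \<and> contracting D K Y b"
  have K': "group K'" by (rule flow_group[OF universal_flow_flow[OF X]])
  define \<psi> where "\<psi> = inv_into (carrier K) \<phi>"
  have \<psi>: "\<psi> \<in> iso K' K" unfolding \<psi>_def by (rule group.iso_set_sym[OF K iso])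
  have \<psi>\<phi>: "\<psi> (\<phi> k) = k" if "k \<in> carrier K" for k
    using iso that by (simp add: \<psi>_def iso_def bij_betw_def)
  have "discrete_minimal_flow K' Y (\<lambda>k. b (\<psi> k))" "contracting D K' Y (\<lambda>k. b (\<psi> k))"
    using Y minimal_flow_twist[OF K' \<psi>] contracting_twist[OF K' \<psi>] by blast+
  then have "\<exists>f. flow_factor_map K' X a Y (\<lambda>k. b (\<psi> k)) f" by (rule universal_flow_factor[OF X])
  then obtain f where "flow_factor_map K' X a Y (\<lambda>k. b (\<psi> k)) f" by blast
  then have "flow_factor_map K X (\<lambda>k. a (\<phi> k)) Y b f"
    using iso_closed[OF K iso] \<psi>\<phi> by (simp add: flow_factor_map_def)
  then show "\<exists>f. flow_factor_map K X (\<lambda>k. a (\<phi> k)) Y b f" by blast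
qed


section \<open>Commensurators\<close>

context group
begin

lemma finite_index_subgroup_trans:
  assumes M: "finite_index_subgroup G M" and L: "finite_index_subgroup (G\<lparr>carrier := M\<rparr>) L"
  shows "finite_index_subgroup G L"
proof -
  have sM: "subgroup M G" by (rule finite_index_subgroup_subgroup[OF M])
  have sL: "subgroup L G"
    using finite_index_subgroup_subgroup[OF L] by (rule incl_subgroup[OF sM])
  obtain R where R: "finite R" "R \<subseteq> carrier G" "\<And>k. k \<in> carrier G \<Longrightarrow> \<exists>r \<in> R. inv r \<otimes> k \<in> M"
    using finite_index_subgroupE[OF M] by blast
  obtain S where S: "finite S" "S \<subseteq> M" "\<And>k. k \<in> M \<Longrightarrow> \<exists>s \<in> S. inv\<^bsub>G\<lparr>carrier := M\<rparr>\<^esub> s \<otimes> k \<in> L"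
    using finite_index_subgroupE[OF L] by auto
  have MG: "M \<subseteq> carrier G" by (rule subgroup.subset[OF sM])
  let ?T = "(\<lambda>(r, s). r \<otimes> s) ` (R \<times> S)"
  have "\<exists>t \<in> ?T. inv t \<otimes> k \<in> L" if k: "k \<in> carrier G" for k
  proof -
    obtain r where r: "r \<in> R" "inv r \<otimes> k \<in> M" using R(3)[OF k] by blast
    then obtain s where s: "s \<in> S" "inv\<^bsub>G\<lparr>carrier := M\<rparr>\<^esub> s \<otimes> (inv r \<otimes> k) \<in> L" using S(3) by blast
    have rs: "r \<in> carrier G" "s \<in> M" "s \<in> carrier G" using r(1) s(1) R(2) S(2) MG by auto
    have "inv (r \<otimes> s) \<otimes> k = inv s \<otimes> (inv r \<otimes> k)" using rs k by (simp add: inv_mult_group m_assoc)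
    then have "inv (r \<otimes> s) \<otimes> k \<in> L" using s(2) rs(2) by (simp add: m_inv_consistent[OF sM])
    then show ?thesis using r(1) s(1) by (intro bexI[of _ "r \<otimes> s"]) auto
  qed
  moreover have "finite ?T" "?T \<subseteq> carrier G" using R(1,2) S(1,2) MG by auto
  ultimately show ?thesis unfolding finite_index_subgroup_def using sL by blast
qed

lemma finite_index_subgroup_superset:
  assumes "finite_index_subgroup G L" "L \<subseteq> M" "subgroup M G"
  shows "finite_index_subgroup G M"
  using assms unfolding finite_index_subgroup_def by (meson subsetD)

lemma finite_index_subgroup_Int2:
  assumes A: "finite_index_subgroup G A" and B: "finite_index_subgroup G B"
  shows "finite_index_subgroup G (A \<inter> B)"
  by (rule finite_index_subgroup_trans[OF B
        finite_index_subgroup_Int[OF A finite_index_subgroup_subgroup[OF B]]])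

text \<open>\<open>finite_index\<close> counts right cosets while
  \<open>finite_index_subgroup\<close> lists left ones; inversion exchanges the two, whence the
  inverses in the labels and in the representatives.\<close>

lemma finite_index_iff:
  assumes L: "subgroup L G"
  shows "finite_index G L (carrier G) \<longleftrightarrow> finite_index_subgroup G L"
proof
  have LG: "L \<subseteq> carrier G" by (rule subgroup.subset[OF L])
  assume "finite_index G L (carrier G)"
  then have fin: "finite (rcosets L)" by (simp add: finite_index_def)
  show "finite_index_subgroup G L"
  proof (rule finite_index_subgroupI[OF L])
    have "(\<lambda>k. L #> inv k) ` carrier G \<subseteq> rcosets L" using LG by (auto intro: rcosetsI)
    then show "finite ((\<lambda>k. L #> inv k) ` carrier G)" using fin by (rule finite_subset)
    fix k k' assume k: "k \<in> carrier G" "k' \<in> carrier G" "L #> inv k = L #> inv k'"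
    have "inv k \<in> L #> inv k'" using rcos_self[OF _ L, of "inv k"] k by simp
    then obtain l where l: "l \<in> L" "inv k = l \<otimes> inv k'" by (auto simp: r_coset_def)
    then have "inv k \<otimes> k' = l" using k LG by (simp add: m_assoc subsetD)
    then show "inv k \<otimes> k' \<in> L" using l(1) by simp
  qed
next
  have LG: "L \<subseteq> carrier G" by (rule subgroup.subset[OF L])
  assume "finite_index_subgroup G L"
  then obtain R where R: "finite R" "R \<subseteq> carrier G" "\<And>k. k \<in> carrier G \<Longrightarrow> \<exists>r \<in> R. inv r \<otimes> k \<in> L"
    using finite_index_subgroupE by blast
  have "rcosets L \<subseteq> (\<lambda>r. L #> inv r) ` R"
  proof
    fix C assume "C \<in> rcosets L"
    then obtain h where h: "h \<in> carrier G" "C = L #> h" by (auto simp: RCOSETS_def)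
    obtain r where r: "r \<in> R" "inv r \<otimes> inv h \<in> L" using R(3)[of "inv h"] h by auto
    have rG: "r \<in> carrier G" using r(1) R(2) by blast
    have "inv (inv r \<otimes> inv h) \<in> L" by (rule subgroup.m_inv_closed[OF L r(2)])
    then have "h \<otimes> r \<in> L" using h rG by (simp add: inv_mult_group)
    moreover have "h = (h \<otimes> r) \<otimes> inv r" using h rG by (simp add: m_assoc)
    ultimately have "h \<in> L #> inv r" unfolding r_coset_def by blast
    then have "L #> inv r = L #> h" using rG by (intro repr_independence L) auto
    then show "C \<in> (\<lambda>r. L #> inv r) ` R" using h(2) r(1) by blast
  qed
  then show "finite_index G L (carrier G)"
    using R(1) LG by (simp add: finite_index_def finite_subset)
qed

lemma finite_index_subgroup_iso:
  fixes K' :: "('c, 'd) monoid_scheme"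
  assumes K': "group K'" and iso: "\<phi> \<in> iso G K'" and L: "finite_index_subgroup G L"
  shows "finite_index_subgroup K' (\<phi> ` L)"
proof -
  interpret group_hom G K' \<phi>
    using K' iso is_group by (simp add: group_hom_def group_hom_axioms_def iso_def)
  have sL: "subgroup L G" by (rule finite_index_subgroup_subgroup[OF L])
  obtain R where R: "finite R" "R \<subseteq> carrier G" "\<And>k. k \<in> carrier G \<Longrightarrow> \<exists>r \<in> R. inv r \<otimes> k \<in> L"
    using finite_index_subgroupE[OF L] by blast
  have "\<exists>s \<in> \<phi> ` R. inv\<^bsub>K'\<^esub> s \<otimes>\<^bsub>K'\<^esub> k' \<in> \<phi> ` L" if k': "k' \<in> carrier K'" for k'
  proof -
    obtain k where k: "k \<in> carrier G" "k' = \<phi> k"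
      using iso k' by (auto simp: iso_def bij_betw_def)
    obtain r where r: "r \<in> R" "inv r \<otimes> k \<in> L" using R(3)[OF k(1)] by blast
    have "\<phi> (inv r \<otimes> k) = inv\<^bsub>K'\<^esub> (\<phi> r) \<otimes>\<^bsub>K'\<^esub> k'" using k r(1) R(2) by (simp add: subsetD)
    then show ?thesis using r by (metis imageI)
  qed
  moreover have "finite (\<phi> ` R)" "\<phi> ` R \<subseteq> carrier K'" using R(1,2) by auto
  ultimately show ?thesis
    unfolding finite_index_subgroup_def using subgroup_img_is_subgroup[OF sL] by blast
qed

section \<open>Conjugate subgroups and closure properties of the commensurator\<close>

lemma conjugate_subgroup_image: "conjugate_subgroup G g H = (\<lambda>t. g \<otimes> t \<otimes> inv g) ` H"
  by (auto simp: conjugate_subgroup_def l_coset_def r_coset_def)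

lemma conjugate_subgroup_iff:
  assumes "H \<subseteq> carrier G" "g \<in> carrier G" "x \<in> carrier G"
  shows "x \<in> conjugate_subgroup G g H \<longleftrightarrow> inv g \<otimes> x \<otimes> g \<in> H"
proof
  assume "x \<in> conjugate_subgroup G g H"
  then obtain t where t: "t \<in> H" "x = g \<otimes> t \<otimes> inv g" by (auto simp: conjugate_subgroup_image)
  then have "inv g \<otimes> x \<otimes> g = t" using assms by (simp add: m_assoc mult_inv_cancel subsetD)
  then show "inv g \<otimes> x \<otimes> g \<in> H" using t(1) by simp
next
  assume "inv g \<otimes> x \<otimes> g \<in> H"
  moreover have "x = g \<otimes> (inv g \<otimes> x \<otimes> g) \<otimes> inv g" using assms by (simp add: m_assoc mult_inv_cancel)
  ultimately show "x \<in> conjugate_subgroup G g H" unfolding conjugate_subgroup_image by blast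
qed

lemma conjugate_subgroup_closed:
  assumes "H \<subseteq> carrier G" "g \<in> carrier G"
  shows "conjugate_subgroup G g H \<subseteq> carrier G"
  using assms by (auto simp: conjugate_subgroup_image)

lemma conjugation_iso:
  assumes H: "H \<subseteq> carrier G" and g: "g \<in> carrier G"
  shows "(\<lambda>t. g \<otimes> t \<otimes> inv g) \<in> iso (G\<lparr>carrier := H\<rparr>) (G\<lparr>carrier := conjugate_subgroup G g H\<rparr>)"
proof -
  have "inj_on (\<lambda>t. g \<otimes> t \<otimes> inv g) H"
    using H g by (intro inj_onI) (simp add: subsetD)
  moreover have "g \<otimes> (s \<otimes> t) \<otimes> inv g = (g \<otimes> s \<otimes> inv g) \<otimes> (g \<otimes> t \<otimes> inv g)"
    if "s \<in> H" "t \<in> H" for s t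
    using that H g by (simp add: m_assoc mult_inv_cancel subsetD)
  ultimately show ?thesis
    by (auto simp: iso_def hom_def bij_betw_def conjugate_subgroup_image)
qed

lemma subgroup_conjugate:
  assumes H: "subgroup H G" and g: "g \<in> carrier G"
  shows "subgroup (conjugate_subgroup G g H) G"
proof -
  have HG: "H \<subseteq> carrier G" by (rule subgroup.subset[OF H])
  have "(\<lambda>t. g \<otimes> t \<otimes> inv g) \<in> hom G G"
    using g by (auto simp: hom_def m_assoc mult_inv_cancel)
  then have "group_hom G G (\<lambda>t. g \<otimes> t \<otimes> inv g)"
    by (simp add: group_hom_def group_hom_axioms_def is_group)
  then show ?thesis
    unfolding conjugate_subgroup_image by (rule group_hom.subgroup_img_is_subgroup[OF _ H])
qed

lemma finite_index_conjugate:
  assumes H: "subgroup H G" and g: "g \<in> carrier G" and L: "finite_index_subgroup (G\<lparr>carrier := H\<rparr>) L"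
  shows "finite_index_subgroup (G\<lparr>carrier := conjugate_subgroup G g H\<rparr>) (conjugate_subgroup G g L)"
proof -
  interpret HH: group "G\<lparr>carrier := H\<rparr>" by (rule subgroup_imp_group[OF H])
  show ?thesis
    unfolding conjugate_subgroup_image[of g L]
    by (rule HH.finite_index_subgroup_iso[OF subgroup_imp_group[OF subgroup_conjugate[OF H g]]
          conjugation_iso[OF subgroup.subset[OF H] g] L])
qed

lemma commensurator_iff:
  assumes H: "subgroup H G"
  shows "g \<in> commensurator G H \<longleftrightarrow> g \<in> carrier G \<and>
    finite_index_subgroup (G\<lparr>carrier := H\<rparr>) (H \<inter> conjugate_subgroup G g H) \<and>
    finite_index_subgroup (G\<lparr>carrier := conjugate_subgroup G g H\<rparr>) (H \<inter> conjugate_subgroup G g H)"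
proof (cases "g \<in> carrier G")
  case True
  let ?L = "H \<inter> conjugate_subgroup G g H"
  have Hg: "subgroup (conjugate_subgroup G g H) G" by (rule subgroup_conjugate[OF H True])
  have *: "finite_index G ?L S \<longleftrightarrow> finite_index_subgroup (G\<lparr>carrier := S\<rparr>) ?L"
    if S: "subgroup S G" "?L \<subseteq> S" for S
  proof -
    interpret SS: group "G\<lparr>carrier := S\<rparr>" by (rule subgroup_imp_group[OF S(1)])
    have "subgroup ?L (G\<lparr>carrier := S\<rparr>)"
      by (intro subgroup_incl subgroups_Inter_pair H Hg S)
    then show ?thesis using SS.finite_index_iff by (simp add: finite_index_def)
  qed
  then show ?thesis using True *[OF H] *[OF Hg] by (simp add: commensurator_def)
qed (simp add: commensurator_def)

lemma conjugate_subgroup_mult: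
  assumes "H \<subseteq> carrier G" "g \<in> carrier G" "k \<in> carrier G"
  shows "conjugate_subgroup G (g \<otimes> k) H = conjugate_subgroup G g (conjugate_subgroup G k H)"
proof -
  have "(g \<otimes> k) \<otimes> t \<otimes> inv (g \<otimes> k) = g \<otimes> (k \<otimes> t \<otimes> inv k) \<otimes> inv g" if "t \<in> H" for t
    using that assms by (simp add: inv_mult_group m_assoc subsetD)
  then show ?thesis by (simp add: conjugate_subgroup_image image_image)
qed

lemma conjugate_subgroup_Int:
  assumes "A \<subseteq> carrier G" "B \<subseteq> carrier G" "g \<in> carrier G"
  shows "conjugate_subgroup G g (A \<inter> B) = conjugate_subgroup G g A \<inter> conjugate_subgroup G g B"
proof -
  have "inj_on (\<lambda>t. g \<otimes> t \<otimes> inv g) (carrier G)" using assms(3) by (intro inj_onI) simp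
  then show ?thesis
    unfolding conjugate_subgroup_image using assms(1,2) by (rule inj_on_image_Int)
qed

lemma conjugate_subgroup_inv:
  assumes "H \<subseteq> carrier G" "g \<in> carrier G"
  shows "conjugate_subgroup G g (conjugate_subgroup G (inv g) H) = H"
proof -
  have "conjugate_subgroup G \<one> H = H"
    using assms(1) by (auto simp: conjugate_subgroup_image subsetD image_iff)
  then show ?thesis using conjugate_subgroup_mult[OF assms(1,2), of "inv g"] assms(2) by simp
qed

text \<open>Commensurability is transitive. Conjugating by \<open>g\<close> makes the conjugate by
  \<open>g\<close> commensurable with the conjugate by \<open>g \<otimes> k\<close>, and it is
  commensurable with \<open>H\<close> by assumption.\<close>

lemma commensurator_mult:
  assumes H: "subgroup H G" and g: "g \<in> commensurator G H" and k: "k \<in> commensurator G H"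
  shows "g \<otimes> k \<in> commensurator G H"
proof -
  have HG: "H \<subseteq> carrier G" by (rule subgroup.subset[OF H])
  have gG: "g \<in> carrier G" and kG: "k \<in> carrier G" using g k by (auto simp: commensurator_def)
  let ?c = "conjugate_subgroup G"
  let ?gH = "?c g H" and ?kH = "?c k H" and ?gkH = "?c (g \<otimes> k) H"
  have kHG: "?kH \<subseteq> carrier G" by (rule conjugate_subgroup_closed[OF HG kG])
  have s: "subgroup ?gH G" "subgroup ?kH G" "subgroup ?gkH G"
    using subgroup_conjugate[OF H] gG kG by auto
  have A: "finite_index_subgroup (G\<lparr>carrier := H\<rparr>) (H \<inter> ?gH)"
    "finite_index_subgroup (G\<lparr>carrier := ?gH\<rparr>) (H \<inter> ?gH)"
    using g commensurator_iff[OF H] by auto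
  have "?c g (H \<inter> ?kH) = ?gH \<inter> ?gkH"
    using conjugate_subgroup_Int[OF HG kHG gG] conjugate_subgroup_mult[OF HG gG kG] by simp
  moreover have "finite_index_subgroup (G\<lparr>carrier := ?gH\<rparr>) (?c g (H \<inter> ?kH))"
    "finite_index_subgroup (G\<lparr>carrier := ?c g ?kH\<rparr>) (?c g (H \<inter> ?kH))"
    using k commensurator_iff[OF H] finite_index_conjugate[OF H gG] finite_index_conjugate[OF s(2) gG]
    by auto
  ultimately have B: "finite_index_subgroup (G\<lparr>carrier := ?gH\<rparr>) (?gH \<inter> ?gkH)"
    "finite_index_subgroup (G\<lparr>carrier := ?gkH\<rparr>) (?gH \<inter> ?gkH)"
    using conjugate_subgroup_mult[OF HG gG kG] by simp_all
  \<comment> \<open>Both halves at once: \<open>S\<close> is one of the outer groups,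
    \<open>P\<close> its intersection with the middle group \<open>?gH\<close>, and \<open>Q\<close>
    the intersection of the other outer group with \<open>?gH\<close>. Within \<open>?gH\<close> the
    set \<open>P \<inter> Q\<close> has finite index in \<open>P\<close>, and \<open>P\<close> has
    finite index in \<open>S\<close>.\<close>
  have main: "finite_index_subgroup (G\<lparr>carrier := S\<rparr>) (H \<inter> ?gkH)"
    if S: "subgroup S G" "H \<inter> ?gkH \<subseteq> S"
      and P: "finite_index_subgroup (G\<lparr>carrier := S\<rparr>) P" "finite_index_subgroup (G\<lparr>carrier := ?gH\<rparr>) P"
      and Q: "finite_index_subgroup (G\<lparr>carrier := ?gH\<rparr>) Q"
      and PQ: "P \<inter> Q \<subseteq> H \<inter> ?gkH" for S P Q
  proof -
    interpret SS: group "G\<lparr>carrier := S\<rparr>" by (rule subgroup_imp_group[OF S(1)])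
    interpret gH: group "G\<lparr>carrier := ?gH\<rparr>" by (rule subgroup_imp_group[OF s(1)])
    have "finite_index_subgroup (G\<lparr>carrier := P\<rparr>) (P \<inter> Q)"
      using gH.finite_index_subgroup_Int[OF Q finite_index_subgroup_subgroup[OF P(2)]]
      by (simp add: Int_commute)
    then have "finite_index_subgroup (G\<lparr>carrier := S\<rparr>) (P \<inter> Q)"
      using SS.finite_index_subgroup_trans[OF P(1)] by simp
    moreover have "subgroup (H \<inter> ?gkH) (G\<lparr>carrier := S\<rparr>)"
      by (intro subgroup_incl subgroups_Inter_pair H s S)
    ultimately show ?thesis using SS.finite_index_subgroup_superset PQ by blast
  qed
  have "finite_index_subgroup (G\<lparr>carrier := H\<rparr>) (H \<inter> ?gkH)"
    by (rule main[OF H _ A B(1)]) auto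
  moreover have "finite_index_subgroup (G\<lparr>carrier := ?gkH\<rparr>) (H \<inter> ?gkH)"
    by (rule main[OF s(3) _ B(2,1) A(2)]) auto
  ultimately show ?thesis using gG kG by (simp add: commensurator_iff[OF H])
qed

text \<open>Conjugation by \<open>inv g\<close> carries the finite-index pair of
  \<open>H \<inter> conjugate_subgroup G g H\<close> in \<open>conjugate_subgroup G g H\<close> to
  the pair in question.\<close>

lemma commensurator_preimage_finite_index:
  assumes H: "subgroup H G" and g: "g \<in> commensurator G H"
  shows "finite_index_subgroup (G\<lparr>carrier := H\<rparr>) (H \<inter> conjugate_subgroup G (inv g) H)"
proof -
  have HG: "H \<subseteq> carrier G" by (rule subgroup.subset[OF H])
  have gG: "g \<in> carrier G" using g by (simp add: commensurator_def)
  let ?c = "conjugate_subgroup G"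
  have "finite_index_subgroup (G\<lparr>carrier := ?c g H\<rparr>) (H \<inter> ?c g H)"
    using g commensurator_iff[OF H] by blast
  then have "finite_index_subgroup (G\<lparr>carrier := ?c (inv g) (?c g H)\<rparr>) (?c (inv g) (H \<inter> ?c g H))"
    using gG by (intro finite_index_conjugate subgroup_conjugate H) auto
  moreover have "?c (inv g) (?c g H) = H"
    using conjugate_subgroup_inv[OF HG, of "inv g"] gG by simp
  ultimately show ?thesis
    using conjugate_subgroup_Int[OF HG conjugate_subgroup_closed[OF HG gG], of "inv g"] gG
    by (simp add: Int_commute)
qed

end



section \<open>Extension to the commensurator\<close>

lemma homeomorphic_map_bij_betw:
  assumes "homeomorphic_map X Y f"
  shows "bij_betw f (topspace X) (topspace Y)"
  using homeomorphic_imp_injective_map[OF assms] homeomorphic_imp_surjective_map[OF assms]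
  by (simp add: bij_betw_def)

context charge_values
begin

text \<open>The required equation says that \<open>f\<close> is an isomorphism of two flows of
  \<open>?L'\<close> on the same space: the restricted action, and the action of \<open>?L\<close>
  read through conjugation by \<open>g\<close>. Both are universal, as \<open>?L'\<close> and
  \<open>?L\<close> have finite index in \<open>H\<close>, so uniqueness provides
  \<open>f\<close>.\<close>

lemma universal_flow_intertwiner:
  fixes G (structure) and X :: "'x topology"
  assumes G: "group G" and H: "subgroup H G" and X: "universal_flow D (G\<lparr>carrier := H\<rparr>) X a"
    and g: "g \<in> commensurator G H"
  shows "\<exists>f f'. homeomorphic_maps X X f f' \<and>
    (\<forall>t \<in> H \<inter> conjugate_subgroup G (inv g) H. \<forall>x \<in> topspace X.
       f (a t x) = a (g \<otimes> t \<otimes> inv g) (f x))"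
proof -
  interpret group G by (rule G)
  have HG: "H \<subseteq> carrier G" by (rule subgroup.subset[OF H])
  have gG: "g \<in> carrier G" using g by (simp add: commensurator_def)
  let ?c = "conjugate_subgroup G"
  let ?L = "H \<inter> ?c g H" and ?L' = "H \<inter> ?c (inv g) H"
  have cHG: "?c (inv g) H \<subseteq> carrier G" by (rule conjugate_subgroup_closed[OF HG]) (use gG in simp)
  have L': "finite_index_subgroup (G\<lparr>carrier := H\<rparr>) ?L'"
    by (rule commensurator_preimage_finite_index[OF H g])
  have L: "finite_index_subgroup (G\<lparr>carrier := H\<rparr>) ?L" using g commensurator_iff[OF H] by blast
  have XL: "universal_flow D (G\<lparr>carrier := ?L\<rparr>) X a" and XL': "universal_flow D (G\<lparr>carrier := ?L'\<rparr>) X a"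
    using universal_flow_restrict[OF X L] universal_flow_restrict[OF X L'] by simp_all
  have "?c g ?L' = ?L"
    using conjugate_subgroup_Int[OF HG cHG gG] conjugate_subgroup_inv[OF HG gG] by auto
  moreover have "?L' \<subseteq> carrier G" using HG by blast
  ultimately have "(\<lambda>t. g \<otimes> t \<otimes> inv g) \<in> iso (G\<lparr>carrier := ?L'\<rparr>) (G\<lparr>carrier := ?L\<rparr>)"
    using conjugation_iso[OF _ gG] by metis
  then have tw: "universal_flow D (G\<lparr>carrier := ?L'\<rparr>) X (\<lambda>t. a (g \<otimes> t \<otimes> inv g))"
    by (rule universal_flow_twist[OF flow_group[OF universal_flow_flow[OF XL']] _ XL])
  obtain f f' where "homeomorphic_maps X X f f'"
    "\<And>k x. k \<in> carrier (G\<lparr>carrier := ?L'\<rparr>) \<Longrightarrow> x \<in> topspace X \<Longrightarrow>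
       f (a k x) = a (g \<otimes> k \<otimes> inv g) (f x)"
    using universal_flow_unique[OF XL' tw] by blast
  then show ?thesis by auto
qed

text \<open>Two maps that intertwine with \<open>g\<close> on a subgroup of finite index differ by an endomorphism of a
  minimal proximal flow, which is trivial.\<close>

lemma intertwiner_unique:
  assumes X: "universal_flow D (G\<lparr>carrier := H\<rparr>) X a"
    and M: "finite_index_subgroup (G\<lparr>carrier := H\<rparr>) M"
    and f: "homeomorphic_maps X X f f'"
      "\<And>t x. t \<in> M \<Longrightarrow> x \<in> topspace X \<Longrightarrow> f (a t x) = a (\<phi> t) (f x)"
    and p: "continuous_map X X p"
      "\<And>t x. t \<in> M \<Longrightarrow> x \<in> topspace X \<Longrightarrow> p (a t x) = a (\<phi> t) (p x)"
    and x: "x \<in> topspace X"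
  shows "p x = f x"
proof -
  have XM: "universal_flow D (G\<lparr>carrier := M\<rparr>) X a" using universal_flow_restrict[OF X M] by simp
  note flM = universal_flow_flow[OF XM]
  note s = hm_simps[OF f(1)]
  have pto: "p y \<in> topspace X" if "y \<in> topspace X" for y
    using p(1) that by (auto simp: continuous_map_def)
  have "f' (p (a t y)) = a t (f' (p y))" if t: "t \<in> M" and y: "y \<in> topspace X" for t y
  proof -
    have "a t (f' (p y)) \<in> topspace X"
      using flow_maps_to[OF flM _ s(4)[OF pto[OF y]]] t by simp
    then have "a t (f' (p y)) = f' (f (a t (f' (p y))))" by (simp add: s(1))
    also have "\<dots> = f' (a (\<phi> t) (p y))" using f(2)[OF t s(4)[OF pto[OF y]]] s(2)[OF pto[OF y]] by simp
    finally show ?thesis using p(2)[OF t y] by simp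
  qed
  moreover have "continuous_map X X (\<lambda>y. f' (p y))"
    using continuous_map_compose[OF p(1) hm_maps(4)[OF f(1)]] by (simp add: o_def)
  ultimately have "f' (p x) = x"
    by (intro equivariant_maps_agree[OF universal_flow_minimal[OF XM] flM universal_flow_contracting[OF XM]
          _ _ continuous_map_id[unfolded id_def] _ x]) auto
  then show ?thesis using s(2)[OF pto[OF x]] by metis
qed

lemma extend_to_commensurator:
  fixes G (structure) and X :: "'x topology"
  assumes G: "group G" and H: "subgroup H G" and X: "universal_flow D (G\<lparr>carrier := H\<rparr>) X a"
  shows "\<exists>hat \<in> hom (G\<lparr>carrier := commensurator G H\<rparr>) (homeo_group X).
    (\<forall>g \<in> commensurator G H. \<forall>t \<in> H \<inter> conjugate_subgroup G (inv g) H. \<forall>x \<in> topspace X.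
       hat g (a t x) = a (g \<otimes> t \<otimes> inv g) (hat g x)) \<and>
    (\<forall>h \<in> H. \<forall>x \<in> topspace X. hat h x = a h x)"
proof -
  interpret group G by (rule G)
  interpret HH: group "G\<lparr>carrier := H\<rparr>" by (rule subgroup_imp_group[OF H])
  have HG: "H \<subseteq> carrier G" by (rule subgroup.subset[OF H])
  note fl = universal_flow_flow[OF X]
  let ?C = "commensurator G H" and ?c = "conjugate_subgroup G"
  have CG: "?C \<subseteq> carrier G" by (auto simp: commensurator_def)
  let ?Q = "\<lambda>g f f'. homeomorphic_maps X X f f' \<and>
    (\<forall>t \<in> H \<inter> ?c (inv g) H. \<forall>x \<in> topspace X. f (a t x) = a (g \<otimes> t \<otimes> inv g) (f x))"
  have "\<forall>g \<in> ?C. \<exists>f f'. ?Q g f f'"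
    using universal_flow_intertwiner[OF G H X] by blast
  then obtain F F' where "\<forall>g \<in> ?C. ?Q g (F g) (F' g)" by metis
  then have F: "\<And>g. g \<in> ?C \<Longrightarrow> homeomorphic_maps X X (F g) (F' g)"
    "\<And>g t x. g \<in> ?C \<Longrightarrow> t \<in> H \<inter> ?c (inv g) H \<Longrightarrow> x \<in> topspace X \<Longrightarrow>
       F g (a t x) = a (g \<otimes> t \<otimes> inv g) (F g x)" by blast+
  \<comment> \<open>Elements of \<open>Bij\<close> are extensional; restricting the chosen maps
    makes the homomorphism law an equality of functions.\<close>
  define hat where "hat g = restrict (F g) (topspace X)" for g
  have ato: "a t x \<in> topspace X" if "t \<in> H" "x \<in> topspace X" for t x
    using flow_maps_to[OF fl _ that(2)] that(1) by simp
  have "hat \<in> hom (G\<lparr>carrier := ?C\<rparr>) (homeo_group X)"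
  proof (rule homI)
    fix g assume "g \<in> carrier (G\<lparr>carrier := ?C\<rparr>)"
    then have g: "g \<in> ?C" by simp
    have hom: "homeomorphic_map X X (hat g)"
      by (rule homeomorphic_map_eq[OF hm_maps(1)[OF F(1)[OF g]]]) (simp add: hat_def)
    then have "bij_betw (hat g) (topspace X) (topspace X)" by (rule homeomorphic_map_bij_betw)
    then show "hat g \<in> carrier (homeo_group X)"
      using hom by (simp add: homeo_group_def Bij_def hat_def)
  next
    fix g k assume "g \<in> carrier (G\<lparr>carrier := ?C\<rparr>)" "k \<in> carrier (G\<lparr>carrier := ?C\<rparr>)"
    then have gk: "g \<in> ?C" "k \<in> ?C" "g \<in> carrier G" "k \<in> carrier G" using CG by auto
    have gkC: "g \<otimes> k \<in> ?C" by (rule commensurator_mult[OF H gk(1,2)])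
    \<comment> \<open>On this subgroup conjugation by \<open>k\<close> and by
      \<open>g \<otimes> k\<close> both stay in \<open>H\<close>, so \<open>F g\<close> after
      \<open>F k\<close> and \<open>F (g \<otimes> k)\<close> intertwine the same two actions. Its
      index is finite, so \<open>intertwiner_unique\<close> identifies the two maps.\<close>
    let ?M = "(H \<inter> ?c (inv k) H) \<inter> (H \<inter> ?c (inv (g \<otimes> k)) H)"
    have M: "finite_index_subgroup (G\<lparr>carrier := H\<rparr>) ?M"
      by (intro HH.finite_index_subgroup_Int2 commensurator_preimage_finite_index H gk gkC)
    have hF: "continuous_map X X (F g)" "continuous_map X X (F k)"
      using F(1)[OF gk(1)] F(1)[OF gk(2)] by (auto simp: homeomorphic_maps_def)
    have kto: "F k x \<in> topspace X" if "x \<in> topspace X" for x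
      using hF(2) that by (auto simp: continuous_map_def)
    have eq: "F g (F k x) = F (g \<otimes> k) x" if x: "x \<in> topspace X" for x
    proof (rule intertwiner_unique[OF X M F(1)[OF gkC] _ _ _ x,
          where \<phi> = "\<lambda>t. (g \<otimes> k) \<otimes> t \<otimes> inv (g \<otimes> k)"])
      show "F (g \<otimes> k) (a t y) =
          a ((g \<otimes> k) \<otimes> t \<otimes> inv (g \<otimes> k)) (F (g \<otimes> k) y)"
        if "t \<in> ?M" "y \<in> topspace X" for t y
        using F(2)[OF gkC _ that(2)] that(1) by blast
      show "continuous_map X X (\<lambda>x. F g (F k x))"
        using continuous_map_compose[OF hF(2,1)] by (simp add: o_def)
      fix t y assume t: "t \<in> ?M" and y: "y \<in> topspace X"
      have tG: "t \<in> carrier G" using t HG by blast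
      let ?s = "k \<otimes> t \<otimes> inv k"
      have sG: "?s \<in> carrier G" using gk tG by simp
      have "?s \<in> H" using t tG gk conjugate_subgroup_iff[OF HG, of "inv k" t] by simp
      moreover have "g \<otimes> ?s \<otimes> inv g \<in> H"
        using t tG gk conjugate_subgroup_iff[OF HG, of "inv (g \<otimes> k)" t]
        by (simp add: inv_mult_group m_assoc)
      then have "?s \<in> ?c (inv g) H"
        using sG gk conjugate_subgroup_iff[OF HG, of "inv g" ?s] by simp
      ultimately have s: "?s \<in> H \<inter> ?c (inv g) H" by blast
      have "F g (F k (a t y)) = F g (a ?s (F k y))" using F(2)[OF gk(2) _ y] t by simp
      also have "\<dots> = a (g \<otimes> ?s \<otimes> inv g) (F g (F k y))" by (rule F(2)[OF gk(1) s kto[OF y]])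
      also have "g \<otimes> ?s \<otimes> inv g = (g \<otimes> k) \<otimes> t \<otimes> inv (g \<otimes> k)"
        using gk tG by (simp add: inv_mult_group m_assoc)
      finally show "F g (F k (a t y)) =
          a ((g \<otimes> k) \<otimes> t \<otimes> inv (g \<otimes> k)) (F g (F k y))" .
    qed
    have Bij: "hat l \<in> Bij (topspace X)" if "l \<in> ?C" for l
    proof -
      have "homeomorphic_map X X (F l)" by (rule hm_maps(1)[OF F(1)[OF that]])
      then have "bij_betw (F l) (topspace X) (topspace X)" by (rule homeomorphic_map_bij_betw)
      then show ?thesis by (simp add: hat_def Bij_def)
    qed
    have "hat (g \<otimes> k) = compose (topspace X) (hat g) (hat k)"
    proof
      fix x show "hat (g \<otimes> k) x = compose (topspace X) (hat g) (hat k) x"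
        using eq kto by (cases "x \<in> topspace X") (simp_all add: hat_def compose_def)
    qed
    then show "hat (g \<otimes>\<^bsub>G\<lparr>carrier := ?C\<rparr>\<^esub> k) = hat g \<otimes>\<^bsub>homeo_group X\<^esub> hat k"
      using Bij gk by (simp add: homeo_group_def BijGroup_def)
  qed
  moreover have "hat g (a t x) = a (g \<otimes> t \<otimes> inv g) (hat g x)"
    if "g \<in> ?C" "t \<in> H \<inter> ?c (inv g) H" "x \<in> topspace X" for g t x
    using F(2)[OF that] that ato by (simp add: hat_def)
  moreover have "hat h x = a h x" if h: "h \<in> H" and x: "x \<in> topspace X" for h x
  proof -
    have hG: "h \<in> carrier G" using h HG by blast
    have sub: "?c k H \<subseteq> H" if "k \<in> H" for k
      using that by (auto simp: conjugate_subgroup_image subgroup.m_closed[OF H] subgroup.m_inv_closed[OF H])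
    have cH: "?c k H = H" if k: "k \<in> H" for k
    proof
      have "?c k (?c (inv k) H) \<subseteq> ?c k H"
        using sub[OF subgroup.m_inv_closed[OF H k]] unfolding conjugate_subgroup_image[of k]
        by (rule image_mono)
      then show "H \<subseteq> ?c k H" using conjugate_subgroup_inv[OF HG, of k] k HG by auto
    qed (rule sub[OF k])
    have "finite_index_subgroup (G\<lparr>carrier := H\<rparr>) H"
      by (rule HH.finite_index_subgroupI[where \<phi> = "\<lambda>_. ()"])
        (use HH.subgroup_self HH.m_closed HH.inv_closed in auto)
    then have fi: "finite_index_subgroup (G\<lparr>carrier := H\<rparr>) H" "h \<in> ?C"
      using cH[OF h] hG commensurator_iff[OF H] by auto
    \<comment> \<open>The action of \<open>h\<close> is itself an intertwiner for conjugation by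
      \<open>h\<close>, on all of \<open>H\<close> because \<open>h\<close> normalises
      \<open>H\<close>. Uniqueness identifies it with the chosen \<open>F h\<close>.\<close>
    have "a h x = F h x"
    proof (rule intertwiner_unique[OF X fi(1) F(1)[OF fi(2)] _ _ _ x,
          where \<phi> = "\<lambda>t. h \<otimes> t \<otimes> inv h"])
      fix t y assume t: "t \<in> H" and y: "y \<in> topspace X"
      show "F h (a t y) = a (h \<otimes> t \<otimes> inv h) (F h y)"
        using F(2)[OF fi(2) _ y] t cH[OF subgroup.m_inv_closed[OF H h]] by simp
      have "h \<otimes> t \<otimes> inv h \<in> H"
        using h t by (intro subgroup.m_closed[OF H] subgroup.m_inv_closed[OF H])
      then have "a (h \<otimes> t \<otimes> inv h) (a h y) = a (h \<otimes> t \<otimes> inv h \<otimes> h) y"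
        using flow_mult[OF fl _ _ y] h by simp
      also have "h \<otimes> t \<otimes> inv h \<otimes> h = h \<otimes> t" using t HG hG by (simp add: m_assoc subsetD)
      also have "a (h \<otimes> t) y = a h (a t y)" using flow_mult[OF fl _ _ y] h t by simp
      finally show "a h (a t y) = a (h \<otimes> t \<otimes> inv h) (a h y)" by simp
    qed (use flow_continuous[OF fl] h in simp)
    then show ?thesis using x by (simp add: hat_def)
  qed
  ultimately show ?thesis by blast
qed

text \<open>Restricted to \<open>L\<close>, both \<open>X\<close> and \<open>Z\<close> are
  universal, hence isomorphic to \<open>Y\<close>. The actions \<open>b1\<close> and
  \<open>b2\<close> are those of \<open>H\<close> and \<open>Hg\<close> transported along these
  isomorphisms, which settles the outer two links. For the middle link, \<open>Z\<close> read
  through conjugation by \<open>g\<close> is a universal flow of \<open>H\<close> and therefore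
  isomorphic to \<open>X\<close>.\<close>

lemma extended_flows_isomorphic:
  fixes G (structure) and X :: "'x topology" and Y :: "'y topology" and Z :: "'z topology"
  assumes G: "group G" and H: "subgroup H G" and X: "universal_flow D (G\<lparr>carrier := H\<rparr>) X a"
    and g: "g \<in> commensurator G H"
    and Hg: "Hg = conjugate_subgroup G g H" and L: "L = H \<inter> Hg"
    and Y: "universal_flow D (G\<lparr>carrier := L\<rparr>) Y b"
    and Z: "universal_flow D (G\<lparr>carrier := Hg\<rparr>) Z c"
  shows "\<exists>b1 b2.
    flow (G\<lparr>carrier := H\<rparr>) (discrete_topology H) Y b1 \<and> extends_action L Y b1 b \<and>
    flow (G\<lparr>carrier := Hg\<rparr>) (discrete_topology Hg) Y b2 \<and> extends_action L Y b2 b \<and>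
    flow_isomorphic (G\<lparr>carrier := H\<rparr>) X a Y b1 \<and>
    flow_isomorphic_along (\<lambda>h. g \<otimes> h \<otimes> inv g)
      (G\<lparr>carrier := H\<rparr>) Y b1 (G\<lparr>carrier := Hg\<rparr>) Y b2 \<and>
    flow_isomorphic (G\<lparr>carrier := Hg\<rparr>) Y b2 Z c"
proof -
  interpret group G by (rule G)
  have HG: "H \<subseteq> carrier G" by (rule subgroup.subset[OF H])
  have gG: "g \<in> carrier G" using g by (simp add: commensurator_def)
  have fi: "finite_index_subgroup (G\<lparr>carrier := H\<rparr>) L" "finite_index_subgroup (G\<lparr>carrier := Hg\<rparr>) L"
    using g commensurator_iff[OF H] Hg L by auto
  have XL: "universal_flow D (G\<lparr>carrier := L\<rparr>) X a" using universal_flow_restrict[OF X fi(1)] by simp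
  have ZL: "universal_flow D (G\<lparr>carrier := L\<rparr>) Z c" using universal_flow_restrict[OF Z fi(2)] by simp
  note flX = universal_flow_flow[OF X] and flZ = universal_flow_flow[OF Z]
  obtain p p' where p: "homeomorphic_maps X Y p p'"
    "\<And>k x. k \<in> L \<Longrightarrow> x \<in> topspace X \<Longrightarrow> p (a k x) = b k (p x)"
    using universal_flow_unique[OF XL Y] by auto
  obtain q q' where q: "homeomorphic_maps Z Y q q'"
    "\<And>k z. k \<in> L \<Longrightarrow> z \<in> topspace Z \<Longrightarrow> q (c k z) = b k (q z)"
    using universal_flow_unique[OF ZL Y] by auto
  let ?\<phi> = "\<lambda>h. g \<otimes> h \<otimes> inv g"
  have iso: "?\<phi> \<in> iso (G\<lparr>carrier := H\<rparr>) (G\<lparr>carrier := Hg\<rparr>)"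
    unfolding Hg by (rule conjugation_iso[OF HG gG])
  have tw: "universal_flow D (G\<lparr>carrier := H\<rparr>) Z (\<lambda>h. c (?\<phi> h))"
    by (rule universal_flow_twist[OF flow_group[OF flX] iso Z])
  obtain r r' where r: "homeomorphic_maps X Z r r'"
    "\<And>h x. h \<in> H \<Longrightarrow> x \<in> topspace X \<Longrightarrow> r (a h x) = c (?\<phi> h) (r x)"
    using universal_flow_unique[OF X tw] by auto
  note sp = hm_simps[OF p(1)] and sq = hm_simps[OF q(1)] and sr = hm_simps[OF r(1)]
  define b1 where "b1 = transport_action Y p p' a"
  define b2 where "b2 = transport_action Y q q' c"
  have b1: "b1 k y = p (a k (p' y))" if "y \<in> topspace Y" for k y
    using that by (simp add: b1_def transport_action_def)
  have b2: "b2 k y = q (c k (q' y))" if "y \<in> topspace Y" for k y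
    using that by (simp add: b2_def transport_action_def)
  have ato: "a h x \<in> topspace X" if "h \<in> H" "x \<in> topspace X" for h x
    using flow_maps_to[OF flX _ that(2)] that(1) by simp
  have cto: "c h z \<in> topspace Z" if "h \<in> Hg" "z \<in> topspace Z" for h z
    using flow_maps_to[OF flZ _ that(2)] that(1) by simp
  have id: "(\<lambda>k. k) \<in> iso S S" for S :: "('g, 'h) monoid_scheme" 
    by (simp add: iso_def hom_def bij_betw_def)
  have "flow (G\<lparr>carrier := H\<rparr>) (discrete_topology H) Y b1"
    using flow_transport[OF p(1) flX] by (simp add: b1_def)
  moreover have "flow (G\<lparr>carrier := Hg\<rparr>) (discrete_topology Hg) Y b2"
    using flow_transport[OF q(1) flZ] by (simp add: b2_def)
  moreover have "extends_action L Y b1 b" "extends_action L Y b2 b"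
    using p(2) q(2) sp sq by (auto simp: extends_action_def b1 b2)
  moreover have "flow_isomorphic (G\<lparr>carrier := H\<rparr>) X a Y b1"
    unfolding flow_isomorphic_along_def
    using id hm_maps(1)[OF p(1)] sp by (intro conjI exI[of _ p]) (auto simp: b1)
  moreover have "flow_isomorphic (G\<lparr>carrier := Hg\<rparr>) Y b2 Z c"
    unfolding flow_isomorphic_along_def
    using id hm_maps(2)[OF q(1)] sq cto by (intro conjI exI[of _ q']) (auto simp: b2)
  \<comment> \<open>The isomorphism goes from \<open>Y\<close> back to \<open>X\<close>, across to
    \<open>Z\<close> by the conjugation-equivariant \<open>r\<close>, and into \<open>Y\<close>
    again.\<close>
  moreover have "flow_isomorphic_along ?\<phi> (G\<lparr>carrier := H\<rparr>) Y b1 (G\<lparr>carrier := Hg\<rparr>) Y b2"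
    unfolding flow_isomorphic_along_def
  proof (intro conjI iso exI[of _ "q \<circ> (r \<circ> p')"])
    show "homeomorphic_map Y Y (q \<circ> (r \<circ> p'))"
      by (rule homeomorphic_map_compose[OF homeomorphic_map_compose[OF
              hm_maps(2)[OF p(1)] hm_maps(1)[OF r(1)]] hm_maps(1)[OF q(1)]])
    show "\<forall>k \<in> carrier (G\<lparr>carrier := H\<rparr>). \<forall>y \<in> topspace Y.
        (q \<circ> (r \<circ> p')) (b1 k y) = b2 (?\<phi> k) ((q \<circ> (r \<circ> p')) y)"
      using r(2) sp sq sr ato by (simp add: b1 b2)
  qed
  ultimately show ?thesis by blast
qed

end

section \<open>Back from charges to proximal and strongly proximal flows\<close>

lemma minimal_proximal_iff:
  "discrete_minimal_flow K X a \<and> proximal_action K X a \<longleftrightarrow>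
    discrete_minimal_flow K X a \<and> contracting {0, 1/2, 1} K X a"
  using proximal_iff_contracting[OF minimal_flow_flow] by blast

lemma minimal_strongly_proximal_iff:
  "discrete_minimal_flow K X a \<and> strongly_proximal_action K X a \<longleftrightarrow>
    discrete_minimal_flow K X a \<and> contracting {0..1} K X a"
  using strongly_proximal_iff_contracting[OF minimal_flow_flow] by blast

lemma universal_minimal_proximal_flow_iff:
  "universal_minimal_proximal_flow (G\<lparr>carrier := S\<rparr>) (discrete_topology S) X a \<longleftrightarrow>
    universal_flow {0, 1/2, 1} (G\<lparr>carrier := S\<rparr>) X a"
  unfolding universal_minimal_proximal_flow_def universal_flow_def
  by (simp add: minimal_proximal_iff[of "G\<lparr>carrier := S\<rparr>", simplified] flip: conj_assoc)

lemma universal_minimal_strongly_proximal_flow_iff: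
  "universal_minimal_strongly_proximal_flow (G\<lparr>carrier := S\<rparr>) (discrete_topology S) X a \<longleftrightarrow>
    universal_flow {0..1} (G\<lparr>carrier := S\<rparr>) X a"
  unfolding universal_minimal_strongly_proximal_flow_def universal_flow_def
  by (simp add: minimal_strongly_proximal_iff[of "G\<lparr>carrier := S\<rparr>", simplified] flip: conj_assoc)

theorem theorem6p1:
  fixes G :: "('g, 'm) monoid_scheme" and H :: "'g set"
  assumes "group G" and "subgroup H G" and "countable (commensurator G H)"
  shows
    "(\<forall>(X :: 'x topology) a.
        universal_minimal_proximal_flow (G\<lparr>carrier := H\<rparr>) (discrete_topology H) X a \<longrightarrow>
        (\<exists>hat \<in> hom (G\<lparr>carrier := commensurator G H\<rparr>) (homeo_group X).
           (\<forall>g \<in> commensurator G H. \<forall>t \<in> H \<inter> conjugate_subgroup G (inv\<^bsub>G\<^esub> g) H. \<forall>x \<in> topspace X.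
              hat g (a t x) = a (g \<otimes>\<^bsub>G\<^esub> t \<otimes>\<^bsub>G\<^esub> inv\<^bsub>G\<^esub> g) (hat g x)) \<and>
           (\<forall>h \<in> H. \<forall>x \<in> topspace X. hat h x = a h x) \<and>
           (\<forall>g \<in> commensurator G H.
              let Hg = conjugate_subgroup G g H; L = H \<inter> Hg in
              \<forall>(Y :: 'y topology) b (Z :: 'z topology) c.
                universal_minimal_proximal_flow (G\<lparr>carrier := L\<rparr>) (discrete_topology L) Y b \<longrightarrow>
                universal_minimal_proximal_flow (G\<lparr>carrier := Hg\<rparr>) (discrete_topology Hg) Z c \<longrightarrow>
                (\<exists>b1 b2.
                   flow (G\<lparr>carrier := H\<rparr>) (discrete_topology H) Y b1 \<and> extends_action L Y b1 b \<and>
                   flow (G\<lparr>carrier := Hg\<rparr>) (discrete_topology Hg) Y b2 \<and> extends_action L Y b2 b \<and>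
                   flow_isomorphic (G\<lparr>carrier := H\<rparr>) X a Y b1 \<and>
                   flow_isomorphic_along (\<lambda>h. g \<otimes>\<^bsub>G\<^esub> h \<otimes>\<^bsub>G\<^esub> inv\<^bsub>G\<^esub> g)
                     (G\<lparr>carrier := H\<rparr>) Y b1 (G\<lparr>carrier := Hg\<rparr>) Y b2 \<and>
                   flow_isomorphic (G\<lparr>carrier := Hg\<rparr>) Y b2 Z c))))
     \<and>
     (\<forall>(X :: 'x topology) a.
        universal_minimal_strongly_proximal_flow (G\<lparr>carrier := H\<rparr>) (discrete_topology H) X a \<longrightarrow>
        (\<exists>hat \<in> hom (G\<lparr>carrier := commensurator G H\<rparr>) (homeo_group X).
           (\<forall>g \<in> commensurator G H. \<forall>t \<in> H \<inter> conjugate_subgroup G (inv\<^bsub>G\<^esub> g) H. \<forall>x \<in> topspace X.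
              hat g (a t x) = a (g \<otimes>\<^bsub>G\<^esub> t \<otimes>\<^bsub>G\<^esub> inv\<^bsub>G\<^esub> g) (hat g x)) \<and>
           (\<forall>h \<in> H. \<forall>x \<in> topspace X. hat h x = a h x) \<and>
           (\<forall>g \<in> commensurator G H.
              let Hg = conjugate_subgroup G g H; L = H \<inter> Hg in
              \<forall>(Y :: 'y topology) b (Z :: 'z topology) c.
                universal_minimal_strongly_proximal_flow (G\<lparr>carrier := L\<rparr>) (discrete_topology L) Y b \<longrightarrow>
                universal_minimal_strongly_proximal_flow (G\<lparr>carrier := Hg\<rparr>) (discrete_topology Hg) Z c \<longrightarrow>
                (\<exists>b1 b2.
                   flow (G\<lparr>carrier := H\<rparr>) (discrete_topology H) Y b1 \<and> extends_action L Y b1 b \<and>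
                   flow (G\<lparr>carrier := Hg\<rparr>) (discrete_topology Hg) Y b2 \<and> extends_action L Y b2 b \<and>
                   flow_isomorphic (G\<lparr>carrier := H\<rparr>) X a Y b1 \<and>
                   flow_isomorphic_along (\<lambda>h. g \<otimes>\<^bsub>G\<^esub> h \<otimes>\<^bsub>G\<^esub> inv\<^bsub>G\<^esub> g)
                     (G\<lparr>carrier := H\<rparr>) Y b1 (G\<lparr>carrier := Hg\<rparr>) Y b2 \<and>
                   flow_isomorphic (G\<lparr>carrier := Hg\<rparr>) Y b2 Z c))))"
proof -
  \<comment> \<open>The chain of isomorphisms does not mention \<open>hat\<close>, so it can be
    split off from the existential statement about \<open>hat\<close>.\<close>
  have bex_conjI: "\<exists>x \<in> A. P x \<and> Q x \<and> R" if "\<exists>x \<in> A. P x \<and> Q x" R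
    for A and P Q :: "('g \<Rightarrow> 'x \<Rightarrow> 'x) \<Rightarrow> bool" and R
    using that by blast
  show ?thesis
    unfolding universal_minimal_proximal_flow_iff universal_minimal_strongly_proximal_flow_iff Let_def
    by (intro conjI allI ballI impI bex_conjI
        pairs.extend_to_commensurator[OF assms(1,2)]
        pairs.extended_flows_isomorphic[OF assms(1,2) _ _ refl refl]
        all_charges.extend_to_commensurator[OF assms(1,2)]
        all_charges.extended_flows_isomorphic[OF assms(1,2) _ _ refl refl])
qed

end
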